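(* Let $n\ge1$, $0<\alpha\le1$, and let $\Omega\subset\mathbb{R}^n$ be a bounded domain with $C^{4,\alpha}$-smooth boundary. Let $a_{ij},b_i\in C^{2,\alpha}(\overline\Omega)$ ($1\le i,j\le n$), $c\in C^{0,\alpha}(\overline\Omega)$, and assume there is $\lambda>0$ with $\sum_{i,j}a_{ij}(x)\xi_i\xi_j\ge\lambda|\xi|^2$ for all $x\in\Omega$, $\xi\in\mathbb{R}^n$. Define $Lu=\sum_{i,j=1}^n a_{ij}\,\partial_{x_i}\partial_{x_j}u+\sum_{i=1}^n b_i\,\partial_{x_i}u+cu$. Then the space $$X=\{u\in C^{2,\alpha}(\overline\Omega)\ :\ u=0,\ Lu=0\ \text{on}\ \partial\Omega\}$$ can be continuously and linearly embedded into $C^{2,\alpha}_c(\mathbb{R}^n)$ by an extension operator preserving the sup-norm: there is a linear map $E:X\to C^{2,\alpha}_c(\mathbb{R}^n)$, continuous with respect to the $C^{2,\alpha}$-norms, with $Eu=u$ on $\overline\Omega$ and $\sup_{\mathbb{R}^n}|Eu|=\sup_{\overline\Omega}|u|$ for all $u\in X$.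
   Context: $C^{k,\alpha}(\overline\Omega)$ is the space of $k$ times continuously differentiable functions on $\Omega$ whose derivatives up to order $k$ extend continuously to $\overline\Omega$, with the $k$-th derivatives $\alpha$-Hölder continuous on $\overline\Omega$, equipped with the usual $C^{k,\alpha}$-norm. $Lu$ on $\partial\Omega$ is understood through these continuous extensions. $C^{2,\alpha}_c(\mathbb{R}^n)$ is the space of compactly supported functions in $C^{2,\alpha}(\mathbb{R}^n)$ with the $C^{2,\alpha}$-norm. *)

theory Defs
  imports "HOL-Analysis.Analysis"
begin

definition partial :: "'n::finite \<Rightarrow> (real^'n \<Rightarrow> real) \<Rightarrow> real^'n \<Rightarrow> real" where
  "partial i f x = deriv (\<lambda>t. f (x + t *\<^sub>R axis i 1)) 0"

(* partials [i1, ..., ij] f is the iterated derivative of f in the coordinates i1, ..., ij.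
   Lists play the role of multi-indices, with order given by the length. *)
definition partials :: "'n::finite list \<Rightarrow> (real^'n \<Rightarrow> real) \<Rightarrow> real^'n \<Rightarrow> real" where
  "partials is f = foldr partial is f"

(* For f continuous on an open set U, this is the only candidate for a continuous extension of f
   to the closure of U; such an extension exists iff continuous_on (closure U) (closure_ext U f). *)
definition closure_ext :: "(real^'n::finite) set \<Rightarrow> (real^'n \<Rightarrow> real) \<Rightarrow> real^'n \<Rightarrow> real" where
  "closure_ext U f x = (if x \<in> U then f x else Lim (at x within U) f)"

definition holder_continuous_on ::
    "(real^'n::finite) set \<Rightarrow> real \<Rightarrow> (real^'n \<Rightarrow> real) \<Rightarrow> bool" where
  "holder_continuous_on S \<alpha> f \<longleftrightarrow>
     (\<exists>C. \<forall>x\<in>S. \<forall>y\<in>S. \<bar>f x - f y\<bar> \<le> C * dist x y powr \<alpha>)"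

(* u restricted to the closure of the open set U belongs to C^{k,alpha}(closure U).  The values of
   u outside the closure are irrelevant; those on the boundary are the ones given by continuity. *)
definition C_holder_on ::
    "nat \<Rightarrow> real \<Rightarrow> (real^'n::finite) set \<Rightarrow> (real^'n \<Rightarrow> real) \<Rightarrow> bool" where
  "C_holder_on k \<alpha> U u \<longleftrightarrow>
     continuous_on (closure U) u \<and>
     (\<forall>is. length is < k \<longrightarrow> partials is u differentiable_on U) \<and>
     (\<forall>is. length is \<le> k \<longrightarrow> continuous_on (closure U) (closure_ext U (partials is u))) \<and>
     (\<forall>is. length is = k \<longrightarrow> holder_continuous_on (closure U) \<alpha> (closure_ext U (partials is u)))"

(* The space C^{k,alpha}(closure U) itself.  A function on the closure of U is represented by its
   extension by 0 to the whole space, so that elements correspond exactly to functions on the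
   closure and the vector space operations are the pointwise ones. *)
definition holder_space :: "nat \<Rightarrow> real \<Rightarrow> (real^'n::finite) set \<Rightarrow> (real^'n \<Rightarrow> real) set" where
  "holder_space k \<alpha> U = {u. C_holder_on k \<alpha> U u \<and> (\<forall>x. x \<notin> closure U \<longrightarrow> u x = 0)}"

(* sum_{j <= k} sup_{|beta| = j} sup_U |D^beta u|  +  sup_{|beta| = k} [D^beta u]_{alpha;U}.
   For u of class C^{k,alpha}, the supremum over lists of length j equals the one over
   multi-indices of order j, and suprema over U equal those over its closure.
   The suprema are meaningful on bounded U, and for compactly supported u on U = UNIV. *)
definition holder_norm ::
    "nat \<Rightarrow> real \<Rightarrow> (real^'n::finite) set \<Rightarrow> (real^'n \<Rightarrow> real) \<Rightarrow> real" where
  "holder_norm k \<alpha> U u =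
     (\<Sum>j\<le>k. SUP (is, x) \<in> {is. length is = j} \<times> U. \<bar>partials is u x\<bar>) +
     (SUP (is, x, y) \<in> {(is, x, y). length is = k \<and> x \<in> U \<and> y \<in> U \<and> x \<noteq> y}.
        \<bar>partials is u x - partials is u y\<bar> / dist x y powr \<alpha>)"

definition holder_space_compact_support ::
    "nat \<Rightarrow> real \<Rightarrow> (real^'n::finite \<Rightarrow> real) set" where
  "holder_space_compact_support k \<alpha> =
     {u \<in> holder_space k \<alpha> UNIV. compact (closure {x. u x \<noteq> 0})}"

(* Boundary of class C^{k,alpha} in the sense of Gilbarg-Trudinger: near every boundary point there
   is a C^{k,alpha} diffeomorphism psi from a ball B onto an open set D that maps B inter U into an
   open coordinate half-space and B inter frontier U into the bounding hyperplane.
   Shrinking B, one may ask for C^{k,alpha} regularity up to the closures of B and D. *)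
definition holder_boundary :: "nat \<Rightarrow> real \<Rightarrow> (real^'n::finite) set \<Rightarrow> bool" where
  "holder_boundary k \<alpha> U \<longleftrightarrow>
     (\<forall>p\<in>frontier U. \<exists>r>0. \<exists>D \<psi> \<phi>. \<exists>m::'n.
        open D \<and> homeomorphism (ball p r) D \<psi> \<phi> \<and>
        \<psi> ` (ball p r \<inter> U) \<subseteq> {y. 0 < y $ m} \<and>
        \<psi> ` (ball p r \<inter> frontier U) \<subseteq> {y. y $ m = 0} \<and>
        (\<forall>i. C_holder_on k \<alpha> (ball p r) (\<lambda>x. \<psi> x $ i)) \<and>
        (\<forall>i. C_holder_on k \<alpha> D (\<lambda>y. \<phi> y $ i)))"

(* The operator L on the closure of U, with the derivatives of u extended continuously. *)
definition L_op ::
    "(real^'n::finite) set \<Rightarrow> ('n \<Rightarrow> 'n \<Rightarrow> real^'n \<Rightarrow> real) \<Rightarrow> ('n \<Rightarrow> real^'n \<Rightarrow> real) \<Rightarrow>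
     (real^'n \<Rightarrow> real) \<Rightarrow> (real^'n \<Rightarrow> real) \<Rightarrow> real^'n \<Rightarrow> real" where
  "L_op U a b c u x =
     (\<Sum>i\<in>UNIV. \<Sum>j\<in>UNIV. a i j x * closure_ext U (partials [i, j] u) x) +
     (\<Sum>i\<in>UNIV. b i x * closure_ext U (partials [i] u) x) + c x * u x"

definition X_space ::
    "real \<Rightarrow> (real^'n::finite) set \<Rightarrow> ('n \<Rightarrow> 'n \<Rightarrow> real^'n \<Rightarrow> real) \<Rightarrow> ('n \<Rightarrow> real^'n \<Rightarrow> real) \<Rightarrow>
     (real^'n \<Rightarrow> real) \<Rightarrow> (real^'n \<Rightarrow> real) set" where
  "X_space \<alpha> \<Omega> a b c =
     {u \<in> holder_space 2 \<alpha> \<Omega>. \<forall>x\<in>frontier \<Omega>. u x = 0 \<and> L_op \<Omega> a b c u x = 0}"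

end

theory Submission
  imports Defs
begin

text \<open>
Across the boundary, \<open>u\<close> is continued by odd reflection. If \<open>\<Omega>\<close> were the half-space \<open>y\<^sub>m > 0\<close>,
the continuation \<open>y \<mapsto> - u (mirror y)\<close> of a function \<open>u\<close> vanishing on \<open>y\<^sub>m = 0\<close> would match \<open>u\<close>
there up to first order, and up to second order precisely where the second normal derivative of
\<open>u\<close> vanishes. The equation does not give that; it gives, with
\<open>\<alpha>\<^sub>k\<^sub>l\<close> and \<open>\<beta>\<^sub>k\<close> the coefficients normalised so that \<open>\<alpha>\<^sub>m\<^sub>m = 1\<close>,
\<open>u\<^sub>m\<^sub>m + (\<Sum>k\<noteq>m. (\<alpha>\<^sub>k\<^sub>m + \<alpha>\<^sub>m\<^sub>k) u\<^sub>k\<^sub>m) + \<beta>\<^sub>m u\<^sub>m = 0\<close> on the boundary, since all tangential derivatives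
of \<open>u\<close> vanish. The reflection is therefore bent: \<open>R\<close> sends \<open>y\<close> to a point displaced from its mirror
image by terms of first order in tangential and of second order in normal direction, with
coefficients \<open>\<alpha>\<^sub>k\<^sub>m + \<alpha>\<^sub>m\<^sub>k\<close> and \<open>\<beta>\<^sub>m\<close>, chosen such that the second normal derivative of \<open>- u \<circ> R\<close>
equals that of \<open>u\<close> exactly when the equation holds (\<open>flat_reflection\<close>). The map \<open>R\<close> is as regular
as the coefficients, hence \<open>C\<^bsup>2,\<alpha>\<^esup>\<close>, and so is the continued function. Boundary charts of class
\<open>C\<^bsup>4,\<alpha>\<^esup>\<close> transport the operator to the half-space without leaving \<open>C\<^bsup>2,\<alpha>\<^esup>\<close> coefficients, because
the transformed first-order coefficients contain at most two derivatives of the chart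
(\<open>boundary_reflection\<close>). Ellipticity is what allows to normalise \<open>\<alpha>\<^sub>m\<^sub>m = 1\<close>.

Locally the extension is thus a composition operator: it takes the value \<open>u x\<close> or \<open>- u (\<rho> x)\<close> with
\<open>\<rho> x\<close> in the closure of \<open>\<Omega>\<close>. It is linear in \<open>u\<close> and does not increase the supremum norm. A
partition of unity with sum at most \<open>1\<close> everywhere and equal to \<open>1\<close> on the closure of \<open>\<Omega>\<close> glues
finitely many of these operators and keeps both properties (\<open>global_extension\<close>).

All estimates are carried by the predicate \<open>holder_bd\<close>, which contains the bound \<open>K\<close> explicitly.
Every step maps a function with bound \<open>K\<close> to one with bound \<open>C * K\<close>, where \<open>C\<close> depends only on the
domain and the coefficients; applied to \<open>v - u\<close>, this is the continuity of the operator.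
\<close>

section \<open>Gradients relative to a set\<close>

text \<open>The derivative is taken within \<open>S\<close>, so that one notion serves open sets and the closed half-balls on
which functions are reflected and glued.\<close>

definition has_gradient_on ::
    "(real^'n::finite \<Rightarrow> real) \<Rightarrow> ('n \<Rightarrow> real^'n \<Rightarrow> real) \<Rightarrow> (real^'n) set \<Rightarrow> bool" where
  "has_gradient_on f g S \<longleftrightarrow>
     (\<forall>x\<in>S. (f has_derivative (\<lambda>h. \<Sum>i\<in>UNIV. g i x * h $ i)) (at x within S))"

lemma has_gradient_onD:
  "has_gradient_on f g S \<Longrightarrow> x \<in> S \<Longrightarrow>
    (f has_derivative (\<lambda>h. \<Sum>i\<in>UNIV. g i x * h $ i)) (at x within S)"
  by (simp add: has_gradient_on_def)

lemma has_gradient_on_subset: "has_gradient_on f g S \<Longrightarrow> T \<subseteq> S \<Longrightarrow> has_gradient_on f g T"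
  unfolding has_gradient_on_def by (meson has_derivative_subset subsetD)

lemma has_gradient_on_cong:
  assumes "has_gradient_on f g S" "\<And>x. x \<in> S \<Longrightarrow> f' x = f x" "\<And>i x. x \<in> S \<Longrightarrow> g' i x = g i x"
  shows "has_gradient_on f' g' S"
  unfolding has_gradient_on_def
proof
  fix x assume x: "x \<in> S"
  have "(f has_derivative (\<lambda>h. \<Sum>i\<in>UNIV. g' i x * h $ i)) (at x within S)"
    using has_gradient_onD[OF assms(1) x] assms(3)[OF x] by simp
  then show "(f' has_derivative (\<lambda>h. \<Sum>i\<in>UNIV. g' i x * h $ i)) (at x within S)"
    by (rule has_derivative_transform[rotated 2]) (use x assms(2) in auto)
qed

lemma has_gradient_on_const: "has_gradient_on (\<lambda>x. c) (\<lambda>i x. 0) S"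
  unfolding has_gradient_on_def by simp

lemma has_gradient_on_component:
  "has_gradient_on (\<lambda>x. x $ k) (\<lambda>i x. if i = k then 1 else 0) S"
proof -
  have "((\<lambda>x. x $ k) has_derivative (\<lambda>h. h $ k)) (at x within S)" for x
    by (rule bounded_linear_imp_has_derivative[OF bounded_linear_vec_nth])
  moreover have "(\<Sum>i\<in>UNIV. (if i = k then 1 else 0) * h $ i) = h $ k" for h :: "real^'a"
    by (simp add: if_distrib[of "\<lambda>x. x * _"] cong: if_cong)
  ultimately show ?thesis
    unfolding has_gradient_on_def by simp
qed

lemma has_gradient_on_add:
  assumes "has_gradient_on f f' S" "has_gradient_on g g' S"
  shows "has_gradient_on (\<lambda>x. f x + g x) (\<lambda>i x. f' i x + g' i x) S"
  unfolding has_gradient_on_def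
proof
  fix x assume x: "x \<in> S"
  show "((\<lambda>x. f x + g x) has_derivative (\<lambda>h. \<Sum>i\<in>UNIV. (f' i x + g' i x) * h $ i)) (at x within S)"
    using has_derivative_add[OF has_gradient_onD[OF assms(1) x] has_gradient_onD[OF assms(2) x]]
    by (simp add: algebra_simps sum.distrib)
qed

lemma has_gradient_on_mult:
  assumes "has_gradient_on f f' S" "has_gradient_on g g' S"
  shows "has_gradient_on (\<lambda>x. f x * g x) (\<lambda>i x. f' i x * g x + f x * g' i x) S"
  unfolding has_gradient_on_def
proof
  fix x assume x: "x \<in> S"
  show "((\<lambda>x. f x * g x) has_derivative
      (\<lambda>h. \<Sum>i\<in>UNIV. (f' i x * g x + f x * g' i x) * h $ i)) (at x within S)"
    by (rule has_derivative_eq_rhs[OF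
          has_derivative_mult[OF has_gradient_onD[OF assms(1) x] has_gradient_onD[OF assms(2) x]]])
      (simp add: fun_eq_iff algebra_simps sum.distrib sum_distrib_left)
qed

lemma has_gradient_on_cmult:
  assumes "has_gradient_on f f' S"
  shows "has_gradient_on (\<lambda>x. c * f x) (\<lambda>i x. c * f' i x) S"
  using has_gradient_on_mult[OF has_gradient_on_const assms, of c] by simp

lemma has_gradient_on_sum:
  assumes "finite I" "\<And>j. j \<in> I \<Longrightarrow> has_gradient_on (f j) (f' j) S"
  shows "has_gradient_on (\<lambda>x. \<Sum>j\<in>I. f j x) (\<lambda>i x. \<Sum>j\<in>I. f' j i x) S"
  using assms
proof (induction I)
  case empty then show ?case by (simp add: has_gradient_on_const)
next
  case (insert j I) then show ?case by (simp add: has_gradient_on_add)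
qed

lemma has_gradient_on_chain:
  assumes h: "\<And>x. x \<in> S \<Longrightarrow> (h has_field_derivative h' x) (at (f x) within f ` S)"
    and f: "has_gradient_on f f' S"
  shows "has_gradient_on (\<lambda>x. h (f x)) (\<lambda>i x. h' x * f' i x) S"
  unfolding has_gradient_on_def
proof
  fix x assume x: "x \<in> S"
  have "(h has_derivative (*) (h' x)) (at (f x) within f ` S)"
    using h[OF x] by (simp add: has_field_derivative_def)
  from has_derivative_in_compose[OF has_gradient_onD[OF f x] this]
  show "((\<lambda>x. h (f x)) has_derivative (\<lambda>y. \<Sum>i\<in>UNIV. h' x * f' i x * y $ i)) (at x within S)"
    by (simp add: sum_distrib_left mult.assoc)
qed

lemma has_gradient_on_compose:
  assumes f: "has_gradient_on f f' T" and \<phi>: "\<And>k. has_gradient_on (\<lambda>x. \<phi> x $ k) (\<phi>' k) S"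
    and sub: "\<And>x. x \<in> S \<Longrightarrow> \<phi> x \<in> T"
  shows "has_gradient_on (\<lambda>x. f (\<phi> x)) (\<lambda>i x. \<Sum>k\<in>UNIV. f' k (\<phi> x) * \<phi>' k i x) S"
  unfolding has_gradient_on_def
proof
  fix x assume x: "x \<in> S"
  have 1: "(\<phi> has_derivative (\<lambda>h. \<chi> k. \<Sum>i\<in>UNIV. \<phi>' k i x * h $ i)) (at x within S)"
    by (subst has_derivative_componentwise_within)
      (auto simp: Basis_vec_def inner_axis' inner_axis has_gradient_onD[OF \<phi> x])
  have 2: "(f has_derivative (\<lambda>h. \<Sum>i\<in>UNIV. f' i (\<phi> x) * h $ i)) (at (\<phi> x) within \<phi> ` S)"
    by (rule has_derivative_subset[OF has_gradient_onD[OF f sub[OF x]]]) (use sub in auto)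
  have 3: "(\<Sum>k\<in>UNIV. f' k (\<phi> x) * (\<Sum>i\<in>UNIV. \<phi>' k i x * h $ i)) =
      (\<Sum>i\<in>UNIV. (\<Sum>k\<in>UNIV. f' k (\<phi> x) * \<phi>' k i x) * h $ i)" for h
    by (simp add: sum_distrib_left sum_distrib_right mult.assoc) (rule sum.swap)
  show "((\<lambda>x. f (\<phi> x)) has_derivative
      (\<lambda>h. \<Sum>i\<in>UNIV. (\<Sum>k\<in>UNIV. f' k (\<phi> x) * \<phi>' k i x) * h $ i)) (at x within S)"
    using has_derivative_in_compose[OF 1 2] by (simp add: 3)
qed

lemma has_gradient_on_continuous: "has_gradient_on f g S \<Longrightarrow> continuous_on S f"
  unfolding has_gradient_on_def continuous_on_eq_continuous_within
  by (blast intro: has_derivative_continuous)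

text \<open>Restriction to a line reduces the comparison of gradients to one real variable; the set \<open>T\<close> of
parameters allows one-sided derivatives at the boundary of \<open>S\<close>.\<close>

lemma has_gradient_on_path:
  assumes f: "has_gradient_on f g S" and x: "x + t0 *\<^sub>R w \<in> S"
    and T: "t0 \<in> T" "\<And>t. t \<in> T \<Longrightarrow> x + t *\<^sub>R w \<in> S"
  shows "((\<lambda>t. f (x + t *\<^sub>R w)) has_field_derivative (\<Sum>i\<in>UNIV. g i (x + t0 *\<^sub>R w) * w $ i))
    (at t0 within T)"
proof -
  have 1: "((\<lambda>t. x + t *\<^sub>R w) has_derivative (\<lambda>h. h *\<^sub>R w)) (at t0 within T)"
    by (auto intro!: derivative_eq_intros)
  have 2: "(f has_derivative (\<lambda>h. \<Sum>i\<in>UNIV. g i (x + t0 *\<^sub>R w) * h $ i))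
      (at (x + t0 *\<^sub>R w) within (\<lambda>t. x + t *\<^sub>R w) ` T)"
    by (rule has_derivative_subset[OF has_gradient_onD[OF f x]]) (use T in auto)
  show ?thesis
    unfolding has_field_derivative_def
    by (rule has_derivative_eq_rhs[OF has_derivative_in_compose[OF 1 2]])
      (simp add: fun_eq_iff sum_distrib_left sum_distrib_right algebra_simps)
qed

lemma sum_mult_axis: "(\<Sum>i\<in>UNIV. g i * axis j (1::real) $ i) = g j" for j :: "'n::finite"
  by (simp add: axis_def if_distrib[of "\<lambda>x. _ * x"] cong: if_cong)

lemma has_gradient_on_axis:
  assumes f: "has_gradient_on f g S" and x: "x \<in> S"
    and T: "0 \<in> T" "\<And>t. t \<in> T \<Longrightarrow> x + t *\<^sub>R axis i 1 \<in> S"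
  shows "((\<lambda>t. f (x + t *\<^sub>R axis i 1)) has_field_derivative g i x) (at 0 within T)"
  using has_gradient_on_path[OF f _ T] x by (simp add: sum_mult_axis)

lemma has_gradient_on_partial:
  assumes f: "has_gradient_on f g S" and "open S" and x: "x \<in> S"
  shows "partial i f x = g i x"
proof -
  have "open ((\<lambda>t. x + t *\<^sub>R axis i 1) -` S)"
    by (rule open_vimage[OF \<open>open S\<close>]) (auto intro!: continuous_intros)
  moreover have "0 \<in> (\<lambda>t. x + t *\<^sub>R axis i 1) -` S" using x by simp
  ultimately have "((\<lambda>t. f (x + t *\<^sub>R axis i 1)) has_field_derivative g i x) (at 0)"
    using has_gradient_on_axis[OF f x, of "(\<lambda>t. x + t *\<^sub>R axis i 1) -` S" i]
    by (metis at_within_open vimageD)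
  then show ?thesis unfolding partial_def by (rule DERIV_imp_deriv)
qed

lemma differentiable_on_has_gradient:
  assumes "f differentiable_on S" "open S"
  shows "has_gradient_on f (\<lambda>i. partial i f) S"
proof -
  have "has_gradient_on f (\<lambda>i x. frechet_derivative f (at x) (axis i 1)) S"
    unfolding has_gradient_on_def
  proof
    fix x assume x: "x \<in> S"
    have D: "(f has_derivative frechet_derivative f (at x)) (at x)"
      using assms x by (metis at_within_open differentiable_on_def frechet_derivative_works)
    interpret bounded_linear "frechet_derivative f (at x)"
      using D by (rule has_derivative_bounded_linear)
    have "frechet_derivative f (at x) h = (\<Sum>i\<in>UNIV. frechet_derivative f (at x) (axis i 1) * h $ i)" for h
    proof -
      have "h = (\<Sum>i\<in>UNIV. h $ i *\<^sub>R axis i 1)"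
        by (metis basis_expansion scalar_mult_eq_scaleR)
      then have "frechet_derivative f (at x) h = frechet_derivative f (at x) (\<Sum>i\<in>UNIV. h $ i *\<^sub>R axis i 1)"
        by simp
      then show ?thesis by (simp add: sum scaleR mult.commute)
    qed
    then show "(f has_derivative (\<lambda>h. \<Sum>i\<in>UNIV. frechet_derivative f (at x) (axis i 1) * h $ i)) (at x within S)"
      by (intro has_derivative_eq_rhs[OF has_derivative_at_withinI[OF D]] ext)
  qed
  from has_gradient_on_cong[OF this refl has_gradient_on_partial[OF this assms(2)]] show ?thesis .
qed

lemma has_gradient_on_lipschitz:
  fixes f :: "real^'n::finite \<Rightarrow> real"
  assumes f: "has_gradient_on f g S" and S: "convex S"
    and b: "\<And>i x. x \<in> S \<Longrightarrow> \<bar>g i x\<bar> \<le> B" and x: "x \<in> S" "y \<in> S"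
  shows "\<bar>f x - f y\<bar> \<le> real CARD('n) * B * dist x y"
proof -
  have B: "0 \<le> B" using b[OF x(1)] by (meson abs_ge_zero order_trans)
  have "onorm (\<lambda>h. \<Sum>i\<in>UNIV. g i x * h $ i) \<le> real CARD('n) * B" if "x \<in> S" for x
  proof (rule onorm_le)
    fix h :: "real^'n"
    have "norm (\<Sum>i\<in>UNIV. g i x * h $ i) \<le> (\<Sum>i\<in>(UNIV::'n set). B * norm h)"
      by (rule sum_norm_le) (auto simp: abs_mult intro!: mult_mono b that B component_le_norm_cart)
    then show "norm (\<Sum>i\<in>UNIV. g i x * h $ i) \<le> real CARD('n) * B * norm h" by simp
  qed
  from differentiable_bound[OF S has_gradient_onD[OF f] this x] show ?thesis
    by (simp add: dist_norm)
qed

section \<open>Symmetry of second derivatives\<close>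

text \<open>Two applications of the mean value theorem, first in direction \<open>i\<close> and then in direction \<open>j\<close>, to
the second difference over a square of side \<open>t\<close>. The left-hand side is symmetric in \<open>i\<close> and \<open>j\<close>.\<close>

lemma second_difference_mvt:
  assumes f: "has_gradient_on f g S" and g: "has_gradient_on (g i) (h i) S"
    and box: "\<And>s t'. 0 \<le> s \<Longrightarrow> s \<le> t \<Longrightarrow> 0 \<le> t' \<Longrightarrow> t' \<le> t \<Longrightarrow>
        x + s *\<^sub>R axis i 1 + t' *\<^sub>R axis j 1 \<in> S" and t: "0 < t"
  shows "\<exists>s t'. 0 \<le> s \<and> s \<le> t \<and> 0 \<le> t' \<and> t' \<le> t \<and>
    f (x + t *\<^sub>R axis i 1 + t *\<^sub>R axis j 1) - f (x + t *\<^sub>R axis i 1) - f (x + t *\<^sub>R axis j 1) + f x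
      = t * t * h i j (x + s *\<^sub>R axis i 1 + t' *\<^sub>R axis j 1)"
proof -
  let ?ei = "axis i 1 :: real^'a" and ?ej = "axis j 1 :: real^'a"
  define F where "F s = f ((x + t *\<^sub>R ?ej) + s *\<^sub>R ?ei) - f (x + s *\<^sub>R ?ei)" for s
  have box1: "(x + t *\<^sub>R ?ej) + s *\<^sub>R ?ei \<in> S" "x + s *\<^sub>R ?ei \<in> S" if "s \<in> {0..t}" for s
    using box[of s t] box[of s 0] that t by (auto simp: algebra_simps)
  have DF: "(F has_field_derivative (g i ((x + t *\<^sub>R ?ej) + s *\<^sub>R ?ei) - g i (x + s *\<^sub>R ?ei)))
      (at s within {0..t})" if "s \<in> {0..t}" for s
    unfolding F_def
    using DERIV_diff[OF has_gradient_on_path[OF f box1(1)[OF that] that box1(1)]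
        has_gradient_on_path[OF f box1(2)[OF that] that box1(2)]]
    by (simp add: sum_mult_axis)
  have "\<exists>s\<in>{0<..<t}. F t - F 0 = (g i ((x + t *\<^sub>R ?ej) + s *\<^sub>R ?ei) - g i (x + s *\<^sub>R ?ei)) * (t - 0)"
    by (rule mvt_simple[OF t]) (use DF in \<open>simp add: has_field_derivative_def\<close>)
  then obtain s where s: "0 < s" "s < t" and
    Fs: "F t - F 0 = (g i ((x + t *\<^sub>R ?ej) + s *\<^sub>R ?ei) - g i (x + s *\<^sub>R ?ei)) * (t - 0)"
    by auto
  have box2: "(x + s *\<^sub>R ?ei) + r *\<^sub>R ?ej \<in> S" if "r \<in> {0..t}" for r
    using box[of s r] that s by auto
  have DG: "((\<lambda>r. g i ((x + s *\<^sub>R ?ei) + r *\<^sub>R ?ej)) has_field_derivative h i j ((x + s *\<^sub>R ?ei) + r *\<^sub>R ?ej))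
      (at r within {0..t})" if "r \<in> {0..t}" for r
    using has_gradient_on_path[OF g box2[OF that] that box2] by (simp add: sum_mult_axis)
  have "\<exists>r\<in>{0<..<t}. g i ((x + s *\<^sub>R ?ei) + t *\<^sub>R ?ej) - g i ((x + s *\<^sub>R ?ei) + 0 *\<^sub>R ?ej)
      = h i j ((x + s *\<^sub>R ?ei) + r *\<^sub>R ?ej) * (t - 0)"
    by (rule mvt_simple[OF t, of "\<lambda>r. g i ((x + s *\<^sub>R ?ei) + r *\<^sub>R ?ej)"])
      (use DG in \<open>simp add: has_field_derivative_def\<close>)
  then obtain r where r: "0 < r" "r < t" and
    Gr: "g i ((x + s *\<^sub>R ?ei) + t *\<^sub>R ?ej) - g i ((x + s *\<^sub>R ?ei) + 0 *\<^sub>R ?ej)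
      = h i j ((x + s *\<^sub>R ?ei) + r *\<^sub>R ?ej) * (t - 0)"
    by auto
  have "F t - F 0 = t * t * h i j (x + s *\<^sub>R ?ei + r *\<^sub>R ?ej)"
    using Fs Gr by (simp add: algebra_simps)
  then show ?thesis
    using s r unfolding F_def
    by (intro exI[of _ s] exI[of _ r]) (auto simp: algebra_simps)
qed

text \<open>Schwarz's theorem: dividing the symmetric second difference by \<open>t\<^sup>2\<close> and letting the square shrink
identifies both mixed derivatives.\<close>

lemma second_derivative_symmetric:
  assumes f: "has_gradient_on f g S" and g: "\<And>i. has_gradient_on (g i) (h i) S"
    and S: "open S" and h: "\<And>i j. continuous_on S (h i j)" and x: "x \<in> S"
  shows "h i j x = h j i x"
proof (rule ccontr)
  assume ne: "h i j x \<noteq> h j i x"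
  define e where "e = \<bar>h i j x - h j i x\<bar> / 2"
  have e: "e > 0" using ne by (simp add: e_def)
  obtain d0 where d0: "d0 > 0" "ball x d0 \<subseteq> S" using S x open_contains_ball by blast
  have "\<exists>d>0. \<forall>y\<in>S. dist y x < d \<longrightarrow> dist (h i j y) (h i j x) < e" for i j
    using h[of i j] e x by (auto simp: continuous_on_iff)
  then obtain d1 d2 where d1: "d1 > 0" "\<And>y. y \<in> S \<Longrightarrow> dist y x < d1 \<Longrightarrow> dist (h i j y) (h i j x) < e"
    and d2: "d2 > 0" "\<And>y. y \<in> S \<Longrightarrow> dist y x < d2 \<Longrightarrow> dist (h j i y) (h j i x) < e" by meson
  define d where "d = min d0 (min d1 d2)"
  define t where "t = d / 3"
  have t: "t > 0" using d0 d1 d2 by (simp add: t_def d_def)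
  have near: "dist (x + s *\<^sub>R axis i 1 + r *\<^sub>R axis j 1) x < d" if "0 \<le> s" "s \<le> t" "0 \<le> r" "r \<le> t" for s r i j
  proof -
    have "norm (s *\<^sub>R axis i 1 + r *\<^sub>R axis j 1 :: real^'a) \<le> s + r"
      by (rule order_trans[OF norm_triangle_ineq]) (use that in simp)
    also have "\<dots> < d" using that t by (simp add: t_def)
    finally show ?thesis by (simp add: dist_norm add.assoc)
  qed
  have box: "x + s *\<^sub>R axis i 1 + r *\<^sub>R axis j 1 \<in> S" if "0 \<le> s" "s \<le> t" "0 \<le> r" "r \<le> t" for s r i j
    using near[OF that] d0 by (auto simp: d_def mem_ball dist_commute)
  from second_difference_mvt[of f g S i h t x j, OF f g box t] obtain s r where
    sr: "0 \<le> s" "s \<le> t" "0 \<le> r" "r \<le> t" and 1: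
    "f (x + t *\<^sub>R axis i 1 + t *\<^sub>R axis j 1) - f (x + t *\<^sub>R axis i 1) - f (x + t *\<^sub>R axis j 1) + f x
      = t * t * h i j (x + s *\<^sub>R axis i 1 + r *\<^sub>R axis j 1)" by blast
  from second_difference_mvt[of f g S j h t x i, OF f g box t] obtain s' r' where
    sr': "0 \<le> s'" "s' \<le> t" "0 \<le> r'" "r' \<le> t" and 2:
    "f (x + t *\<^sub>R axis j 1 + t *\<^sub>R axis i 1) - f (x + t *\<^sub>R axis j 1) - f (x + t *\<^sub>R axis i 1) + f x
      = t * t * h j i (x + s' *\<^sub>R axis j 1 + r' *\<^sub>R axis i 1)" by blast
  have "f (x + t *\<^sub>R axis j 1 + t *\<^sub>R axis i 1) = f (x + t *\<^sub>R axis i 1 + t *\<^sub>R axis j 1)"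
    by (simp add: algebra_simps)
  then have "t * t * h i j (x + s *\<^sub>R axis i 1 + r *\<^sub>R axis j 1) = t * t * h j i (x + s' *\<^sub>R axis j 1 + r' *\<^sub>R axis i 1)"
    using 1 2 by linarith
  then have eq: "h i j (x + s *\<^sub>R axis i 1 + r *\<^sub>R axis j 1) = h j i (x + s' *\<^sub>R axis j 1 + r' *\<^sub>R axis i 1)"
    using t by simp
  have "dist (h i j (x + s *\<^sub>R axis i 1 + r *\<^sub>R axis j 1)) (h i j x) < e"
    using d1(2)[OF box[OF sr]] near[OF sr] by (auto simp: d_def)
  moreover have "dist (h j i (x + s' *\<^sub>R axis j 1 + r' *\<^sub>R axis i 1)) (h j i x) < e"
    using d2(2)[OF box[OF sr']] near[OF sr'] by (auto simp: d_def)
  ultimately show False using eq unfolding e_def dist_real_def by argo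
qed

section \<open>Hoelder classes with explicit bounds\<close>

context
  fixes \<alpha> :: real
  assumes \<alpha>: "0 < \<alpha>" "\<alpha> \<le> 1"
begin

text \<open>The class \<open>C\<^bsup>k,\<alpha>\<^esup>\<close> on \<open>S\<close> with all derivatives of order at most \<open>k\<close> bounded by \<open>K\<close> and Hoelder
constant \<open>K\<close> for those of order \<open>k\<close>. As in the norm of the space, derivatives of lower order are merely
bounded; on convex sets their Hoelder bounds follow.\<close>

primrec holder_bd :: "(real^'n::finite) set \<Rightarrow> real \<Rightarrow> nat \<Rightarrow> (real^'n \<Rightarrow> real) \<Rightarrow> bool" where
  "holder_bd S K 0 = (\<lambda>f. 0 \<le> K \<and> (\<forall>x\<in>S. \<bar>f x\<bar> \<le> K) \<and>
     (\<forall>x\<in>S. \<forall>y\<in>S. \<bar>f x - f y\<bar> \<le> K * dist x y powr \<alpha>))"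
| "holder_bd S K (Suc k) = (\<lambda>f. (\<forall>x\<in>S. \<bar>f x\<bar> \<le> K) \<and>
     (\<exists>g. has_gradient_on f g S \<and> (\<forall>i. holder_bd S K k (g i))))"

declare holder_bd.simps(2) [simp del]

lemma holder_bd_nonneg: "holder_bd S K k f \<Longrightarrow> 0 \<le> K"
  by (induction k arbitrary: f) (auto simp: holder_bd.simps(2))

lemma holder_bd_bound: "holder_bd S K k f \<Longrightarrow> x \<in> S \<Longrightarrow> \<bar>f x\<bar> \<le> K"
  by (cases k) (auto simp: holder_bd.simps(2))

lemma holder_bd_SucE:
  assumes "holder_bd S K (Suc k) f"
  obtains g where "has_gradient_on f g S" "\<And>i. holder_bd S K k (g i)"
  using assms by (auto simp: holder_bd.simps(2))

lemma holder_bd_SucI: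
  assumes "\<And>x. x \<in> S \<Longrightarrow> \<bar>f x\<bar> \<le> K" "has_gradient_on f g S" "\<And>i. holder_bd S K k (g i)"
  shows "holder_bd S K (Suc k) f"
  using assms by (auto simp: holder_bd.simps(2))

lemma holder_bd_mono: "holder_bd S K k f \<Longrightarrow> K \<le> K' \<Longrightarrow> holder_bd S K' k f"
proof (induction k arbitrary: f)
  case 0
  then have "0 \<le> K'" "\<forall>x\<in>S. \<bar>f x\<bar> \<le> K'" by fastforce+
  moreover have "K * dist x y powr \<alpha> \<le> K' * dist x y powr \<alpha>" for x y :: "real^'a"
    using 0(2) by (simp add: mult_right_mono)
  ultimately show ?case using 0(1) unfolding holder_bd.simps(1) by (meson order_trans)
next
  case (Suc k)
  obtain g where "has_gradient_on f g S" "\<And>i. holder_bd S K k (g i)"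
    using holder_bd_SucE[OF Suc.prems(1)] by blast
  then show ?case using Suc by (intro holder_bd_SucI[of _ _ _ g]) (auto intro: order_trans[OF holder_bd_bound])
qed

lemma holder_bd_subset: "holder_bd S K k f \<Longrightarrow> T \<subseteq> S \<Longrightarrow> holder_bd T K k f"
proof (induction k arbitrary: f)
  case (Suc k)
  obtain g where "has_gradient_on f g S" "\<And>i. holder_bd S K k (g i)"
    using holder_bd_SucE[OF Suc.prems(1)] by blast
  then show ?case using Suc by (intro holder_bd_SucI[of _ _ _ g])
      (auto intro: holder_bd_bound has_gradient_on_subset)
qed (auto simp: subset_iff)

lemma holder_bd_cong: "holder_bd S K k f \<Longrightarrow> (\<And>x. x \<in> S \<Longrightarrow> f' x = f x) \<Longrightarrow> holder_bd S K k f'"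
  by (cases k) (auto simp: holder_bd.simps(2) intro: has_gradient_on_cong)

lemma holder_bd_const:
  assumes "\<bar>c\<bar> \<le> K"
  shows "holder_bd S K k (\<lambda>x. c)"
  using assms
proof (induction k arbitrary: c)
  case 0
  then have "0 \<le> K" by linarith
  then show ?case using 0 by simp
next
  case (Suc k)
  have "0 \<le> K" using Suc by linarith
  then show ?case using Suc has_gradient_on_const by (intro holder_bd_SucI[of _ _ _ "\<lambda>i x. 0"]) auto
qed

lemma holder_bd_add:
  "holder_bd S K k f \<Longrightarrow> holder_bd S M k g \<Longrightarrow> holder_bd S (K + M) k (\<lambda>x. f x + g x)"
proof (induction k arbitrary: f g)
  case 0
  show ?case
    unfolding holder_bd.simps(1)
  proof (intro conjI ballI)
    fix x y assume "x \<in> S" "y \<in> S"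
    with 0 show "\<bar>f x + g x\<bar> \<le> K + M"
      by (intro order_trans[OF abs_triangle_ineq] add_mono) auto
    have "\<bar>f x - f y\<bar> \<le> K * dist x y powr \<alpha>" "\<bar>g x - g y\<bar> \<le> M * dist x y powr \<alpha>"
      using 0 \<open>x \<in> S\<close> \<open>y \<in> S\<close> by auto
    then show "\<bar>f x + g x - (f y + g y)\<bar> \<le> (K + M) * dist x y powr \<alpha>"
      unfolding distrib_right by linarith
  qed (use 0 in auto)
next
  case (Suc k)
  obtain f' where "has_gradient_on f f' S" "\<And>i. holder_bd S K k (f' i)"
    using holder_bd_SucE[OF Suc.prems(1)] by blast
  moreover obtain g' where "has_gradient_on g g' S" "\<And>i. holder_bd S M k (g' i)"
    using holder_bd_SucE[OF Suc.prems(2)] by blast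
  ultimately show ?case using Suc
    by (intro holder_bd_SucI[OF _ has_gradient_on_add])
      (auto intro!: holder_bd_bound order_trans[OF abs_triangle_ineq] add_mono)
qed

lemma holder_bd_sum:
  assumes "finite I" "\<And>j. j \<in> I \<Longrightarrow> holder_bd S K k (f j)" "0 \<le> K"
  shows "holder_bd S (real (card I) * K) k (\<lambda>x. \<Sum>j\<in>I. f j x)"
  using assms
proof (induction I)
  case empty then show ?case by (simp add: holder_bd_const)
next
  case (insert j I)
  then have "holder_bd S (K + real (card I) * K) k (\<lambda>x. f j x + (\<Sum>j\<in>I. f j x))"
    by (intro holder_bd_add) auto
  then show ?case using insert by (simp add: algebra_simps)
qed

lemma holder_bd_cmult: "holder_bd S K k f \<Longrightarrow> holder_bd S (\<bar>c\<bar> * K) k (\<lambda>x. c * f x)"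
proof (induction k arbitrary: f)
  case 0
  then show ?case
    by (auto simp: abs_mult mult_left_mono right_diff_distrib[symmetric] mult.assoc)
next
  case (Suc k)
  obtain g where "has_gradient_on f g S" "\<And>i. holder_bd S K k (g i)"
    using holder_bd_SucE[OF Suc.prems(1)] by blast
  then show ?case using Suc
    by (intro holder_bd_SucI[OF _ has_gradient_on_cmult])
      (auto simp: abs_mult intro!: mult_left_mono holder_bd_bound)
qed

lemma holder_bd_uminus: "holder_bd S K k f \<Longrightarrow> holder_bd S K k (\<lambda>x. - f x)"
  using holder_bd_cmult[of S K k f "-1"] by simp

lemma holder_bd_diff:
  "holder_bd S K k f \<Longrightarrow> holder_bd S M k g \<Longrightarrow> holder_bd S (K + M) k (\<lambda>x. f x - g x)"
  using holder_bd_add[OF _ holder_bd_uminus] by fastforce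

lemma holder_bd_uniform:
  fixes f :: "'i::finite \<Rightarrow> real^'n::finite \<Rightarrow> real"
  assumes "\<And>i. \<exists>K. holder_bd S K k (f i)"
  obtains K where "\<forall>i. holder_bd S K k (f i)"
proof -
  obtain B where B: "\<And>i. holder_bd S (B i) k (f i)" using assms by metis
  have "B i \<le> (\<Sum>i\<in>UNIV. B i)" for i by (rule member_le_sum) (auto intro: holder_bd_nonneg[OF B])
  then show thesis using that[of "\<Sum>i\<in>UNIV. B i"] holder_bd_mono[OF B] by blast
qed

lemma holder_bd_Suc_ex:
  assumes "\<And>x. x \<in> S \<Longrightarrow> \<bar>f x\<bar> \<le> B" "has_gradient_on f g S" "\<And>i. \<exists>K. holder_bd S K k (g i)"
  shows "\<exists>K. holder_bd S K (Suc k) f"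
proof -
  obtain K where K: "\<forall>i. holder_bd S K k (g i)" by (rule holder_bd_uniform[OF assms(3)])
  have "holder_bd S (max B K) k (g i)" for i by (rule holder_bd_mono[OF spec[OF K]]) simp
  moreover have "\<bar>f x\<bar> \<le> max B K" if "x \<in> S" for x using assms(1)[OF that] by simp
  ultimately show ?thesis using assms(2) holder_bd_SucI by blast
qed

text \<open>A Lipschitz bound controls small distances and a uniform bound controls large ones, so that together
they give a Hoelder bound on sets of any diameter.\<close>

lemma le_powr_of_le_one:
  assumes "0 \<le> d" "0 < \<alpha>" "\<alpha> \<le> 1" "0 \<le> A" "0 \<le> B" "t \<le> A * d" "t \<le> B"
  shows "t \<le> (A + B) * d powr (\<alpha>::real)"
proof (cases "d \<le> 1")
  case True
  then have "d \<le> d powr \<alpha>" using assms by (cases "d = 0") (use powr_mono'[of \<alpha> 1 d] in auto)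
  then have "A * d \<le> A * d powr \<alpha>" using assms by (intro mult_left_mono)
  moreover have "0 \<le> B * d powr \<alpha>" using assms by simp
  ultimately show ?thesis using assms unfolding distrib_right by linarith
next
  case False
  then have "1 \<le> d powr \<alpha>" using assms by (simp add: ge_one_powr_ge_zero)
  then have "B * 1 \<le> B * d powr \<alpha>" using assms by (intro mult_left_mono)
  moreover have "0 \<le> A * d powr \<alpha>" using assms by simp
  ultimately show ?thesis using assms unfolding distrib_right by linarith
qed

text \<open>On convex sets, bounded gradients give Lipschitz functions.\<close>

lemma holder_bd_lower:
  fixes f :: "real^'n::finite \<Rightarrow> real"
  assumes "convex S" "holder_bd S K (Suc k) f"
  shows "holder_bd S ((real CARD('n) + 2) * K) k f"
  using assms(2)
proof (induction k arbitrary: f)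
  case 0
  then obtain g where g: "has_gradient_on f g S" "\<And>i x. x \<in> S \<Longrightarrow> \<bar>g i x\<bar> \<le> K" and K: "0 \<le> K"
    by (auto simp: holder_bd.simps(2))
  have b: "\<bar>f x\<bar> \<le> K" if "x \<in> S" for x using holder_bd_bound[OF 0 that] .
  have "\<bar>f x - f y\<bar> \<le> (real CARD('n) * K + 2 * K) * dist x y powr \<alpha>" if "x \<in> S" "y \<in> S" for x y
    using b[OF that(1)] b[OF that(2)] K \<alpha> has_gradient_on_lipschitz[OF g(1) assms(1) g(2) that]
    by (intro le_powr_of_le_one) auto
  moreover have "\<bar>f x\<bar> \<le> (real CARD('n) + 2) * K" if "x \<in> S" for x
  proof -
    have "1 * K \<le> (real CARD('n) + 2) * K" using K by (intro mult_right_mono) auto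
    then show ?thesis using b[OF that] by simp
  qed
  ultimately show ?case using K by (simp add: distrib_right)
next
  case (Suc k)
  obtain g where g: "has_gradient_on f g S" "\<And>i. holder_bd S K (Suc k) (g i)"
    using holder_bd_SucE[OF Suc.prems(1)] by blast
  have "0 \<le> K" using holder_bd_nonneg Suc(2) by blast
  then have "1 * K \<le> (real CARD('n) + 2) * K" by (intro mult_right_mono) auto
  then show ?case using Suc(1)[OF g(2)] holder_bd_bound[OF Suc(2)]
    by (intro holder_bd_SucI[OF _ g(1)]) (auto intro: order_trans)
qed

lemma holder_bd_continuous:
  assumes "convex S" "holder_bd S K k f"
  shows "continuous_on S f"
proof (cases k)
  case 0
  have "continuous_on S f"
    unfolding continuous_on_def
  proof
    fix x assume x: "x \<in> S"
    have "((\<lambda>y. K * dist y x powr \<alpha>) \<longlongrightarrow> K * dist x x powr \<alpha>) (at x within S)"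
      using \<alpha> by (intro tendsto_intros tendsto_powr2) auto
    then have "((\<lambda>y. K * dist y x powr \<alpha>) \<longlongrightarrow> 0) (at x within S)" by simp
    then have "((\<lambda>y. f y - f x) \<longlongrightarrow> 0) (at x within S)"
      by (rule Lim_null_comparison[rotated]) (use assms 0 x in \<open>auto simp: eventually_at intro!: exI[of _ 1]\<close>)
    then show "(f \<longlongrightarrow> f x) (at x within S)" by (simp add: LIM_zero_iff)
  qed
  then show ?thesis .
next
  case (Suc k)
  then show ?thesis using assms(2) holder_bd_SucE has_gradient_on_continuous by metis
qed

text \<open>The constant is independent of \<open>f\<close> and \<open>g\<close>. In the Leibniz rule the undifferentiated factor is used
one order below its own, which is where convexity enters.\<close>

lemma holder_bd_mult:
  fixes S :: "(real^'n::finite) set"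
  assumes "convex S"
  shows "\<exists>C\<ge>0. \<forall>f g K M. holder_bd S K k f \<longrightarrow> holder_bd S M k g \<longrightarrow>
    holder_bd S (C * K * M) k (\<lambda>x. f x * g x)"
proof (induction k)
  case 0
  have "holder_bd S (2 * K * M) 0 (\<lambda>x. f x * g x)" if f: "holder_bd S K 0 f" and g: "holder_bd S M 0 g" for f g K M
    unfolding holder_bd.simps(1)
  proof (intro conjI ballI)
    have KM: "0 \<le> K" "0 \<le> M" using f g holder_bd_nonneg by blast+
    then show "0 \<le> 2 * K * M" by simp
    fix x y assume x: "x \<in> S" and y: "y \<in> S"
    have *: "\<bar>f x * g x\<bar> \<le> K * M" unfolding abs_mult
      using KM by (intro mult_mono holder_bd_bound[OF f x] holder_bd_bound[OF g x]) auto
    then show "\<bar>f x * g x\<bar> \<le> 2 * K * M" using mult_right_mono[of 1 2 "K * M"] KM by (simp add: mult.assoc)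
    have "f x * g x - f y * g y = f x * (g x - g y) + (f x - f y) * g y" by algebra
    then have "\<bar>f x * g x - f y * g y\<bar> \<le> \<bar>f x\<bar> * \<bar>g x - g y\<bar> + \<bar>f x - f y\<bar> * \<bar>g y\<bar>"
      by (metis abs_mult abs_triangle_ineq)
    also have "\<dots> \<le> K * (M * dist x y powr \<alpha>) + (K * dist x y powr \<alpha>) * M"
      using f g x y KM by (intro add_mono mult_mono holder_bd_bound[OF f x] holder_bd_bound[OF g y]) auto
    finally show "\<bar>f x * g x - f y * g y\<bar> \<le> 2 * K * M * dist x y powr \<alpha>" by (simp add: algebra_simps)
  qed
  then show ?case by (intro exI[of _ 2]) auto
next
  case (Suc k)
  then obtain C where C: "C \<ge> 0" "\<And>f g K M. holder_bd S K k f \<Longrightarrow> holder_bd S M k g \<Longrightarrow>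
    holder_bd S (C * K * M) k (\<lambda>x. f x * g x)" by blast
  define c where "c = real CARD('n) + 2"
  have c: "c \<ge> 0" by (simp add: c_def)
  have "holder_bd S ((1 + 2 * C * c) * K * M) (Suc k) (\<lambda>x. f x * g x)"
    if f: "holder_bd S K (Suc k) f" and g: "holder_bd S M (Suc k) g" for f g K M
  proof -
    have KM: "0 \<le> K" "0 \<le> M" using f g holder_bd_nonneg by blast+
    obtain f' where f': "has_gradient_on f f' S" "\<And>i. holder_bd S K k (f' i)"
      using holder_bd_SucE[OF f] by blast
    obtain g' where g': "has_gradient_on g g' S" "\<And>i. holder_bd S M k (g' i)"
      using holder_bd_SucE[OF g] by blast
    have "holder_bd S (C * K * (c * M) + C * (c * K) * M) k (\<lambda>x. f' i x * g x + f x * g' i x)" for i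
      unfolding c_def by (intro holder_bd_add C(2) f' g' holder_bd_lower assms f g)
    then have *: "holder_bd S ((1 + 2 * C * c) * K * M) k (\<lambda>x. f' i x * g x + f x * g' i x)" for i
      by (rule holder_bd_mono) (use KM in \<open>simp add: algebra_simps\<close>)
    show ?thesis
    proof (rule holder_bd_SucI[OF _ has_gradient_on_mult[OF f'(1) g'(1)] *])
      fix x assume x: "x \<in> S"
      have "\<bar>f x * g x\<bar> \<le> K * M" unfolding abs_mult
        using KM by (intro mult_mono holder_bd_bound[OF f x] holder_bd_bound[OF g x]) auto
      also have "\<dots> \<le> (1 + 2 * C * c) * K * M" using KM C(1) c by (simp add: distrib_right)
      finally show "\<bar>f x * g x\<bar> \<le> (1 + 2 * C * c) * K * M" .
    qed
  qed
  then show ?case using C(1) c by (intro exI[of _ "1 + 2 * C * c"]) auto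
qed

text \<open>The coefficients of the operator and the charts are fixed, so that for them only the existence of some
bound matters. The variants with suffix \<open>ex\<close> serve this purpose.\<close>

lemma holder_bd_mult_ex:
  assumes "convex S" "\<exists>K. holder_bd S K k f" "\<exists>K. holder_bd S K k g"
  shows "\<exists>K. holder_bd S K k (\<lambda>x. f x * g x)"
  using holder_bd_mult[OF assms(1), of k] assms(2,3) by blast

lemma holder_bd_add_ex:
  assumes "\<exists>K. holder_bd S K k f" "\<exists>K. holder_bd S K k g"
  shows "\<exists>K. holder_bd S K k (\<lambda>x. f x + g x)"
  using assms holder_bd_add by blast

lemma holder_bd_diff_ex:
  assumes "\<exists>K. holder_bd S K k f" "\<exists>K. holder_bd S K k g"
  shows "\<exists>K. holder_bd S K k (\<lambda>x. f x - g x)"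
  using assms holder_bd_diff by blast

lemma holder_bd_const_ex: "\<exists>K. holder_bd S K k (\<lambda>x. c)"
  using holder_bd_const by blast

lemma holder_bd_sum_ex:
  assumes "finite I" "\<And>j. j \<in> I \<Longrightarrow> \<exists>K. holder_bd S K k (f j)"
  shows "\<exists>K. holder_bd S K k (\<lambda>x. \<Sum>j\<in>I. f j x)"
  using assms by (induction I) (auto intro: holder_bd_add_ex holder_bd_const_ex)

lemma holder_bd_prod_ex:
  assumes "convex S" "finite I" "\<And>j. j \<in> I \<Longrightarrow> \<exists>K. holder_bd S K k (f j)"
  shows "\<exists>K. holder_bd S K k (\<lambda>x. \<Prod>j\<in>I. f j x)"
  using assms(2,3) by (induction I) (auto intro: holder_bd_mult_ex[OF assms(1)] holder_bd_const_ex)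

lemma holder_bd_lower_ex:
  assumes "convex S" "\<exists>K. holder_bd S K l f" "k \<le> l"
  shows "\<exists>K. holder_bd S K k f"
proof -
  have "\<exists>K. holder_bd S K (l - d) f" for d
  proof (induction d)
    case 0 show ?case using assms(2) by simp
  next
    case (Suc d)
    show ?case
    proof (cases "d < l")
      case True
      then have "l - d = Suc (l - Suc d)" by simp
      then show ?thesis using Suc holder_bd_lower[OF assms(1)] by metis
    next
      case False then show ?thesis using Suc by simp
    qed
  qed
  from this[of "l - k"] show ?thesis using assms(3) by simp
qed

lemma holder_bd_component_ex:
  assumes "bounded S" "convex S"
  shows "\<exists>K. holder_bd S K k (\<lambda>x. x $ j)"
proof -
  obtain B where B: "\<And>x. x \<in> S \<Longrightarrow> norm x \<le> B" using assms(1) by (auto simp: bounded_iff)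
  have "\<bar>x $ j\<bar> \<le> max B 1" if "x \<in> S" for x
    using B[OF that] component_le_norm_cart[of x j] by linarith
  then have "holder_bd S (max B 1) (Suc k) (\<lambda>x. x $ j)"
    by (intro holder_bd_SucI[OF _ has_gradient_on_component] holder_bd_const) auto
  then show ?thesis using holder_bd_lower[OF assms(2)] by blast
qed

text \<open>Only the domain \<open>S\<close> has to be convex, so that \<open>f\<close> may live on the region \<open>\<Omega>\<close> itself. The Lipschitz
bound is a separate hypothesis because it is needed at order \<open>0\<close>, where the induction ends.\<close>

lemma holder_bd_compose_lipschitz:
  fixes S :: "(real^'n::finite) set" and T :: "(real^'n) set"
  assumes S: "convex S" and sub: "\<And>x. x \<in> S \<Longrightarrow> \<phi> x \<in> T"
    and L: "\<And>x y. x \<in> S \<Longrightarrow> y \<in> S \<Longrightarrow> dist (\<phi> x) (\<phi> y) \<le> L * dist x y"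
    and \<phi>: "\<And>j. \<exists>M. holder_bd S M k (\<lambda>x. \<phi> x $ j)"
  shows "\<exists>C\<ge>0. \<forall>f K. holder_bd T K k f \<longrightarrow> holder_bd S (C * K) k (\<lambda>x. f (\<phi> x))"
  using \<phi>
proof (induction k)
  case 0
  define L' where "L' = max 1 L"
  have L': "dist (\<phi> x) (\<phi> y) \<le> L' * dist x y" if "x \<in> S" "y \<in> S" for x y
    using L[OF that] by (rule order_trans) (auto simp: L'_def intro: mult_right_mono)
  have "holder_bd S ((1 + L' powr \<alpha>) * K) 0 (\<lambda>x. f (\<phi> x))" if f: "holder_bd T K 0 f" for f K
    unfolding holder_bd.simps(1)
  proof (intro conjI ballI)
    have K: "0 \<le> K" using f holder_bd_nonneg by blast
    then show "0 \<le> (1 + L' powr \<alpha>) * K" by simp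
    fix x y assume x: "x \<in> S" and y: "y \<in> S"
    show "\<bar>f (\<phi> x)\<bar> \<le> (1 + L' powr \<alpha>) * K"
      using holder_bd_bound[OF f sub[OF x]] mult_right_mono[of 1 "1 + L' powr \<alpha>" K] K by simp
    have "\<bar>f (\<phi> x) - f (\<phi> y)\<bar> \<le> K * dist (\<phi> x) (\<phi> y) powr \<alpha>" using f sub x y by auto
    also have "\<dots> \<le> K * (L' * dist x y) powr \<alpha>"
      using K \<alpha> L'[OF x y] by (intro mult_left_mono powr_mono2) auto
    also have "\<dots> = L' powr \<alpha> * K * dist x y powr \<alpha>"
      by (simp add: powr_mult L'_def)
    also have "\<dots> \<le> (1 + L' powr \<alpha>) * K * dist x y powr \<alpha>"
      using K by (intro mult_right_mono) auto
    finally show "\<bar>f (\<phi> x) - f (\<phi> y)\<bar> \<le> (1 + L' powr \<alpha>) * K * dist x y powr \<alpha>" .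
  qed
  then show ?case by (intro exI[of _ "1 + L' powr \<alpha>"]) auto
next
  case (Suc k)
  have "\<exists>M. holder_bd S M k (\<lambda>x. \<phi> x $ j)" for j
    using Suc(2) holder_bd_lower[OF S] by blast
  from Suc(1)[OF this] obtain C where C: "C \<ge> 0"
    "\<And>f K. holder_bd T K k f \<Longrightarrow> holder_bd S (C * K) k (\<lambda>x. f (\<phi> x))" by blast
  obtain P where P: "P \<ge> 0" "\<And>f g K M. holder_bd S K k f \<Longrightarrow> holder_bd S M k g \<Longrightarrow>
    holder_bd S (P * K * M) k (\<lambda>x. f x * g x)" using holder_bd_mult[OF S] by blast
  obtain M where M': "\<forall>j. holder_bd S M (Suc k) (\<lambda>x. \<phi> x $ j)" by (rule holder_bd_uniform[OF Suc(2)])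
  note M = spec[OF M']
  then have Mnn: "0 \<le> M" using holder_bd_nonneg by blast
  have "\<exists>g. has_gradient_on (\<lambda>x. \<phi> x $ j) g S \<and> (\<forall>i. holder_bd S M k (g i))" for j
    using M[of j] by (auto simp: holder_bd.simps(2))
  then obtain G where G: "\<And>j. has_gradient_on (\<lambda>x. \<phi> x $ j) (G j) S"
    "\<And>j i. holder_bd S M k (G j i)" by metis
  define C' where "C' = 1 + real CARD('n) * (P * C * M)"
  have C': "C' \<ge> 0" unfolding C'_def using C P Mnn by simp
  have "holder_bd S (C' * K) (Suc k) (\<lambda>x. f (\<phi> x))" if f: "holder_bd T K (Suc k) f" for f K
  proof -
    have K: "0 \<le> K" using f holder_bd_nonneg by blast
    obtain g where g: "has_gradient_on f g T" "\<And>i. holder_bd T K k (g i)" using holder_bd_SucE[OF f] by blast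
    have "holder_bd S (real CARD('n) * (P * (C * K) * M)) k (\<lambda>x. \<Sum>j\<in>UNIV. g j (\<phi> x) * G j i x)" for i
      using C P Mnn K by (intro holder_bd_sum P C g G) auto
    then have "holder_bd S (C' * K) k (\<lambda>x. \<Sum>j\<in>UNIV. g j (\<phi> x) * G j i x)" for i
      by (rule holder_bd_mono) (use K in \<open>simp add: C'_def algebra_simps\<close>)
    moreover have "\<bar>f (\<phi> x)\<bar> \<le> C' * K" if "x \<in> S" for x
    proof -
      have "1 * K \<le> C' * K" using K C P Mnn by (intro mult_right_mono) (auto simp: C'_def)
      then show ?thesis using holder_bd_bound[OF f sub[OF that]] by simp
    qed
    ultimately show ?thesis
      by (intro holder_bd_SucI[OF _ has_gradient_on_compose[OF g(1) G(1) sub]]) auto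
  qed
  then show ?case using C' by (intro exI[of _ C']) auto
qed

lemma holder_bd_lipschitz_map:
  fixes S :: "(real^'n::finite) set"
  assumes S: "convex S" and \<phi>: "\<And>j. \<exists>M. holder_bd S M (Suc k) (\<lambda>x. \<phi> x $ j)"
  obtains L where "L \<ge> 1" "\<And>x y. x \<in> S \<Longrightarrow> y \<in> S \<Longrightarrow> dist (\<phi> x :: real^'n) (\<phi> y) \<le> L * dist x y"
proof -
  obtain M where M: "\<And>j. holder_bd S (M j) (Suc k) (\<lambda>x. \<phi> x $ j)" using \<phi> by metis
  have Mnn: "0 \<le> M j" for j using M holder_bd_nonneg by blast
  have *: "\<bar>\<phi> x $ j - \<phi> y $ j\<bar> \<le> real CARD('n) * M j * dist x y" if "x \<in> S" "y \<in> S" for x y j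
  proof -
    obtain g where g: "has_gradient_on (\<lambda>x. \<phi> x $ j) g S" "\<And>i. holder_bd S (M j) k (g i)"
      using holder_bd_SucE[OF M[of j]] by blast
    show ?thesis by (rule has_gradient_on_lipschitz[OF g(1) S holder_bd_bound[OF g(2)] that])
  qed
  define L where "L = 1 + (\<Sum>j\<in>UNIV. real CARD('n) * M j)"
  have "dist (\<phi> x) (\<phi> y) \<le> L * dist x y" if "x \<in> S" "y \<in> S" for x y
  proof -
    have "dist (\<phi> x) (\<phi> y) \<le> (\<Sum>j\<in>UNIV. \<bar>(\<phi> x - \<phi> y) $ j\<bar>)"
      unfolding dist_norm by (rule norm_le_l1_cart)
    also have "\<dots> \<le> (\<Sum>j\<in>UNIV. real CARD('n) * M j * dist x y)"
      using *[OF that] by (intro sum_mono) simp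
    also have "\<dots> = (L - 1) * dist x y" by (simp add: L_def sum_distrib_right)
    also have "\<dots> \<le> L * dist x y" by (intro mult_right_mono) auto
    finally show ?thesis .
  qed
  moreover have "L \<ge> 1" by (auto simp: L_def intro!: sum_nonneg mult_nonneg_nonneg Mnn)
  ultimately show ?thesis using that by blast
qed

lemma holder_bd_compose:
  fixes S T :: "(real^'n::finite) set"
  assumes S: "convex S" and sub: "\<And>x. x \<in> S \<Longrightarrow> \<phi> x \<in> T"
    and \<phi>: "\<And>j. \<exists>M. holder_bd S M (Suc k) (\<lambda>x. \<phi> x $ j)"
  shows "\<exists>C\<ge>0. \<forall>f K. holder_bd T K (Suc k) f \<longrightarrow> holder_bd S (C * K) (Suc k) (\<lambda>x. f (\<phi> x))"
proof -
  obtain L where "L \<ge> 1" "\<And>x y. x \<in> S \<Longrightarrow> y \<in> S \<Longrightarrow> dist (\<phi> x) (\<phi> y) \<le> L * dist x y"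
    using holder_bd_lipschitz_map[OF S \<phi>] by blast
  then show ?thesis using holder_bd_compose_lipschitz[OF S sub _ \<phi>] by blast
qed

lemma holder_bd_compose_ex:
  fixes S T :: "(real^'n::finite) set"
  assumes "convex S" "\<And>x. x \<in> S \<Longrightarrow> \<phi> x \<in> T"
    "\<And>j. \<exists>M. holder_bd S M (Suc k) (\<lambda>x. \<phi> x $ j)" "\<exists>K. holder_bd T K (Suc k) f"
  shows "\<exists>K. holder_bd S K (Suc k) (\<lambda>x. f (\<phi> x))"
  using holder_bd_compose[OF assms(1-3)] assms(4) by blast

text \<open>The gradient of \<open>1 / f\<close> is \<open>- f\<^sub>i / f\<^sup>2\<close>, which involves \<open>1 / f\<close> one order lower.\<close>

lemma holder_bd_inverse_ex:
  assumes S: "convex S" and "\<exists>K. holder_bd S K k f" and c: "c > 0" "\<And>x. x \<in> S \<Longrightarrow> c \<le> f x"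
  shows "\<exists>K. holder_bd S K k (\<lambda>x. inverse (f x))"
  using assms(2)
proof (induction k)
  case 0
  then obtain K where f: "holder_bd S K 0 f" by blast
  have K: "0 \<le> K" using f holder_bd_nonneg by blast
  have pos: "f x > 0" "inverse (f x) \<le> inverse c" if "x \<in> S" for x
    using c(1) c(2)[OF that] by (auto intro: le_imp_inverse_le)
  have "holder_bd S (inverse c + inverse c * inverse c * K) 0 (\<lambda>x. inverse (f x))"
    unfolding holder_bd.simps(1)
  proof (intro conjI ballI)
    show "0 \<le> inverse c + inverse c * inverse c * K" using c K by simp
    fix x y assume x: "x \<in> S" and y: "y \<in> S"
    have "\<bar>inverse (f x)\<bar> \<le> inverse c" using pos[OF x] by simp
    also have "\<dots> \<le> inverse c + inverse c * inverse c * K" using c K by simp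
    finally show "\<bar>inverse (f x)\<bar> \<le> inverse c + inverse c * inverse c * K" .
    have "inverse (f x) - inverse (f y) = inverse (f x) * inverse (f y) * (f y - f x)"
      using pos(1)[OF x] pos(1)[OF y] by (simp add: field_simps)
    then have "\<bar>inverse (f x) - inverse (f y)\<bar> = inverse (f x) * inverse (f y) * \<bar>f x - f y\<bar>"
      using pos(1)[OF x] pos(1)[OF y] by (simp add: abs_mult abs_minus_commute)
    also have "\<dots> \<le> inverse c * inverse c * (K * dist x y powr \<alpha>)"
      using f x y pos[OF x] pos[OF y] c by (intro mult_mono) auto
    also have "\<dots> \<le> (inverse c + inverse c * inverse c * K) * dist x y powr \<alpha>"
      using c by (simp add: algebra_simps)
    finally show "\<bar>inverse (f x) - inverse (f y)\<bar> \<le> (inverse c + inverse c * inverse c * K) * dist x y powr \<alpha>" .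
  qed
  then show ?case by blast
next
  case (Suc k)
  obtain K where f: "holder_bd S K (Suc k) f" using Suc.prems by blast
  obtain g where g: "has_gradient_on f g S" "\<And>i. holder_bd S K k (g i)" using holder_bd_SucE[OF f] by blast
  have inv: "\<exists>K. holder_bd S K k (\<lambda>x. inverse (f x))" using Suc holder_bd_lower[OF S] by blast
  have "has_gradient_on (\<lambda>x. inverse (f x)) (\<lambda>i x. - (inverse (f x) * inverse (f x)) * g i x) S"
  proof (rule has_gradient_on_chain[OF _ g(1)])
    fix x assume "x \<in> S"
    then have "f x \<noteq> 0" using c by force
    then show "(inverse has_field_derivative - (inverse (f x) * inverse (f x))) (at (f x) within f ` S)"
      by (auto intro!: derivative_eq_intros)
  qed
  moreover have "\<exists>K. holder_bd S K k (\<lambda>x. - (inverse (f x) * inverse (f x)) * g i x)" for i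
    using holder_bd_mult_ex[OF S holder_bd_mult_ex[OF S inv inv]] g(2)[of i] holder_bd_uminus by fastforce
  moreover have "\<bar>inverse (f x)\<bar> \<le> inverse c" if "x \<in> S" for x
    using c(1) c(2)[OF that] by (auto intro: le_imp_inverse_le)
  ultimately show ?case by (intro holder_bd_Suc_ex)
qed

section \<open>Extension to the closure and gluing across a hyperplane\<close>

lemma estimate_on_closure:
  fixes f :: "'a::metric_space \<Rightarrow> real"
  assumes T: "S \<subseteq> T" "T \<subseteq> closure S" and f: "continuous_on T f" and \<omega>: "continuous_on {0..} \<omega>"
    and le: "\<And>x y. x \<in> S \<Longrightarrow> y \<in> S \<Longrightarrow> \<bar>f x - f y\<bar> \<le> \<omega> (dist x y)"
    and x: "x \<in> T" "y \<in> T"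
  shows "\<bar>f x - f y\<bar> \<le> \<omega> (dist x y)"
proof -
  have "\<exists>X. (\<forall>n. X n \<in> S) \<and> (X \<longlonglongrightarrow> z)" if "z \<in> T" for z
    using T that closure_sequential by blast
  then obtain X Y where X: "\<And>n. X n \<in> S" "X \<longlonglongrightarrow> x" and Y: "\<And>n. Y n \<in> S" "Y \<longlonglongrightarrow> y"
    using x by meson
  have "(\<lambda>n. f (X n)) \<longlonglongrightarrow> f x" "(\<lambda>n. f (Y n)) \<longlonglongrightarrow> f y"
    using X Y x T by (auto intro!: continuous_on_tendsto_compose[OF f] always_eventually)
  then have 1: "(\<lambda>n. \<bar>f (X n) - f (Y n)\<bar>) \<longlonglongrightarrow> \<bar>f x - f y\<bar>" by (intro tendsto_intros)
  have 2: "(\<lambda>n. \<omega> (dist (X n) (Y n))) \<longlonglongrightarrow> \<omega> (dist x y)"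
    by (rule continuous_on_tendsto_compose[OF \<omega> tendsto_dist[OF X(2) Y(2)]]) auto
  show ?thesis by (rule LIMSEQ_le[OF 1 2]) (use le X Y in auto)
qed

lemma bound_on_closure:
  fixes f :: "'a::metric_space \<Rightarrow> real"
  assumes T: "T \<subseteq> closure S" "S \<subseteq> T" and f: "continuous_on T f"
    and le: "\<And>x. x \<in> S \<Longrightarrow> f x \<le> c" and x: "x \<in> T"
  shows "f x \<le> c"
proof -
  obtain X where X: "\<And>n. X n \<in> S" "X \<longlonglongrightarrow> x" using T x closure_sequential by blast
  have "(\<lambda>n. f (X n)) \<longlonglongrightarrow> f x"
    using X x T by (intro continuous_on_tendsto_compose[OF f]) (auto intro!: always_eventually)
  then show ?thesis by (rule LIMSEQ_le_const2) (use le X in auto)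
qed

text \<open>If both a function and its gradient are continuous up to the boundary, the gradient remains a
derivative there: after subtracting the linear function given by the limit gradient, the function is
Lipschitz with small constant near the point, and this estimate passes to the closure.\<close>

lemma has_gradient_on_closure:
  fixes f :: "real^'n::finite \<Rightarrow> real"
  assumes S: "convex S" and T: "S \<subseteq> T" "T \<subseteq> closure S" and f: "has_gradient_on f g S"
    and S': "open S" and cf: "continuous_on T f" and cg: "\<And>i. continuous_on T (g i)"
  shows "has_gradient_on f g T"
  unfolding has_gradient_on_def has_derivative_within_alt
proof (intro ballI conjI allI impI)
  fix z assume z: "z \<in> T"
  show "bounded_linear (\<lambda>h. \<Sum>i\<in>UNIV. g i z * h $ i)"
    by (intro bounded_linear_sum bounded_linear_const_mult bounded_linear_vec_nth)
  fix e :: real assume e: "0 < e"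
  define e' where "e' = e / real CARD('n)"
  have e': "e' > 0" using e by (simp add: e'_def)
  have "\<exists>d>0. \<forall>y\<in>T. dist y z < d \<longrightarrow> \<bar>g i y - g i z\<bar> \<le> e'" for i
    using cg[of i] z e' unfolding continuous_on_iff dist_real_def by (meson less_imp_le)
  then obtain d0 where d0: "\<And>i. d0 i > 0" "\<And>i y. y \<in> T \<Longrightarrow> dist y z < d0 i \<Longrightarrow> \<bar>g i y - g i z\<bar> \<le> e'"
    by metis
  define d where "d = Min (range d0)"
  have d: "d > 0" "\<And>i. d \<le> d0 i" using d0(1) by (auto simp: d_def)
  define G where "G y = f y + (\<Sum>i\<in>UNIV. (- g i z) * y $ i)" for y
  let ?B = "S \<inter> ball z d" and ?T = "T \<inter> ball z d"
  have GG: "has_gradient_on G (\<lambda>i y. g i y + (\<Sum>j\<in>UNIV. (- g j z) * (if i = j then 1 else 0))) ?B"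
    unfolding G_def
    by (intro has_gradient_on_add has_gradient_on_sum has_gradient_on_cmult has_gradient_on_component
        has_gradient_on_subset[OF f]) auto
  have GB: "\<bar>G x - G y\<bar> \<le> e * dist x y" if "x \<in> ?B" "y \<in> ?B" for x y
  proof -
    have "\<bar>G x - G y\<bar> \<le> real CARD('n) * e' * dist x y"
    proof (rule has_gradient_on_lipschitz[OF GG _ _ that])
      show "convex ?B" by (intro convex_Int S convex_ball)
      fix i y assume y: "y \<in> ?B"
      then have "dist y z < d0 i" using d(2)[of i] by (auto simp: dist_commute)
      then show "\<bar>g i y + (\<Sum>j\<in>UNIV. (- g j z) * (if i = j then 1 else 0))\<bar> \<le> e'"
        using d0(2)[of y i] y T by (auto simp: if_distrib[of "\<lambda>x. _ * x"] cong: if_cong)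
    qed
    then show ?thesis by (simp add: e'_def)
  qed
  have cG: "continuous_on ?T G"
    unfolding G_def by (intro continuous_intros continuous_on_subset[OF cf]) auto
  have sub: "?B \<subseteq> ?T" "?T \<subseteq> closure ?B"
    using T open_Int_closure_subset[of "ball z d" S] by (auto simp: Int_commute)
  have "norm (f y - f z - (\<Sum>i\<in>UNIV. g i z * (y - z) $ i)) \<le> e * norm (y - z)"
    if y: "y \<in> T" "norm (y - z) < d" for y
  proof -
    have "\<bar>G y - G z\<bar> \<le> e * dist y z"
      by (rule estimate_on_closure[OF sub cG _ GB])
        (use y z d in \<open>auto simp: dist_norm norm_minus_commute intro!: continuous_intros\<close>)
    moreover have "G y - G z = f y - f z - (\<Sum>i\<in>UNIV. g i z * (y - z) $ i)"
      by (simp add: G_def sum_negf right_diff_distrib sum_subtractf)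
    ultimately show ?thesis by (simp add: dist_norm)
  qed
  then show "\<exists>d>0. \<forall>y\<in>T. norm (y - z) < d \<longrightarrow>
      norm (f y - f z - (\<Sum>i\<in>UNIV. g i z * (y - z) $ i)) \<le> e * norm (y - z)"
    using d by blast
qed

text \<open>A component of the gradient is determined by the values along any set of parameters accumulating at
\<open>0\<close>; this covers interior, one-sided and tangential directions.\<close>

lemma has_gradient_on_unique:
  assumes 1: "has_gradient_on f1 g1 S1" and 2: "has_gradient_on f2 g2 S2"
    and T: "0 \<in> T" "0 islimpt T" "\<And>t. t \<in> T \<Longrightarrow> z + t *\<^sub>R axis j 1 \<in> S1 \<inter> S2"
    and eq: "\<And>t. t \<in> T \<Longrightarrow> f1 (z + t *\<^sub>R axis j 1) = f2 (z + t *\<^sub>R axis j 1)"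
  shows "g1 j z = g2 j z"
proof -
  have z: "z \<in> S1" "z \<in> S2" using T(3)[OF T(1)] by auto
  have d1: "((\<lambda>t. f1 (z + t *\<^sub>R axis j 1)) has_field_derivative g1 j z) (at 0 within T)"
    by (rule has_gradient_on_axis[OF 1 z(1) T(1)]) (use T in auto)
  have "((\<lambda>t. f2 (z + t *\<^sub>R axis j 1)) has_field_derivative g2 j z) (at 0 within T)"
    by (rule has_gradient_on_axis[OF 2 z(2) T(1)]) (use T in auto)
  then have "((\<lambda>t. f1 (z + t *\<^sub>R axis j 1)) has_field_derivative g2 j z) (at 0 within T)"
    by (rule has_field_derivative_transform_within[OF _ zero_less_one T(1)]) (use eq in auto)
  then show ?thesis using d1 T(2) unfolding has_real_derivative_iff_has_vector_derivative
    by (intro vector_derivative_unique_within) (auto simp: trivial_limit_within)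
qed

lemma islimpt_zero_intervals:
  fixes \<delta> :: real
  assumes "0 < \<delta>"
  shows "0 islimpt {-\<delta><..<\<delta>}" "0 islimpt {0..<\<delta>}" "0 islimpt {-\<delta><..0}"
proof -
  have *: "\<exists>t. 0 < t \<and> t < \<delta> \<and> t < e" if "0 < e" for e
    using assms that by (intro exI[of _ "min \<delta> e / 2"]) auto
  show "0 islimpt {-\<delta><..<\<delta>}"
    unfolding islimpt_approachable
  proof (intro allI impI)
    fix e :: real assume "0 < e"
    then obtain t where "0 < t" "t < \<delta>" "t < e" using * by blast
    then show "\<exists>x'\<in>{-\<delta><..<\<delta>}. x' \<noteq> 0 \<and> dist x' 0 < e"
      by (intro bexI[of _ t]) (auto simp: dist_real_def)
  qed
  show "0 islimpt {0..<\<delta>}"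
    unfolding islimpt_approachable
  proof (intro allI impI)
    fix e :: real assume "0 < e"
    then obtain t where "0 < t" "t < \<delta>" "t < e" using * by blast
    then show "\<exists>x'\<in>{0..<\<delta>}. x' \<noteq> 0 \<and> dist x' 0 < e"
      by (intro bexI[of _ t]) (auto simp: dist_real_def)
  qed
  show "0 islimpt {-\<delta><..0}"
    unfolding islimpt_approachable
  proof (intro allI impI)
    fix e :: real assume "0 < e"
    then obtain t where "0 < t" "t < \<delta>" "t < e" using * by blast
    then show "\<exists>x'\<in>{-\<delta><..0}. x' \<noteq> 0 \<and> dist x' 0 < e"
      by (intro bexI[of _ "-t"]) (auto simp: dist_real_def)
  qed
qed

lemma holder_bd_uniformly_continuous:
  fixes f :: "real^'n::finite \<Rightarrow> real"
  assumes "holder_bd S K 0 f"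
  shows "uniformly_continuous_on S f"
  unfolding uniformly_continuous_on_def
proof (intro allI impI)
  fix e :: real assume e: "e > 0"
  define d where "d = (e / (K + 1)) powr (1 / \<alpha>)"
  have K: "K \<ge> 0" using assms by simp
  have d: "d > 0" using e K by (simp add: d_def)
  have "dist (f x') (f x) < e" if "x \<in> S" "x' \<in> S" "dist x' x < d" for x x'
  proof -
    have "dist x' x powr \<alpha> < d powr \<alpha>" using \<alpha> that by (intro powr_less_mono2) auto
    also have "d powr \<alpha> = e / (K + 1)" using \<alpha> e K by (simp add: d_def powr_powr)
    finally have *: "dist x' x powr \<alpha> < e / (K + 1)" .
    have "dist (f x') (f x) \<le> K * dist x' x powr \<alpha>" using assms that by (auto simp: dist_real_def)
    also have "\<dots> \<le> K * (e / (K + 1))" using * K by (intro mult_left_mono) auto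
    also have "\<dots> < e" using e K by (simp add: field_simps)
    finally show ?thesis .
  qed
  then show "\<exists>d>0. \<forall>x\<in>S. \<forall>x'\<in>S. dist x' x < d \<longrightarrow> dist (f x') (f x) < e" using d by blast
qed

text \<open>Functions with Hoelder bounds are uniformly continuous and hence extend, together with all their
derivatives, to boundary points, with the same bounds.\<close>

lemma holder_bd_extend_closure:
  fixes S :: "(real^'n::finite) set"
  assumes S: "convex S" "open S" and T: "convex T" "S \<subseteq> T" "T \<subseteq> closure S"
  shows "holder_bd S K k f \<Longrightarrow> \<exists>f'. holder_bd T K k f' \<and> (\<forall>x\<in>S. f' x = f x)"
proof (induction k arbitrary: f)
  case 0
  obtain f' where f': "uniformly_continuous_on (closure S) f'" "\<And>x. x \<in> S \<Longrightarrow> f x = f' x"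
    using uniformly_continuous_on_extension_on_closure[OF holder_bd_uniformly_continuous[OF 0]] by metis
  have cf: "continuous_on T f'"
    using f'(1) T continuous_on_subset uniformly_continuous_imp_continuous by blast
  have "continuous_on {0..} (\<lambda>t. K * t powr \<alpha>)"
    using \<alpha> by (intro continuous_on_mult_left continuous_on_powr') (auto intro!: continuous_intros)
  from estimate_on_closure[OF T(2,3) cf this] have "\<bar>f' x - f' y\<bar> \<le> K * dist x y powr \<alpha>"
    if "x \<in> T" "y \<in> T" for x y using that 0 f'(2) by auto
  moreover have "\<bar>f' x\<bar> \<le> K" if "x \<in> T" for x
    by (rule bound_on_closure[OF T(3,2) _ _ that])
      (use 0 f'(2) in \<open>auto intro!: continuous_intros cf\<close>)
  ultimately show ?case using 0 f'(2) by (intro exI[of _ f']) auto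
next
  case (Suc k)
  obtain g where g: "has_gradient_on f g S" "\<And>i. holder_bd S K k (g i)"
    using holder_bd_SucE[OF Suc.prems] by blast
  obtain g' where g': "\<And>i. holder_bd T K k (g' i)" "\<And>i x. x \<in> S \<Longrightarrow> g' i x = g i x"
    using Suc.IH[OF g(2)] by metis
  have "\<exists>K. holder_bd S K 0 f" using holder_bd_lower_ex[OF S(1)] Suc.prems by blast
  then obtain f' where f': "uniformly_continuous_on (closure S) f'" "\<And>x. x \<in> S \<Longrightarrow> f x = f' x"
    using uniformly_continuous_on_extension_on_closure[OF holder_bd_uniformly_continuous] by metis
  have cf: "continuous_on T f'"
    using f'(1) T continuous_on_subset uniformly_continuous_imp_continuous by blast
  have "has_gradient_on f' g' S"
    by (rule has_gradient_on_cong[OF g(1)]) (use f' g' in auto)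
  from has_gradient_on_closure[OF S(1) T(2,3) this S(2) cf holder_bd_continuous[OF T(1) g'(1)]]
  have "has_gradient_on f' g' T" .
  moreover have "\<bar>f' x\<bar> \<le> K" if "x \<in> T" for x
    by (rule bound_on_closure[OF T(3,2) _ _ that])
      (use holder_bd_bound[OF Suc.prems] f'(2) in \<open>auto intro!: continuous_intros cf\<close>)
  ultimately have "holder_bd T K (Suc k) f'" using g' by (intro holder_bd_SucI) auto
  then show ?case using f'(2) by (intro exI[of _ f']) auto
qed

lemma holder_bd_extend_closure_continuous:
  fixes S :: "(real^'n::finite) set"
  assumes "convex S" "open S" and T: "convex T" "S \<subseteq> T" "T \<subseteq> closure S"
    and f: "holder_bd S K k f" and cf: "continuous_on T f"
  shows "holder_bd T K k f"
proof -
  obtain f' where f': "holder_bd T K k f'" "\<And>x. x \<in> S \<Longrightarrow> f' x = f x"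
    using holder_bd_extend_closure[OF assms(1-5) f] by blast
  have "\<bar>f x - f' x\<bar> \<le> 0" if "x \<in> T" for x
    by (rule bound_on_closure[OF T(3,2) _ _ that])
      (use f'(2) in \<open>auto intro!: continuous_intros cf holder_bd_continuous[OF T(1) f'(1)]\<close>)
  then show ?thesis by (intro holder_bd_cong[OF f'(1)]) auto
qed

text \<open>On the interface the derivatives within both halves agree and their union is the whole set.\<close>

lemma has_gradient_on_glue:
  fixes V :: "(real^'n::finite) set"
  assumes V: "open V"
    and 1: "has_gradient_on f1 g1 (V \<inter> {y. 0 \<le> y $ m})" and 2: "has_gradient_on f2 g2 (V \<inter> {y. y $ m \<le> 0})"
    and f: "\<And>y. y \<in> V \<Longrightarrow> y $ m = 0 \<Longrightarrow> f1 y = f2 y"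
    and g: "\<And>i y. y \<in> V \<Longrightarrow> y $ m = 0 \<Longrightarrow> g1 i y = g2 i y"
  shows "has_gradient_on (\<lambda>y. if 0 \<le> y $ m then f1 y else f2 y)
    (\<lambda>i y. if 0 \<le> y $ m then g1 i y else g2 i y) V"
    (is "has_gradient_on ?f ?g V")
proof -
  have cont: "continuous_on UNIV (\<lambda>y::real^'n. y $ m)" by (intro continuous_intros)
  have op: "open (V \<inter> {y. 0 < y $ m})" "open (V \<inter> {y. y $ m < 0})"
    using V by (auto intro!: open_Int open_halfspace_component_gt_cart open_halfspace_component_lt_cart)
  have f1: "has_gradient_on ?f ?g (V \<inter> {y. 0 \<le> y $ m})"
    by (rule has_gradient_on_cong[OF 1]) auto
  have f2: "has_gradient_on ?f ?g (V \<inter> {y. y $ m \<le> 0})"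
    by (rule has_gradient_on_cong[OF 2]) (use f g in \<open>auto split: if_splits\<close>)
  show ?thesis
    unfolding has_gradient_on_def
  proof
    fix z assume z: "z \<in> V"
    let ?F = "\<lambda>h. \<Sum>i\<in>UNIV. ?g i z * h $ i"
    consider "0 < z $ m" | "z $ m < 0" | "z $ m = 0" by linarith
    then show "(?f has_derivative ?F) (at z within V)"
    proof cases
      case 1
      have "has_gradient_on ?f ?g (V \<inter> {y. 0 < y $ m})"
        by (rule has_gradient_on_subset[OF f1]) auto
      then have "(?f has_derivative ?F) (at z within V \<inter> {y. 0 < y $ m})"
        by (rule has_gradient_onD) (use 1 z in simp)
      moreover have "at z within V \<inter> {y. 0 < y $ m} = at z"
        by (rule at_within_open[OF _ op(1)]) (use 1 z in simp)
      moreover have "at z within V = at z" by (rule at_within_open[OF z V])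
      ultimately show ?thesis by (simp only:)
    next
      case 2
      have "has_gradient_on ?f ?g (V \<inter> {y. y $ m < 0})"
        by (rule has_gradient_on_subset[OF f2]) auto
      then have "(?f has_derivative ?F) (at z within V \<inter> {y. y $ m < 0})"
        by (rule has_gradient_onD) (use 2 z in simp)
      moreover have "at z within V \<inter> {y. y $ m < 0} = at z"
        by (rule at_within_open[OF _ op(2)]) (use 2 z in simp)
      moreover have "at z within V = at z" by (rule at_within_open[OF z V])
      ultimately show ?thesis by (simp only:)
    next
      case 3
      have V_eq: "(V \<inter> {y. 0 \<le> y $ m}) \<union> (V \<inter> {y. y $ m \<le> 0}) = V" by auto
      have "(?f has_derivative ?F) (at z within (V \<inter> {y. 0 \<le> y $ m}) \<union> (V \<inter> {y. y $ m \<le> 0}))"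
        using has_gradient_onD[OF f1, of z] has_gradient_onD[OF f2, of z] 3 z
        unfolding has_derivative_within by (intro conjI Lim_Un) auto
      then show ?thesis unfolding V_eq .
    qed
  qed
qed

text \<open>A segment joining the two halves crosses the interface, where both functions agree.\<close>

lemma holder_bd_glue_0:
  fixes V :: "(real^'n::finite) set"
  assumes V: "convex V"
    and 1: "holder_bd (V \<inter> {y. 0 \<le> y $ m}) K 0 f1" and 2: "holder_bd (V \<inter> {y. y $ m \<le> 0}) K 0 f2"
    and f: "\<And>y. y \<in> V \<Longrightarrow> y $ m = 0 \<Longrightarrow> f1 y = f2 y"
  shows "holder_bd V (2 * K) 0 (\<lambda>y. if 0 \<le> y $ m then f1 y else f2 y)"
proof -
  note half1 = 1 and half2 = 2
  have K: "0 \<le> K" using 1 by simp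
  let ?f = "\<lambda>y. if 0 \<le> y $ m then f1 y else f2 y"
  have cross: "\<bar>f1 x - f2 y\<bar> \<le> 2 * K * dist x y powr \<alpha>"
    if x: "x \<in> V" "0 \<le> x $ m" and y: "y \<in> V" "y $ m \<le> 0" for x y
  proof -
    define t where "t = (if x $ m = y $ m then 0 else x $ m / (x $ m - y $ m))"
    have t: "0 \<le> t" "t \<le> 1" using x y by (auto simp: t_def field_simps)
    define z where "z = (1 - t) *\<^sub>R x + t *\<^sub>R y"
    have zs: "z \<in> closed_segment x y" using t by (auto simp: z_def closed_segment_def)
    have zm: "z $ m = 0"
    proof (cases "x $ m = y $ m")
      case True then show ?thesis using x y by (simp add: z_def t_def)
    next
      case False
      have "(x $ m - y $ m) * z $ m = (x $ m - y $ m) * x $ m - ((x $ m - y $ m) * t) * (x $ m - y $ m)"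
        by (simp add: z_def algebra_simps)
      also have "(x $ m - y $ m) * t = x $ m" using False by (simp add: t_def)
      finally have "(x $ m - y $ m) * z $ m = 0" by (simp add: algebra_simps)
      then show ?thesis using False by simp
    qed
    have zV: "z \<in> V" using zs V x y by (meson convex_contains_segment subsetD)
    have "dist x z \<le> dist x y" "dist z y \<le> dist x y"
      using dist_in_closed_segment[OF zs] by (auto simp: dist_commute)
    then have d: "K * dist x z powr \<alpha> \<le> K * dist x y powr \<alpha>" "K * dist z y powr \<alpha> \<le> K * dist x y powr \<alpha>"
      using \<alpha> K by (auto intro!: mult_left_mono powr_mono2)
    have "\<bar>f1 x - f1 z\<bar> \<le> K * dist x z powr \<alpha>" "\<bar>f2 z - f2 y\<bar> \<le> K * dist z y powr \<alpha>"
      using 1 2 x y zV zm by auto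
    then show ?thesis using d f[OF zV zm] by linarith
  qed
  show ?thesis
    unfolding holder_bd.simps(1)
  proof (intro conjI ballI)
    show "0 \<le> 2 * K" using K by simp
    fix x y assume x: "x \<in> V" and y: "y \<in> V"
    have "\<bar>?f x\<bar> \<le> K" using 1 2 x by auto
    then show "\<bar>?f x\<bar> \<le> 2 * K" using K by linarith
    have same: "K * dist x y powr \<alpha> \<le> 2 * K * dist x y powr \<alpha>" using K by (intro mult_right_mono) auto
    consider "0 \<le> x $ m" "0 \<le> y $ m" | "0 \<le> x $ m" "y $ m < 0" | "x $ m < 0" "0 \<le> y $ m" | "x $ m < 0" "y $ m < 0"
      by linarith
    then show "\<bar>?f x - ?f y\<bar> \<le> 2 * K * dist x y powr \<alpha>"
    proof cases
      case 1
      then have "\<bar>f1 x - f1 y\<bar> \<le> K * dist x y powr \<alpha>" using half1 x y by auto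
      then show ?thesis using same 1 by simp
    next
      case 2 then show ?thesis using cross[OF x _ y] by simp
    next
      case 3 then show ?thesis using cross[OF y _ x] by (simp add: abs_minus_commute dist_commute)
    next
      case 4
      then have "\<bar>f2 x - f2 y\<bar> \<le> K * dist x y powr \<alpha>" using half2 x y by auto
      then show ?thesis using same 4 by simp
    qed
  qed
qed

section \<open>Reflection across a flat boundary\<close>

text \<open>On the boundary the Hessian of a function vanishing there has entries only in row and column \<open>m\<close>.\<close>

lemma sum_off_diagonal_vanishing:
  fixes A c :: "'n::finite \<Rightarrow> 'n \<Rightarrow> real"
  assumes A0: "\<And>k l. k \<noteq> m \<Longrightarrow> l \<noteq> m \<Longrightarrow> A k l = 0" and sym: "\<And>k l. A k l = A l k"
  shows "(\<Sum>k\<in>UNIV. \<Sum>l\<in>UNIV. c k l * A k l) = c m m * A m m + (\<Sum>l\<in>UNIV - {m}. (c m l + c l m) * A m l)"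
proof -
  have "(\<Sum>l\<in>UNIV. c k l * A k l) = c k m * A k m" if "k \<noteq> m" for k
    by (subst sum.remove[of _ m]) (use that A0 in auto)
  then have "(\<Sum>k\<in>UNIV - {m}. \<Sum>l\<in>UNIV. c k l * A k l) = (\<Sum>k\<in>UNIV - {m}. c k m * A m k)"
    by (intro sum.cong) (auto simp: sym[of _ m])
  moreover have "(\<Sum>l\<in>UNIV. c m l * A m l) = c m m * A m m + (\<Sum>l\<in>UNIV - {m}. c m l * A m l)"
    by (rule sum.remove) auto
  moreover have "(\<Sum>k\<in>UNIV. \<Sum>l\<in>UNIV. c k l * A k l)
      = (\<Sum>l\<in>UNIV. c m l * A m l) + (\<Sum>k\<in>UNIV - {m}. \<Sum>l\<in>UNIV. c k l * A k l)"
    by (rule sum.remove) auto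
  ultimately show ?thesis by (simp add: distrib_right sum.distrib)
qed

definition mirror :: "'n::finite \<Rightarrow> real^'n \<Rightarrow> real^'n" where
  "mirror m y = (\<chi> k. if k = m then - y $ m else y $ k)"

lemma mirror_component: "mirror m y $ k = (if k = m then - y $ m else y $ k)"
  by (simp add: mirror_def)

lemma dist_mirror: "q $ m = 0 \<Longrightarrow> dist (mirror m y) q = dist y q"
  unfolding dist_norm norm_vec_def L2_set_def
  by (intro arg_cong[where f = sqrt] sum.cong) (auto simp: mirror_component)

lemma mirror_fixed: "y $ m = 0 \<Longrightarrow> mirror m y = y"
  by (auto simp: vec_eq_iff mirror_component)

text \<open>Symmetry of the Hessian persists at boundary points by continuity.\<close>

lemma second_gradient_symmetric:
  fixes f :: "real^'n::finite \<Rightarrow> real"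
  assumes f: "has_gradient_on f g T" and g: "\<And>i. has_gradient_on (g i) (h i) T"
    and h: "\<And>i j. continuous_on T (h i j)"
    and S: "open S" "S \<subseteq> T" "T \<subseteq> closure S" and x: "x \<in> T"
  shows "h i j x = h j i x"
proof -
  have eq: "h i j y = h j i y" if "y \<in> S" for y
  proof (rule second_derivative_symmetric[of f g S h y i j])
    show "has_gradient_on f g S" by (rule has_gradient_on_subset[OF f S(2)])
    show "has_gradient_on (g i) (h i) S" for i by (rule has_gradient_on_subset[OF g S(2)])
    show "continuous_on S (h i j)" for i j by (rule continuous_on_subset[OF h S(2)])
  qed (use S that in auto)
  have cont: "continuous_on T (\<lambda>x. \<bar>h i j x - h j i x\<bar>)"
    using h[of i j] h[of j i] by (intro continuous_intros)
  have "\<bar>h i j x - h j i x\<bar> \<le> 0"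
    by (rule bound_on_closure[OF S(3,2), of "\<lambda>x. \<bar>h i j x - h j i x\<bar>", OF cont _ x]) (simp add: eq)
  then show ?thesis by simp
qed

lemma half_ball_closure:
  fixes q :: "real^'n::finite"
  shows "ball q r \<inter> {y. 0 \<le> y $ m} \<subseteq> closure (ball q r \<inter> {y. 0 < y $ m})"
    "ball q r \<inter> {y. y $ m \<le> 0} \<subseteq> closure (ball q r \<inter> {y. y $ m < 0})"
proof -
  show "ball q r \<inter> {y. 0 \<le> y $ m} \<subseteq> closure (ball q r \<inter> {y. 0 < y $ m})"
    "ball q r \<inter> {y. y $ m \<le> 0} \<subseteq> closure (ball q r \<inter> {y. y $ m < 0})"
    using open_Int_closure_subset[of "ball q r" "{y. 0 < y $ m}"]
      open_Int_closure_subset[of "ball q r" "{y. y $ m < 0}"] by auto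
qed

lemma convex_half_ball:
  fixes q :: "real^'n::finite"
  shows "convex (ball q r \<inter> {y. 0 \<le> y $ m})" "convex (ball q r \<inter> {y. y $ m \<le> 0})"
    "convex (ball q r \<inter> {y. 0 < y $ m})"
  using convex_halfspace_ge[of 0 "axis m 1 :: real^'n"] convex_halfspace_le[of "axis m 1 :: real^'n" 0]
    convex_halfspace_gt[of 0 "axis m 1 :: real^'n"]
  by (auto intro!: convex_Int simp: inner_axis')

lemma component_near_ball:
  fixes q :: "real^'n::finite"
  assumes z: "z \<in> ball q r"
  obtains \<delta> where "0 < \<delta>" "\<And>t. \<bar>t\<bar> < \<delta> \<Longrightarrow> z + t *\<^sub>R axis j 1 \<in> ball q r"
proof
  show "0 < r - dist q z" using z by simp
  fix t assume "\<bar>t\<bar> < r - dist q z"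
  moreover have "dist q (z + t *\<^sub>R axis j 1) \<le> dist q z + \<bar>t\<bar>"
    using dist_triangle[of q "z + t *\<^sub>R axis j 1" z] by (simp add: dist_norm)
  ultimately show "z + t *\<^sub>R axis j 1 \<in> ball q r" by simp
qed

text \<open>Functions that coincide on the hyperplane have the same derivatives along it. With the zero function
this says that tangential derivatives of a function vanishing on the hyperplane are zero.\<close>

lemma tangential_derivatives_agree:
  fixes q :: "real^'n::finite"
  assumes 1: "has_gradient_on f1 g1 S1" and 2: "has_gradient_on f2 g2 S2"
    and S: "\<And>y. y \<in> ball q r \<Longrightarrow> y $ m = 0 \<Longrightarrow> y \<in> S1 \<inter> S2"
    and eq: "\<And>y. y \<in> ball q r \<Longrightarrow> y $ m = 0 \<Longrightarrow> f1 y = f2 y"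
    and z: "z \<in> ball q r" "z $ m = 0" and j: "j \<noteq> m"
  shows "g1 j z = g2 j z"
proof -
  obtain \<delta> where \<delta>: "0 < \<delta>" "\<And>t. \<bar>t\<bar> < \<delta> \<Longrightarrow> z + t *\<^sub>R axis j 1 \<in> ball q r"
    using component_near_ball[OF z(1)] by blast
  have in_plane: "(z + t *\<^sub>R axis j 1) $ m = 0" for t using z j by (simp add: axis_def)
  have in_ball: "z + t *\<^sub>R axis j 1 \<in> ball q r" if "t \<in> {-\<delta><..<\<delta>}" for t
    using \<delta>(2)[of t] that by (auto simp: abs_less_iff)
  show ?thesis
    by (rule has_gradient_on_unique[OF 1 2 _ islimpt_zero_intervals(1)[OF \<delta>(1)]])
      (use \<delta> S[OF in_ball in_plane] eq[OF in_ball in_plane] in auto)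
qed

lemma half_ball_gradient_unique:
  fixes q :: "real^'n::finite"
  assumes 1: "has_gradient_on f g (ball q r \<inter> {y. y $ m \<le> 0})"
    and 2: "has_gradient_on f g' (ball q r \<inter> {y. y $ m \<le> 0})"
    and z: "z \<in> ball q r" "z $ m \<le> 0"
  shows "g m z = g' m z"
proof -
  obtain \<delta> where \<delta>: "0 < \<delta>" "\<And>t. \<bar>t\<bar> < \<delta> \<Longrightarrow> z + t *\<^sub>R axis m 1 \<in> ball q r"
    using component_near_ball[OF z(1)] by blast
  have "z + t *\<^sub>R axis m 1 \<in> ball q r" "(z + t *\<^sub>R axis m 1) $ m \<le> 0" if "t \<in> {-\<delta><..0}" for t
    using \<delta>(2)[of t] that z by (auto simp: abs_less_iff)
  then show ?thesis
    by (intro has_gradient_on_unique[OF 1 2 _ islimpt_zero_intervals(3)[OF \<delta>(1)]])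
      (use \<delta>(1) in auto)
qed

lemma mirror_compose_ex:
  fixes q :: "real^'n::finite"
  assumes q: "q $ m = 0" and f: "\<exists>M. holder_bd (ball q r \<inter> {y. 0 \<le> y $ m}) M (Suc k) f"
  shows "\<exists>M. holder_bd (ball q r \<inter> {y. y $ m \<le> 0}) M (Suc k) (\<lambda>y. f (mirror m y))"
proof (rule holder_bd_compose_ex[OF _ _ _ f])
  let ?S = "ball q r \<inter> {y. y $ m \<le> 0}"
  show conv: "convex ?S" by (rule convex_half_ball)
  show "mirror m y \<in> ball q r \<inter> {y. 0 \<le> y $ m}" if "y \<in> ?S" for y
    using that dist_mirror[OF q, of y] by (auto simp: dist_commute mirror_component)
  fix j
  have comp: "\<exists>M. holder_bd ?S M (Suc k) (\<lambda>y. y $ i)" for i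
    by (rule holder_bd_component_ex) (auto intro: conv bounded_subset[OF bounded_ball])
  then have "\<exists>M. holder_bd ?S M (Suc k) (\<lambda>y. - y $ i)" for i
    using holder_bd_uminus by blast
  with comp show "\<exists>M. holder_bd ?S M (Suc k) (\<lambda>y. mirror m y $ j)"
    by (cases "j = m") (auto simp: mirror_component)
qed

text \<open>The gradient and the Hessian are quantified universally, so that they need not be chosen: on a half-ball
they are unique.\<close>

definition flat_solution ::
    "('n::finite \<Rightarrow> 'n \<Rightarrow> real^'n \<Rightarrow> real) \<Rightarrow> ('n \<Rightarrow> real^'n \<Rightarrow> real) \<Rightarrow> 'n \<Rightarrow> (real^'n) set \<Rightarrow>
     (real^'n \<Rightarrow> real) \<Rightarrow> bool" where
  "flat_solution al be m S v \<longleftrightarrow> (\<forall>y\<in>S. y $ m = 0 \<longrightarrow> v y = 0 \<and>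
     (\<forall>v1 v2. has_gradient_on v v1 S \<longrightarrow> (\<forall>i. has_gradient_on (v1 i) (v2 i) S) \<longrightarrow>
        (\<forall>i j. continuous_on S (v2 i j)) \<longrightarrow>
        (\<Sum>k\<in>UNIV. \<Sum>l\<in>UNIV. al k l y * v2 k l y) + (\<Sum>k\<in>UNIV. be k y * v1 k y) = 0))"

text \<open>The heart of the argument. In terms of \<open>Z\<^sub>k = \<alpha>\<^sub>k\<^sub>m + \<alpha>\<^sub>m\<^sub>k\<close> and \<open>\<Gamma> = \<beta>\<^sub>m\<close>, both evaluated at the mirror
image, the reflection is \<open>R y = y - y\<^sub>m Z\<close> in tangential components and \<open>- y\<^sub>m + y\<^sub>m\<^sup>2 \<Gamma>\<close> in the normal
one. At the interface, \<open>w = - v \<circ> R\<close> has the same first derivatives as \<open>v\<close>, and hence the same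
second derivatives with at least one tangential index; the remaining one is
\<open>w\<^sub>m\<^sub>m = - v\<^sub>m\<^sub>m - 2 (\<Sum>k\<noteq>m. Z\<^sub>k v\<^sub>k\<^sub>m) - 2 \<Gamma> v\<^sub>m\<close>, which equals \<open>v\<^sub>m\<^sub>m\<close> precisely by the equation. Taking the
coefficients at the mirror image places them inside the half-ball on which they are defined.\<close>

lemma flat_reflection:
  fixes q :: "real^'n::finite" and al :: "'n \<Rightarrow> 'n \<Rightarrow> real^'n \<Rightarrow> real" and be :: "'n \<Rightarrow> real^'n \<Rightarrow> real" and m :: 'n
  defines "P \<equiv> \<lambda>r. ball q r \<inter> {y. 0 \<le> y $ m}"
  assumes q: "q $ m = 0" and \<rho>: "0 < \<rho>"
    and al: "\<And>k l. \<exists>M. holder_bd (P \<rho>) M 2 (al k l)" and be: "\<And>k. \<exists>M. holder_bd (P \<rho>) M 2 (be k)"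
    and al1: "\<And>y. y \<in> P \<rho> \<Longrightarrow> al m m y = 1"
  obtains r R C where "0 < r" "r \<le> \<rho>" "\<And>y. y \<in> ball q r \<Longrightarrow> y $ m \<le> 0 \<Longrightarrow> R y \<in> P \<rho>" "0 \<le> C"
    "\<And>v K. holder_bd (P \<rho>) K 2 v \<Longrightarrow> flat_solution al be m (P \<rho>) v \<Longrightarrow>
      holder_bd (ball q r) (C * K) 2 (\<lambda>y. if 0 \<le> y $ m then v y else - v (R y))"
proof -
  define N where "N r = ball q r \<inter> {y. y $ m \<le> 0}" for r
  have two: "(2::nat) = Suc (Suc 0)" by simp
  have convP: "convex (P r)" and convN: "convex (N r)" for r
    unfolding P_def N_def by (rule convex_half_ball)+
  define Z where "Z k y = al k m (mirror m y) + al m k (mirror m y)" for k y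
  define \<Gamma> where "\<Gamma> y = be m (mirror m y)" for y
  have Zex: "\<exists>M. holder_bd (N \<rho>) M 2 (Z k)" for k
  proof -
    have "\<exists>M. holder_bd (N \<rho>) M 2 (\<lambda>y. al i j (mirror m y))" for i j
      using mirror_compose_ex[OF q, of \<rho> "Suc 0" "al i j"] al[of i j] unfolding N_def P_def two by blast
    then show ?thesis unfolding Z_def by (intro holder_bd_add_ex)
  qed
  have \<Gamma>ex: "\<exists>M. holder_bd (N \<rho>) M 2 \<Gamma>"
    using mirror_compose_ex[OF q, of \<rho> "Suc 0" "be m"] be[of m] unfolding N_def P_def two \<Gamma>_def by blast
  have yex: "\<exists>M. holder_bd (N \<rho>) M 2 (\<lambda>y. y $ k)" for k
    by (rule holder_bd_component_ex) (auto simp: N_def convex_half_ball intro: bounded_subset[OF bounded_ball])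
  define Rc where "Rc k y = (if k = m then - y $ m + y $ m * y $ m * \<Gamma> y else y $ k - y $ m * Z k y)"
    for k y
  \<comment> \<open>Sign and size: \<open>R\<close> turns \<open>y\<^sub>m \<le> 0\<close> into \<open>- y\<^sub>m (1 - y\<^sub>m \<Gamma>) \<ge> 0\<close> once \<open>|y\<^sub>m \<Gamma>| \<le> 1\<close>, and it fixes the hyperplane.\<close>
  define R where "R y = (\<chi> k. Rc k y)" for y
  have Rk: "R y $ k = Rc k y" for y k by (simp add: R_def)
  have Rex: "\<exists>M. holder_bd (N \<rho>) M 2 (Rc k)" for k
  proof (cases "k = m")
    case True
    have "Rc k = (\<lambda>y. (y $ m * y $ m) * \<Gamma> y - y $ m)" using True by (auto simp: Rc_def)
    then show ?thesis
      by (auto intro!: holder_bd_diff_ex holder_bd_mult_ex[OF convN] yex \<Gamma>ex)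
  next
    case False
    then have "Rc k = (\<lambda>y. y $ k - y $ m * Z k y)" by (auto simp: Rc_def)
    then show ?thesis
      by (auto intro!: holder_bd_diff_ex holder_bd_mult_ex[OF convN] yex Zex)
  qed
  obtain L where L: "L \<ge> 1" "\<And>x y. x \<in> N \<rho> \<Longrightarrow> y \<in> N \<rho> \<Longrightarrow> dist (R x) (R y) \<le> L * dist x y"
    using holder_bd_lipschitz_map[OF convN, of \<rho> "Suc 0" R] Rex unfolding Rk two by blast
  obtain G where G: "holder_bd (N \<rho>) G 2 \<Gamma>" using \<Gamma>ex by blast
  have G0: "0 \<le> G" using G holder_bd_nonneg by blast
  \<comment> \<open>The first radius keeps \<open>R y\<close> inside the given ball, the second keeps it above the hyperplane.\<close>
  define r where "r = min (\<rho> / L) (1 / (G + 1))"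
  have r: "0 < r" "r \<le> \<rho>" "r * (G + 1) \<le> 1" "L * r \<le> \<rho>"
  proof -
    show "0 < r" using \<rho> L(1) G0 by (simp add: r_def)
    have "\<rho> / L \<le> \<rho>" using \<rho> L(1) by (simp add: divide_le_eq)
    then show "r \<le> \<rho>" by (simp add: r_def)
    have "r \<le> 1 / (G + 1)" "r \<le> \<rho> / L" by (auto simp: r_def)
    then show "r * (G + 1) \<le> 1" "L * r \<le> \<rho>" using G0 L(1) by (auto simp: field_simps)
  qed
  have Nsub: "N r \<subseteq> N \<rho>" and Psub: "P r \<subseteq> P \<rho>" using r(2) by (auto simp: N_def P_def)
  have R_fixed: "R y = y" if "y $ m = 0" for y
    using that by (auto simp: vec_eq_iff Rk Rc_def)
  have R_maps: "R y \<in> P \<rho>" if y: "y \<in> N r" for y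
  proof -
    have qN: "q \<in> N \<rho>" using q \<rho> by (simp add: N_def)
    have "dist (R y) q \<le> L * dist y q" using L(2)[OF _ qN, of y] y Nsub R_fixed[OF q] by auto
    also have "\<dots> < L * r" using y L(1) by (auto simp: N_def dist_commute)
    finally have "R y \<in> ball q \<rho>" using r(4) by (simp add: dist_commute)
    moreover have "0 \<le> R y $ m"
    proof -
      have "\<bar>y $ m\<bar> \<le> dist y q" using component_le_norm_cart[of "y - q" m] q by (simp add: dist_norm)
      then have ym: "\<bar>y $ m\<bar> \<le> r" using y by (auto simp: N_def dist_commute)
      have "\<bar>y $ m * \<Gamma> y\<bar> \<le> r * G" unfolding abs_mult
        using ym holder_bd_bound[OF G, of y] y Nsub r(1) by (intro mult_mono) auto
      also have "\<dots> \<le> 1" using r(1,3) by (simp add: algebra_simps)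
      finally have "0 \<le> 1 - y $ m * \<Gamma> y" by simp
      moreover have "0 \<le> - y $ m" using y by (simp add: N_def)
      ultimately have "0 \<le> - y $ m * (1 - y $ m * \<Gamma> y)" by (rule mult_nonneg_nonneg[rotated])
      then show ?thesis by (simp add: Rk Rc_def algebra_simps)
    qed
    ultimately show ?thesis by (simp add: P_def)
  qed
  have Rex_r: "\<exists>M. holder_bd (N r) M (Suc (Suc 0)) (\<lambda>y. R y $ j)" for j
    using Rex[of j] holder_bd_subset[OF _ Nsub] unfolding Rk two by blast
  obtain C1 where C1: "C1 \<ge> 0"
    "\<And>f K. holder_bd (P \<rho>) K 2 f \<Longrightarrow> holder_bd (N r) (C1 * K) 2 (\<lambda>y. f (R y))"
    using holder_bd_compose[OF convN R_maps Rex_r] unfolding two by blast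
  define e where "e i = (if i = m then 1 else 0 :: real)" for i
  obtain Z1 Z2 where Z1: "\<And>k. has_gradient_on (Z k) (Z1 k) (N r)"
    and Z2: "\<And>k i. has_gradient_on (Z1 k i) (Z2 k i) (N r)"
  proof -
    have "\<exists>g h. has_gradient_on (Z k) g (N r) \<and> (\<forall>i. has_gradient_on (g i) (h i) (N r))" for k
    proof -
      obtain M where "holder_bd (N r) M (Suc (Suc 0)) (Z k)" using Zex[of k] holder_bd_subset[OF _ Nsub] two by metis
      then show ?thesis by (auto simp: holder_bd.simps(2)) metis
    qed
    then show ?thesis using that by metis
  qed
  obtain \<Gamma>1 \<Gamma>2 where \<Gamma>1: "has_gradient_on \<Gamma> \<Gamma>1 (N r)" and \<Gamma>2: "\<And>i. has_gradient_on (\<Gamma>1 i) (\<Gamma>2 i) (N r)"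
  proof -
    obtain M where "holder_bd (N r) M (Suc (Suc 0)) \<Gamma>" using \<Gamma>ex holder_bd_subset[OF _ Nsub] two by metis
    then show ?thesis using that by (auto simp: holder_bd.simps(2)) metis
  qed
  have ym: "has_gradient_on (\<lambda>y. y $ m) (\<lambda>i y. e i) S" for S
    using has_gradient_on_component[of m S] unfolding e_def .
  \<comment> \<open>First derivatives of \<open>R\<close>, and below those of \<open>\<partial>\<^sub>m R\<close>; \<open>e i\<close> is the derivative of \<open>y\<^sub>m\<close> in direction \<open>i\<close>.\<close>
  define R1 where "R1 k i y = (if k = m
      then - e i + ((e i * y $ m + y $ m * e i) * \<Gamma> y + y $ m * y $ m * \<Gamma>1 i y)
      else (if i = k then 1 else 0) + - 1 * (e i * Z k y + y $ m * Z1 k i y))" for k i y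
  have R1: "has_gradient_on (\<lambda>y. R y $ k) (R1 k) (N r)" for k
  proof (cases "k = m")
    case True
    have "has_gradient_on (\<lambda>y. - 1 * y $ m + y $ m * y $ m * \<Gamma> y)
      (\<lambda>i y. - 1 * e i + ((e i * y $ m + y $ m * e i) * \<Gamma> y + y $ m * y $ m * \<Gamma>1 i y)) (N r)"
      by (intro has_gradient_on_add has_gradient_on_mult has_gradient_on_cmult ym \<Gamma>1)
    then show ?thesis by (rule has_gradient_on_cong) (auto simp: True Rk Rc_def R1_def)
  next
    case False
    have "has_gradient_on (\<lambda>y. y $ k + - 1 * (y $ m * Z k y))
      (\<lambda>i y. (if i = k then 1 else 0) + - 1 * (e i * Z k y + y $ m * Z1 k i y)) (N r)"
      by (intro has_gradient_on_add has_gradient_on_mult has_gradient_on_cmult ym Z1 has_gradient_on_component)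
    then show ?thesis by (rule has_gradient_on_cong) (use False in \<open>auto simp: Rk Rc_def R1_def\<close>)
  qed
  define R2 where "R2 k i y = (if k = m
      then 0 + ((2 * e i * \<Gamma> y + 2 * y $ m * \<Gamma>1 i y) +
        ((e i * y $ m + y $ m * e i) * \<Gamma>1 m y + y $ m * y $ m * \<Gamma>2 m i y))
      else - 1 * (Z1 k i y + (e i * Z1 k m y + y $ m * Z2 k m i y)))" for k i y
  have R2: "has_gradient_on (R1 k m) (R2 k) (N r)" for k
  proof (cases "k = m")
    case True
    have "has_gradient_on (\<lambda>y. - 1 + ((2 * y $ m) * \<Gamma> y + y $ m * y $ m * \<Gamma>1 m y))
      (\<lambda>i y. 0 + ((2 * e i * \<Gamma> y + 2 * y $ m * \<Gamma>1 i y) +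
        ((e i * y $ m + y $ m * e i) * \<Gamma>1 m y + y $ m * y $ m * \<Gamma>2 m i y))) (N r)"
      by (intro has_gradient_on_add has_gradient_on_mult has_gradient_on_cmult ym \<Gamma>1 \<Gamma>2 has_gradient_on_const)
    then show ?thesis by (rule has_gradient_on_cong) (auto simp: True R1_def R2_def e_def)
  next
    case False
    have "has_gradient_on (\<lambda>y. - 1 * (Z k y + y $ m * Z1 k m y))
      (\<lambda>i y. - 1 * (Z1 k i y + (e i * Z1 k m y + y $ m * Z2 k m i y))) (N r)"
      by (intro has_gradient_on_add has_gradient_on_mult has_gradient_on_cmult ym Z1 Z2)
    then show ?thesis by (rule has_gradient_on_cong) (use False in \<open>auto simp: R1_def R2_def e_def\<close>)
  qed
  have holder_bd_w: "holder_bd (ball q r) (2 * (1 + C1) * K) 2 (\<lambda>y. if 0 \<le> y $ m then v y else - v (R y))"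
    if v: "holder_bd (P \<rho>) K 2 v" and sol: "flat_solution al be m (P \<rho>) v" for v K
  proof -
    have v0: "v y = 0" if "y \<in> P \<rho>" "y $ m = 0" for y
      using sol that unfolding flat_solution_def by blast
    have eqn: "(\<Sum>k\<in>UNIV. \<Sum>l\<in>UNIV. al k l y * v2 k l y) + (\<Sum>k\<in>UNIV. be k y * v1 k y) = 0"
      if "has_gradient_on v v1 (P \<rho>)" "\<And>i. has_gradient_on (v1 i) (v2 i) (P \<rho>)"
        "\<And>i j. continuous_on (P \<rho>) (v2 i j)" "y \<in> P \<rho>" "y $ m = 0" for v1 v2 y
      using sol that unfolding flat_solution_def by blast
    have K: "0 \<le> K" using v holder_bd_nonneg by blast
    obtain v1 where v1: "has_gradient_on v v1 (P \<rho>)" "\<And>i. holder_bd (P \<rho>) K (Suc 0) (v1 i)"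
      using holder_bd_SucE[OF v[unfolded two]] by blast
    have "\<exists>h. has_gradient_on (v1 i) h (P \<rho>) \<and> (\<forall>j. holder_bd (P \<rho>) K 0 (h j))" for i
      using holder_bd_SucE[OF v1(2)[of i]] by metis
    then obtain v2 where v2: "\<And>i. has_gradient_on (v1 i) (v2 i) (P \<rho>)" "\<And>i j. holder_bd (P \<rho>) K 0 (v2 i j)"
      by metis
    define w where "w y = - v (R y)" for y
    have w: "holder_bd (N r) (C1 * K) 2 w" unfolding w_def by (intro holder_bd_uminus C1 v)
    obtain w1 where w1: "has_gradient_on w w1 (N r)" "\<And>i. holder_bd (N r) (C1 * K) (Suc 0) (w1 i)"
      using holder_bd_SucE[OF w[unfolded two]] by blast
    have "\<exists>h. has_gradient_on (w1 i) h (N r) \<and> (\<forall>j. holder_bd (N r) (C1 * K) 0 (h j))" for i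
      using holder_bd_SucE[OF w1(2)[of i]] by metis
    then obtain w2 where w2: "\<And>i. has_gradient_on (w1 i) (w2 i) (N r)" "\<And>i j. holder_bd (N r) (C1 * K) 0 (w2 i j)"
      by metis
    have flat: "y \<in> P \<rho> \<inter> N r" "y \<in> N r \<inter> P \<rho>" "y \<in> P \<rho>" "y \<in> N r" if "y \<in> ball q r" "y $ m = 0" for y
      using that r(2) by (auto simp: P_def N_def)
    have flat\<rho>: "y \<in> P \<rho> \<inter> UNIV" if "y \<in> ball q \<rho>" "y $ m = 0" for y
      using that by (auto simp: P_def)
    have sub\<rho>: "y \<in> ball q \<rho>" if "y \<in> ball q r" for y using that r(2) by auto
    have v1_0: "v1 k z = 0" if z: "z \<in> ball q \<rho>" "z $ m = 0" and k: "k \<noteq> m" for k z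
      by (rule tangential_derivatives_agree[OF v1(1) has_gradient_on_const[of 0 UNIV] flat\<rho> _ z k])
        (use v0 flat\<rho> in auto)
    have v2_0: "v2 k l z = 0" if z: "z \<in> ball q \<rho>" "z $ m = 0" and k: "k \<noteq> m" and l: "l \<noteq> m" for k l z
      by (rule tangential_derivatives_agree[OF v2(1) has_gradient_on_const[of 0 UNIV] flat\<rho> _ z l])
        (use v1_0 k in auto)
    have v2_sym: "v2 k l z = v2 l k z" if "z \<in> P \<rho>" for k l z
    proof (rule second_gradient_symmetric[of v v1 "P \<rho>" v2 "ball q \<rho> \<inter> {y. 0 < y $ m}", OF v1(1) v2(1) _ _ _ _ that])
      show "continuous_on (P \<rho>) (v2 i j)" for i j by (rule holder_bd_continuous[OF convP v2(2)])
      show "open (ball q \<rho> \<inter> {y. 0 < y $ m})" by (intro open_Int open_ball open_halfspace_component_gt_cart)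
      show "P \<rho> \<subseteq> closure (ball q \<rho> \<inter> {y. 0 < y $ m})" unfolding P_def by (rule half_ball_closure)
    qed (auto simp: P_def)
    have w2_sym: "w2 k l z = w2 l k z" if "z \<in> N r" for k l z
    proof (rule second_gradient_symmetric[of w w1 "N r" w2 "ball q r \<inter> {y. y $ m < 0}", OF w1(1) w2(1) _ _ _ _ that])
      show "continuous_on (N r) (w2 i j)" for i j by (rule holder_bd_continuous[OF convN w2(2)])
      show "open (ball q r \<inter> {y. y $ m < 0})" by (intro open_Int open_ball open_halfspace_component_lt_cart)
      show "N r \<subseteq> closure (ball q r \<inter> {y. y $ m < 0})" unfolding N_def by (rule half_ball_closure)
    qed (auto simp: N_def)
    have match0: "v z = w z" if z: "z \<in> ball q r" "z $ m = 0" for z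
      using v0[OF flat(3)[OF z] z(2)] R_fixed[OF z(2)] by (simp add: w_def)
    define W where "W i y = - 1 * (\<Sum>k\<in>UNIV. v1 k (R y) * R1 k i y)" for i y
    have Wg: "has_gradient_on w W (N r)"
      unfolding W_def
      by (rule has_gradient_on_cong[OF has_gradient_on_cmult[OF has_gradient_on_compose[OF v1(1) R1 R_maps], of "-1"]])
        (auto simp: w_def)
    have w1m: "w1 m y = W m y" if "y \<in> N r" for y
      using half_ball_gradient_unique[of w w1 q r m W y] w1(1) Wg that unfolding N_def by auto
    have R1z: "R1 k m z = (if k = m then - 1 else - Z k z)" if "z $ m = 0" for k z
      using that by (simp add: R1_def e_def)
    have match1: "v1 i z = w1 i z" if z: "z \<in> ball q r" "z $ m = 0" for i z
    proof (cases "i = m")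
      case False
      show ?thesis
        by (rule tangential_derivatives_agree[OF v1(1) w1(1) flat(1) match0 z False])
    next
      case True
      have "(\<Sum>k\<in>UNIV. v1 k z * R1 k m z) = - v1 m z"
        using v1_0[OF sub\<rho>[OF z(1)] z(2)] by (subst sum.remove[of _ m]) (auto simp: R1z[OF z(2)])
      then have "W m z = v1 m z" by (simp add: W_def R_fixed[OF z(2)])
      then show ?thesis using w1m[OF flat(4)[OF z]] True by simp
    qed
    have match2: "v2 i j z = w2 i j z" if z: "z \<in> ball q r" "z $ m = 0" for i j z
    proof -
      have tang: "v2 i j z = w2 i j z" if "j \<noteq> m" for i j
        by (rule tangential_derivatives_agree[OF v2(1) w2(1) flat(1) match1 z that])
      \<comment> \<open>The second normal derivative is the only one for which the equation is used.\<close>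
      have "v2 m m z = w2 m m z"
      proof -
        have zP: "z \<in> P \<rho>" and zN: "z \<in> N r" using flat[OF z] by auto
        have z\<rho>: "z \<in> ball q \<rho>" by (rule sub\<rho>[OF z(1)])
        have "has_gradient_on (w1 m) (\<lambda>i y. - 1 * (\<Sum>k\<in>UNIV. (\<Sum>l\<in>UNIV. v2 k l (R y) * R1 l i y) * R1 k m y
            + v1 k (R y) * R2 k i y)) (N r)"
        proof (rule has_gradient_on_cong)
          show "has_gradient_on (\<lambda>y. - 1 * (\<Sum>k\<in>UNIV. v1 k (R y) * R1 k m y))
            (\<lambda>i y. - 1 * (\<Sum>k\<in>UNIV. (\<Sum>l\<in>UNIV. v2 k l (R y) * R1 l i y) * R1 k m y
            + v1 k (R y) * R2 k i y)) (N r)"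
            by (intro has_gradient_on_cmult has_gradient_on_sum has_gradient_on_mult R2
                has_gradient_on_compose[OF v2(1) R1 R_maps]) auto
        qed (use w1m in \<open>auto simp: W_def\<close>)
        from half_ball_gradient_unique[OF w2(1)[unfolded N_def] this[unfolded N_def] z(1)] z(2)
        have w2mm: "w2 m m z = - (\<Sum>k\<in>UNIV. (\<Sum>l\<in>UNIV. v2 k l z * R1 l m z) * R1 k m z + v1 k z * R2 k m z)"
          by (simp add: R_fixed)
        have s1: "(\<Sum>k\<in>UNIV. v1 k z * R2 k m z) = 2 * \<Gamma> z * v1 m z"
          using v1_0[OF z\<rho> z(2)] z(2) by (subst sum.remove[of _ m]) (auto simp: R2_def e_def)
        have s2: "(\<Sum>k\<in>UNIV. be k z * v1 k z) = \<Gamma> z * v1 m z"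
          using v1_0[OF z\<rho> z(2)] mirror_fixed[OF z(2)]
          by (subst sum.remove[of _ m]) (auto simp: \<Gamma>_def)
        have s3: "(\<Sum>k\<in>UNIV. \<Sum>l\<in>UNIV. al k l z * v2 k l z) = v2 m m z + (\<Sum>l\<in>UNIV - {m}. Z l z * v2 m l z)"
          using sum_off_diagonal_vanishing[of m "\<lambda>k l. v2 k l z" "\<lambda>k l. al k l z", OF v2_0[OF z\<rho> z(2)] v2_sym[OF zP]]
            al1[OF zP] mirror_fixed[OF z(2)] by (simp add: Z_def add.commute)
        have "(\<Sum>k\<in>UNIV. \<Sum>l\<in>UNIV. (R1 k m z * R1 l m z) * v2 k l z)
            = (R1 m m z * R1 m m z) * v2 m m z
              + (\<Sum>l\<in>UNIV - {m}. (R1 m m z * R1 l m z + R1 l m z * R1 m m z) * v2 m l z)"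
          by (rule sum_off_diagonal_vanishing[of m "\<lambda>k l. v2 k l z" "\<lambda>k l. R1 k m z * R1 l m z",
                OF v2_0[OF z\<rho> z(2)] v2_sym[OF zP]])
        also have "(\<Sum>l\<in>UNIV - {m}. (R1 m m z * R1 l m z + R1 l m z * R1 m m z) * v2 m l z)
            = 2 * (\<Sum>l\<in>UNIV - {m}. Z l z * v2 m l z)"
          unfolding sum_distrib_left by (rule sum.cong) (auto simp: R1z[OF z(2)])
        finally have s4: "(\<Sum>k\<in>UNIV. (\<Sum>l\<in>UNIV. v2 k l z * R1 l m z) * R1 k m z)
            = v2 m m z + 2 * (\<Sum>l\<in>UNIV - {m}. Z l z * v2 m l z)"
          by (simp add: R1z[OF z(2)] sum_distrib_left sum_distrib_right mult_ac)
        have "(\<Sum>k\<in>UNIV. \<Sum>l\<in>UNIV. al k l z * v2 k l z) + (\<Sum>k\<in>UNIV. be k z * v1 k z) = 0"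
          by (rule eqn[OF v1(1) v2(1) holder_bd_continuous[OF convP v2(2)] zP z(2)])
        then show ?thesis using w2mm s1 s2 s3 s4 by (simp add: sum.distrib)
      qed
      \<comment> \<open>A normal derivative of a tangential one is, by symmetry, a tangential derivative of a normal one.\<close>
      moreover have "v2 i m z = w2 i m z" if "i \<noteq> m"
        using tang[OF that, of m] v2_sym[OF flat(3)[OF z], of i m] w2_sym[OF flat(4)[OF z], of i m] by simp
      ultimately show ?thesis using tang by (cases "j = m"; cases "i = m") auto
    qed
    let ?K = "(1 + C1) * K"
    have K': "K \<le> ?K" "C1 * K \<le> ?K" using K C1(1) by (auto simp: algebra_simps)
    have vP: "holder_bd (ball q r \<inter> {y. 0 \<le> y $ m}) ?K 0 (v2 i j)" for i j
      using holder_bd_mono[OF holder_bd_subset[OF v2(2) Psub] K'(1)] unfolding P_def .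
    have wN: "holder_bd (ball q r \<inter> {y. y $ m \<le> 0}) ?K 0 (w2 i j)" for i j
      using holder_bd_mono[OF w2(2) K'(2)] unfolding N_def .
    have b0: "\<bar>if 0 \<le> y $ m then v y else w y\<bar> \<le> 2 * ?K" if "y \<in> ball q r" for y
      using holder_bd_bound[OF v, of y] holder_bd_bound[OF w, of y] that K K' Psub by (auto simp: N_def P_def)
    have b1: "\<bar>if 0 \<le> y $ m then v1 i y else w1 i y\<bar> \<le> 2 * ?K" if "y \<in> ball q r" for i y
      using holder_bd_bound[OF v1(2), of y i] holder_bd_bound[OF w1(2), of y i] that K K' Psub by (auto simp: N_def P_def)
    have "holder_bd (ball q r) (2 * ?K) (Suc (Suc 0)) (\<lambda>y. if 0 \<le> y $ m then v y else w y)"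
    proof (rule holder_bd_SucI[OF b0])
      show "has_gradient_on (\<lambda>y. if 0 \<le> y $ m then v y else w y)
          (\<lambda>i y. if 0 \<le> y $ m then v1 i y else w1 i y) (ball q r)"
        by (rule has_gradient_on_glue[OF open_ball has_gradient_on_subset[OF v1(1)] w1(1)[unfolded N_def] match0 match1])
          (use Psub in \<open>auto simp: P_def\<close>)
      fix i
      show "holder_bd (ball q r) (2 * ?K) (Suc 0) (\<lambda>y. if 0 \<le> y $ m then v1 i y else w1 i y)"
      proof (rule holder_bd_SucI[OF b1])
        show "has_gradient_on (\<lambda>y. if 0 \<le> y $ m then v1 i y else w1 i y)
            (\<lambda>j y. if 0 \<le> y $ m then v2 i j y else w2 i j y) (ball q r)"
          by (rule has_gradient_on_glue[OF open_ball has_gradient_on_subset[OF v2(1)] w2(1)[unfolded N_def] match1 match2])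
            (use Psub in \<open>auto simp: P_def\<close>)
        show "holder_bd (ball q r) (2 * ?K) 0 (\<lambda>y. if 0 \<le> y $ m then v2 i j y else w2 i j y)" for j
          by (rule holder_bd_glue_0[OF convex_ball vP wN match2])
      qed
    qed
    then show ?thesis unfolding w_def two mult.assoc .
  qed
  show ?thesis
    by (rule that[OF r(1,2) _ _ holder_bd_w]) (use R_maps C1(1) in \<open>auto simp: N_def\<close>)
qed

section \<open>Boundary charts\<close>

lemma partials_Cons: "partials (i # js) f = partial i (partials js f)"
  by (simp add: partials_def)

lemma partials_Nil [simp]: "partials [] f = f"
  by (simp add: partials_def)

text \<open>Translation from iterated partial derivatives to \<open>holder_bd\<close>.\<close>

lemma holder_bd_of_partials:
  fixes f :: "real^'n::finite \<Rightarrow> real"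
  assumes U: "open U" and K: "0 \<le> K"
    and diff: "\<And>js. length js < k \<Longrightarrow> partials js f differentiable_on U"
    and bd: "\<And>js x. length js \<le> k \<Longrightarrow> x \<in> U \<Longrightarrow> \<bar>partials js f x\<bar> \<le> K"
    and hol: "\<And>js x y. length js = k \<Longrightarrow> x \<in> U \<Longrightarrow> y \<in> U \<Longrightarrow>
      \<bar>partials js f x - partials js f y\<bar> \<le> K * dist x y powr \<alpha>"
  shows "length js + l = k \<Longrightarrow> holder_bd U K l (partials js f)"
proof (induction l arbitrary: js)
  case 0 then show ?case using K bd hol by simp
next
  case (Suc l)
  have "has_gradient_on (partials js f) (\<lambda>i. partials (i # js) f) U"
    unfolding partials_Cons by (rule differentiable_on_has_gradient[OF diff U]) (use Suc in simp)
  then show ?case using Suc bd by (intro holder_bd_SucI[of _ _ _ "\<lambda>i. partials (i # js) f"]) auto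
qed

lemma closure_ext_inside: "x \<in> U \<Longrightarrow> closure_ext U f x = f x"
  by (simp add: closure_ext_def)

lemma finite_multi_indices: "finite {js::'n::finite list. length js \<le> k}"
  using finite_lists_length_le[of "UNIV::'n set" k] by simp

text \<open>Derivatives that extend continuously to a compact closure are bounded.\<close>

lemma C_holder_on_holder_bd_ex:
  fixes f :: "real^'n::finite \<Rightarrow> real"
  assumes f: "C_holder_on k \<alpha> U f" and V: "V \<subseteq> U" "open V" "bounded V" and js: "length js + l = k"
  shows "\<exists>K. holder_bd V K l (partials js f)"
proof -
  have bdd: "\<exists>B\<ge>0. \<forall>x\<in>V. \<bar>partials js f x\<bar> \<le> B" if "length js \<le> k" for js
  proof -
    have "continuous_on (closure U) (closure_ext U (partials js f))"
      using f that by (auto simp: C_holder_on_def)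
    then have "continuous_on (closure V) (closure_ext U (partials js f))"
      using closure_mono[OF V(1)] by (rule continuous_on_subset)
    then have "compact (closure_ext U (partials js f) ` closure V)"
      using V(3) by (intro compact_continuous_image) (auto simp: compact_closure)
    then obtain B where B: "\<And>x. x \<in> closure V \<Longrightarrow> \<bar>closure_ext U (partials js f) x\<bar> \<le> B"
      using compact_imp_bounded by (fastforce simp: bounded_iff)
    have "\<bar>partials js f x\<bar> \<le> max B 0" if "x \<in> V" for x
      using B[of x] that V(1) closure_subset[of V] closure_ext_inside[of x U "partials js f"]
      by (auto simp: subset_iff max.coboundedI1)
    then show ?thesis by (intro exI[of _ "max B 0"]) auto
  qed
  have hol: "\<exists>C\<ge>0. \<forall>x\<in>V. \<forall>y\<in>V. \<bar>partials js f x - partials js f y\<bar> \<le> C * dist x y powr \<alpha>"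
    if "length js = k" for js
  proof -
    have "holder_continuous_on (closure U) \<alpha> (closure_ext U (partials js f))"
      using f that by (auto simp: C_holder_on_def)
    then obtain C where C: "\<And>x y. x \<in> closure U \<Longrightarrow> y \<in> closure U \<Longrightarrow>
        \<bar>closure_ext U (partials js f) x - closure_ext U (partials js f) y\<bar> \<le> C * dist x y powr \<alpha>"
      unfolding holder_continuous_on_def by blast
    have "\<bar>partials js f x - partials js f y\<bar> \<le> max C 0 * dist x y powr \<alpha>" if "x \<in> V" "y \<in> V" for x y
    proof -
      have "x \<in> U" "y \<in> U" using that V(1) by auto
      then have "\<bar>partials js f x - partials js f y\<bar> \<le> C * dist x y powr \<alpha>"
        using C[of x y] closure_subset[of U] by (auto simp: closure_ext_inside subset_iff)
      also have "\<dots> \<le> max C 0 * dist x y powr \<alpha>" by (intro mult_right_mono) auto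
      finally show ?thesis .
    qed
    then show ?thesis by (intro exI[of _ "max C 0"]) auto
  qed
  obtain B where B: "\<And>js x. length js \<le> k \<Longrightarrow> x \<in> V \<Longrightarrow> \<bar>partials js f x\<bar> \<le> B js" "\<And>js. length js \<le> k \<Longrightarrow> 0 \<le> B js"
    using bdd by metis
  obtain C where C: "\<And>js x y. length js = k \<Longrightarrow> x \<in> V \<Longrightarrow> y \<in> V \<Longrightarrow>
      \<bar>partials js f x - partials js f y\<bar> \<le> C js * dist x y powr \<alpha>" "\<And>js. length js = k \<Longrightarrow> 0 \<le> C js"
    using hol by metis
  define M where "M js = B js + (if length js = k then C js else 0)" for js
  define K where "K = (\<Sum>js\<in>{js. length js \<le> k}. M js)"
  have M0: "0 \<le> M js" if "length js \<le> k" for js using B(2)[OF that] C(2)[of js] by (simp add: M_def)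
  have MK: "M js \<le> K" if "length js \<le> k" for js
    unfolding K_def by (rule member_le_sum) (use that M0 finite_multi_indices in auto)
  have BK: "B js \<le> K" if "length js \<le> k" for js
    using MK[OF that] C(2)[of js] by (auto simp: M_def split: if_splits)
  have CK: "C js \<le> K" if "length js = k" for js
    using MK[of js] B(2)[of js] that by (simp add: M_def)
  have "holder_bd V K l (partials js f)"
  proof (rule holder_bd_of_partials[OF V(2) _ _ _ _ js])
    show "0 \<le> K" unfolding K_def by (rule sum_nonneg) (use M0 in auto)
    show "partials js f differentiable_on V" if "length js < k" for js
      using f that V(1) unfolding C_holder_on_def by (blast intro: differentiable_on_subset)
    show "\<bar>partials js f x\<bar> \<le> K" if "length js \<le> k" "x \<in> V" for js x
      using B(1)[OF that] BK[OF that(1)] by linarith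
    show "\<bar>partials js f x - partials js f y\<bar> \<le> K * dist x y powr \<alpha>"
      if "length js = k" "x \<in> V" "y \<in> V" for js x y
    proof -
      have "C js * dist x y powr \<alpha> \<le> K * dist x y powr \<alpha>"
        using CK[OF that(1)] by (intro mult_right_mono) auto
      then show ?thesis using C(1)[OF that] by linarith
    qed
  qed
  then show ?thesis by blast
qed

text \<open>The definition of a chart only says that points of \<open>\<Omega>\<close> go to the upper and boundary points to the
hyperplane. Conversely, the upper half-ball is connected and its image avoids the boundary but meets
\<open>\<Omega>\<close>, because \<open>p\<close> is a boundary point; hence it lies entirely in \<open>\<Omega>\<close>.\<close>

lemma chart_sides:
  fixes \<Omega> :: "(real^'n::finite) set" and q :: "real^'n"
  assumes \<Omega>: "open \<Omega>" and hom: "homeomorphism (ball p r) D \<psi> \<phi>" and p: "p \<in> frontier \<Omega>" "0 < r"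
    and in_side: "\<psi> ` (ball p r \<inter> \<Omega>) \<subseteq> {y. 0 < y $ m}"
    and flat: "\<psi> ` (ball p r \<inter> frontier \<Omega>) \<subseteq> {y. y $ m = 0}"
    and q: "q = \<psi> p" "0 < \<rho>" "ball q \<rho> \<subseteq> D" and y: "y \<in> ball q \<rho>"
  shows "0 < y $ m \<Longrightarrow> \<phi> y \<in> \<Omega>" "y $ m = 0 \<Longrightarrow> \<phi> y \<in> frontier \<Omega>" "y $ m < 0 \<Longrightarrow> \<phi> y \<notin> closure \<Omega>"
proof -
  have \<phi>D: "\<phi> y \<in> ball p r" "\<psi> (\<phi> y) = y" if "y \<in> ball q \<rho>" for y
    using homeomorphism_image2[OF hom] homeomorphism_apply2[OF hom] subsetD[OF q(3) that] by blast+
  have c\<phi>: "continuous_on (ball q \<rho>) \<phi>"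
    by (rule continuous_on_subset[OF homeomorphism_cont2[OF hom] q(3)])
  have c\<psi>: "continuous_on (ball p r) \<psi>" and \<phi>\<psi>: "\<And>x. x \<in> ball p r \<Longrightarrow> \<phi> (\<psi> x) = x"
    using homeomorphism_cont1[OF hom] homeomorphism_apply1[OF hom] by auto
  have fr: "frontier \<Omega> = closure \<Omega> - \<Omega>" using \<Omega> by (simp add: frontier_def interior_open)
  have in_side: "0 < \<psi> x $ m" if "x \<in> ball p r" "x \<in> \<Omega>" for x
    using in_side that by blast
  have flat: "\<psi> x $ m = 0" if "x \<in> ball p r" "x \<in> frontier \<Omega>" for x
    using flat that by blast
  let ?So = "ball q \<rho> \<inter> {y. 0 < y $ m}"
  have img: "\<phi> ` ?So \<subseteq> \<Omega>"
  proof (rule ccontr)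
    assume "\<not> \<phi> ` ?So \<subseteq> \<Omega>"
    then have ne: "\<phi> ` ?So - \<Omega> \<noteq> {}" by blast
    have "connected ?So" by (rule convex_connected) (rule convex_half_ball)
    then have con: "connected (\<phi> ` ?So)"
      by (rule connected_continuous_image[rotated]) (rule continuous_on_subset[OF c\<phi>], blast)
    have "open (ball p r \<inter> \<psi> -` ball q \<rho>)"
      by (rule continuous_open_preimage[OF c\<psi> open_ball open_ball])
    moreover have "p \<in> (ball p r \<inter> \<psi> -` ball q \<rho>) \<inter> closure \<Omega>" using p q fr by simp
    ultimately have "(ball p r \<inter> \<psi> -` ball q \<rho>) \<inter> \<Omega> \<noteq> {}"
      using open_Int_closure_eq_empty by blast
    then obtain x where x: "x \<in> \<Omega>" "x \<in> ball p r" "\<psi> x \<in> ball q \<rho>" by blast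
    then have "0 < \<psi> x $ m" using in_side x by blast
    then have "x \<in> \<phi> ` ?So" using x \<phi>\<psi>[OF x(2)] by (intro image_eqI[of _ _ "\<psi> x"]) auto
    then have "\<phi> ` ?So \<inter> \<Omega> \<noteq> {}" using x by blast
    from connected_Int_frontier[OF con this ne] obtain y where y: "y \<in> ?So" "\<phi> y \<in> frontier \<Omega>" by blast
    then have "\<psi> (\<phi> y) $ m = 0" using flat \<phi>D(1)[of y] by auto
    then show False using y \<phi>D(2)[of y] by simp
  qed
  show "\<phi> y \<in> \<Omega>" if "0 < y $ m" using img y that by auto
  have not_\<Omega>: "\<phi> y \<notin> \<Omega>" if "y $ m \<le> 0"
  proof
    assume "\<phi> y \<in> \<Omega>"
    then have "0 < \<psi> (\<phi> y) $ m" using in_side \<phi>D(1)[OF y] by auto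
    then show False using that \<phi>D(2)[OF y] by simp
  qed
  show "\<phi> y \<in> frontier \<Omega>" if "y $ m = 0"
  proof -
    have "y \<in> closure ?So" using half_ball_closure(1)[of q \<rho> m] y that by auto
    then obtain X where X: "\<And>n. X n \<in> ?So" "X \<longlonglongrightarrow> y" unfolding closure_sequential by blast
    have "(\<lambda>n. \<phi> (X n)) \<longlonglongrightarrow> \<phi> y"
      by (rule continuous_on_tendsto_compose[OF c\<phi> X(2) y]) (use X(1) in auto)
    moreover have "\<phi> (X n) \<in> \<Omega>" for n using img X(1)[of n] by blast
    ultimately have "\<phi> y \<in> closure \<Omega>"
      unfolding closure_sequential by (intro exI[of _ "\<lambda>n. \<phi> (X n)"]) simp
    then show ?thesis using not_\<Omega> that by (simp add: fr)
  qed
  show "\<phi> y \<notin> closure \<Omega>" if "y $ m < 0"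
  proof
    assume "\<phi> y \<in> closure \<Omega>"
    then have "\<phi> y \<in> frontier \<Omega>" using not_\<Omega> that by (simp add: fr)
    then have "\<psi> (\<phi> y) $ m = 0" using flat \<phi>D(1)[OF y] by auto
    then show False using that \<phi>D(2)[OF y] by simp
  qed
qed

lemma sum_swap4:
  fixes F :: "'n::finite \<Rightarrow> 'n \<Rightarrow> 'n \<Rightarrow> 'n \<Rightarrow> real"
  shows "(\<Sum>i\<in>UNIV. \<Sum>j\<in>UNIV. \<Sum>k\<in>UNIV. \<Sum>l\<in>UNIV. F i j k l)
    = (\<Sum>k\<in>UNIV. \<Sum>l\<in>UNIV. \<Sum>i\<in>UNIV. \<Sum>j\<in>UNIV. F i j k l)"
proof -
  have "(\<Sum>i\<in>UNIV. \<Sum>j\<in>UNIV. \<Sum>k\<in>UNIV. \<Sum>l\<in>UNIV. F i j k l)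
      = (\<Sum>i\<in>UNIV. \<Sum>k\<in>UNIV. \<Sum>j\<in>UNIV. \<Sum>l\<in>UNIV. F i j k l)"
    by (rule sum.cong[OF refl]) (rule sum.swap)
  also have "\<dots> = (\<Sum>k\<in>UNIV. \<Sum>i\<in>UNIV. \<Sum>j\<in>UNIV. \<Sum>l\<in>UNIV. F i j k l)"
    by (rule sum.swap)
  also have "\<dots> = (\<Sum>k\<in>UNIV. \<Sum>i\<in>UNIV. \<Sum>l\<in>UNIV. \<Sum>j\<in>UNIV. F i j k l)"
    by (rule sum.cong[OF refl], rule sum.cong[OF refl]) (rule sum.swap)
  also have "\<dots> = (\<Sum>k\<in>UNIV. \<Sum>l\<in>UNIV. \<Sum>i\<in>UNIV. \<Sum>j\<in>UNIV. F i j k l)"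
    by (rule sum.cong[OF refl]) (rule sum.swap)
  finally show ?thesis .
qed

lemma sum_swap3:
  fixes F :: "'n::finite \<Rightarrow> 'n \<Rightarrow> 'n \<Rightarrow> real"
  shows "(\<Sum>i\<in>UNIV. \<Sum>j\<in>UNIV. \<Sum>k\<in>UNIV. F i j k)
    = (\<Sum>k\<in>UNIV. \<Sum>i\<in>UNIV. \<Sum>j\<in>UNIV. F i j k)"
proof -
  have "(\<Sum>i\<in>UNIV. \<Sum>j\<in>UNIV. \<Sum>k\<in>UNIV. F i j k) = (\<Sum>i\<in>UNIV. \<Sum>k\<in>UNIV. \<Sum>j\<in>UNIV. F i j k)"
    by (rule sum.cong[OF refl]) (rule sum.swap)
  also have "\<dots> = (\<Sum>k\<in>UNIV. \<Sum>i\<in>UNIV. \<Sum>j\<in>UNIV. F i j k)"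
    by (rule sum.swap)
  finally show ?thesis .
qed

text \<open>The chain rule for \<open>u = v \<circ> \<psi>\<close>: \<open>V\<close> and \<open>W\<close> stand for the second and first derivatives of \<open>v\<close>, \<open>P k i\<close>
for \<open>\<partial>\<^sub>i \<psi>\<^sub>k\<close> and \<open>Q k i j\<close> for \<open>\<partial>\<^sub>i \<partial>\<^sub>j \<psi>\<^sub>k\<close>. The right-hand side collects the coefficients of the
transformed operator.\<close>

lemma operator_change_of_variables:
  fixes a V P :: "'n::finite \<Rightarrow> 'n \<Rightarrow> real" and b W :: "'n \<Rightarrow> real" and Q :: "'n \<Rightarrow> 'n \<Rightarrow> 'n \<Rightarrow> real"
  shows "(\<Sum>i\<in>UNIV. \<Sum>j\<in>UNIV. a i j * (\<Sum>k\<in>UNIV. (\<Sum>l\<in>UNIV. V k l * P l i) * P k j + W k * Q k i j))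
      + (\<Sum>i\<in>UNIV. b i * (\<Sum>k\<in>UNIV. W k * P k i))
    = (\<Sum>k\<in>UNIV. \<Sum>l\<in>UNIV. (\<Sum>i\<in>UNIV. \<Sum>j\<in>UNIV. a i j * P k j * P l i) * V k l)
      + (\<Sum>k\<in>UNIV. ((\<Sum>i\<in>UNIV. \<Sum>j\<in>UNIV. a i j * Q k i j) + (\<Sum>i\<in>UNIV. b i * P k i)) * W k)"
proof -
  have "(\<Sum>i\<in>UNIV. \<Sum>j\<in>UNIV. \<Sum>k\<in>UNIV. \<Sum>l\<in>UNIV. a i j * P k j * P l i * V k l)
      = (\<Sum>k\<in>UNIV. \<Sum>l\<in>UNIV. \<Sum>i\<in>UNIV. \<Sum>j\<in>UNIV. a i j * P k j * P l i * V k l)"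
    by (rule sum_swap4)
  moreover have "(\<Sum>i\<in>UNIV. \<Sum>j\<in>UNIV. \<Sum>k\<in>UNIV. a i j * Q k i j * W k)
      = (\<Sum>k\<in>UNIV. \<Sum>i\<in>UNIV. \<Sum>j\<in>UNIV. a i j * Q k i j * W k)"
    by (rule sum_swap3)
  moreover have "(\<Sum>i\<in>UNIV. \<Sum>k\<in>UNIV. b i * P k i * W k) = (\<Sum>k\<in>UNIV. \<Sum>i\<in>UNIV. b i * P k i * W k)"
    by (rule sum.swap)
  moreover have "(\<Sum>i\<in>UNIV. \<Sum>j\<in>UNIV. a i j * (\<Sum>k\<in>UNIV. (\<Sum>l\<in>UNIV. V k l * P l i) * P k j + W k * Q k i j))
      = (\<Sum>i\<in>UNIV. \<Sum>j\<in>UNIV. \<Sum>k\<in>UNIV. \<Sum>l\<in>UNIV. a i j * P k j * P l i * V k l)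
        + (\<Sum>i\<in>UNIV. \<Sum>j\<in>UNIV. \<Sum>k\<in>UNIV. a i j * Q k i j * W k)"
    by (simp add: sum.distrib sum_distrib_left sum_distrib_right distrib_left mult_ac)
  ultimately show ?thesis
    by (simp add: sum.distrib sum_distrib_left sum_distrib_right distrib_right distrib_left mult_ac)
qed

section \<open>Reflection across a curved boundary\<close>

abbreviation derivative_terms ::
    "('n::finite \<Rightarrow> 'n \<Rightarrow> real^'n \<Rightarrow> real) \<Rightarrow> ('n \<Rightarrow> real^'n \<Rightarrow> real) \<Rightarrow> (real^'n \<Rightarrow> real) \<Rightarrow> real^'n \<Rightarrow> real" where
  "derivative_terms a b u x \<equiv> (\<Sum>i\<in>UNIV. \<Sum>j\<in>UNIV. a i j x * partials [i, j] u x) +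
     (\<Sum>i\<in>UNIV. b i x * partials [i] u x)"

abbreviation odd_extension ::
    "(real^'n::finite) set \<Rightarrow> (real^'n \<Rightarrow> real^'n) \<Rightarrow> (real^'n \<Rightarrow> real) \<Rightarrow> real^'n \<Rightarrow> real" where
  "odd_extension \<Omega> \<rho> u \<equiv> \<lambda>x. if x \<in> closure \<Omega> then u x else - u (\<rho> x)"

text \<open>The elements of \<open>X_space\<close>, with a bound on their size. Since \<open>u\<close> vanishes on the boundary, the equation
there concerns the terms of second and first order; expressing it by a limit from inside makes it
evidently linear in \<open>u\<close>.\<close>

definition reflectable ::
    "(real^'n::finite) set \<Rightarrow> ('n \<Rightarrow> 'n \<Rightarrow> real^'n \<Rightarrow> real) \<Rightarrow> ('n \<Rightarrow> real^'n \<Rightarrow> real) \<Rightarrow>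
     real \<Rightarrow> (real^'n \<Rightarrow> real) \<Rightarrow> bool" where
  "reflectable \<Omega> a b K u \<longleftrightarrow> holder_bd \<Omega> K 2 u \<and> continuous_on (closure \<Omega>) u \<and>
     (\<forall>z\<in>frontier \<Omega>. u z = 0 \<and>
       ((\<lambda>x. derivative_terms a b u x) \<longlongrightarrow> 0) (at z within \<Omega>))"

text \<open>The normal covector of a chart cannot be small when the derivative of the inverse chart is bounded.\<close>

lemma cauchy_schwarz_lower_bound:
  fixes N F :: "real^'n::finite"
  assumes 1: "(\<Sum>i\<in>UNIV. N $ i * F $ i) = 1" and B: "norm F \<le> B"
  shows "1 / B\<^sup>2 \<le> (norm N)\<^sup>2"
proof -
  have "1 = N \<bullet> F" using 1 by (simp add: inner_vec_def)
  also have "\<dots> \<le> norm N * norm F" by (rule norm_cauchy_schwarz)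
  also have "\<dots> \<le> norm N * B" using B by (intro mult_left_mono) auto
  finally have *: "1 \<le> norm N * B" .
  have "0 \<le> B" using order_trans[OF norm_ge_zero B] .
  moreover have "B \<noteq> 0" using * by auto
  moreover from * have "1 \<le> (norm N * B)\<^sup>2" by (simp add: one_le_power)
  ultimately show ?thesis by (simp add: power_mult_distrib divide_le_eq)
qed

text \<open>In the chart, \<open>v = u \<circ> \<phi>\<close> solves the transformed equation on the hyperplane. Dividing that equation by
its coefficient of the second normal derivative, which ellipticity bounds away from zero, yields the
normalised form to which \<open>flat_reflection\<close> applies; the result is carried back by the chart \<open>\<psi>\<close>.
The coefficients are formed in the open half-ball, where only interior derivatives occur, and then
extended to the hyperplane.\<close>

lemma boundary_reflection:
  fixes \<Omega> :: "(real^'n::finite) set" and lam :: real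
    and a :: "'n \<Rightarrow> 'n \<Rightarrow> real^'n \<Rightarrow> real" and b :: "'n \<Rightarrow> real^'n \<Rightarrow> real"
  assumes \<Omega>: "open \<Omega>" and bdry: "holder_boundary 4 \<alpha> \<Omega>"
    and a: "\<And>i j. \<exists>K. holder_bd \<Omega> K 2 (a i j)" and b: "\<And>i. \<exists>K. holder_bd \<Omega> K 2 (b i)"
    and lam: "lam > 0"
    and ell: "\<And>x \<xi>. x \<in> \<Omega> \<Longrightarrow> (\<Sum>i\<in>UNIV. \<Sum>j\<in>UNIV. a i j x * \<xi> $ i * \<xi> $ j) \<ge> lam * (norm \<xi>)\<^sup>2"
    and p: "p \<in> frontier \<Omega>"
  obtains r \<rho> C where "0 < r" "0 \<le> C" "\<And>x. x \<in> ball p r \<Longrightarrow> \<rho> x \<in> closure \<Omega>"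
    "\<And>u K. reflectable \<Omega> a b K u \<Longrightarrow>
      holder_bd (ball p r) (C * K) 2 (odd_extension \<Omega> \<rho> u)"
proof -
  have two: "(2::nat) = Suc (Suc 0)" by simp
  obtain r0 and D :: "(real^'n) set" and \<psi> \<phi> :: "real^'n \<Rightarrow> real^'n" and m :: 'n where r0: "0 < r0" and D: "open D" and hom: "homeomorphism (ball p r0) D \<psi> \<phi>"
    and in_side: "\<psi> ` (ball p r0 \<inter> \<Omega>) \<subseteq> {y. 0 < y $ m}"
    and flat: "\<psi> ` (ball p r0 \<inter> frontier \<Omega>) \<subseteq> {y. y $ m = 0}"
    and \<psi>C': "\<forall>i. C_holder_on 4 \<alpha> (ball p r0) (\<lambda>x. \<psi> x $ i)" and \<phi>C': "\<forall>i. C_holder_on 4 \<alpha> D (\<lambda>y. \<phi> y $ i)"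
    using bspec[OF bdry[unfolded holder_boundary_def] p] by (elim exE conjE) (rule that, assumption+)
  note \<psi>C = spec[OF \<psi>C'] and \<phi>C = spec[OF \<phi>C']
  define q where "q = \<psi> p"
  have p_in: "p \<in> ball p r0" using r0 by simp
  have q0: "q $ m = 0" using flat p p_in unfolding q_def by blast
  have "q \<in> D" using homeomorphism_image1[OF hom] p_in unfolding q_def by blast
  then obtain \<rho>0 where \<rho>0: "0 < \<rho>0" "ball q \<rho>0 \<subseteq> D" using D open_contains_ball by blast
  have \<phi>V: "\<phi> y \<in> ball p r0" "\<psi> (\<phi> y) = y" if "y \<in> ball q \<rho>0" for y
    using homeomorphism_image2[OF hom] homeomorphism_apply2[OF hom] subsetD[OF \<rho>0(2) that] by blast+
  note \<phi>\<psi> = homeomorphism_apply1[OF hom]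
  note sides = chart_sides[OF \<Omega> hom p r0 in_side flat q_def \<rho>0]
  define So where "So = ball q \<rho>0 \<inter> {y. 0 < y $ m}"
  define Sp where "Sp = ball q \<rho>0 \<inter> {y. 0 \<le> y $ m}"
  have So: "open So" "convex So" "So \<subseteq> Sp" "Sp \<subseteq> closure So" and Sp: "convex Sp"
    unfolding So_def Sp_def
    by (auto intro!: open_Int open_halfspace_component_gt_cart convex_half_ball half_ball_closure[THEN subsetD])
  have \<phi>So: "\<phi> y \<in> \<Omega>" "\<phi> y \<in> ball p r0" "y \<in> ball q \<rho>0" if "y \<in> So" for y
    using that sides(1) \<phi>V unfolding So_def by blast+
  have \<psi>ex: "\<exists>K. holder_bd (ball p r0) K 2 (partials js (\<lambda>x. \<psi> x $ k))" if "length js \<le> 2" for js k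
  proof -
    have "\<exists>K. holder_bd (ball p r0) K (4 - length js) (partials js (\<lambda>x. \<psi> x $ k))"
      by (rule C_holder_on_holder_bd_ex[OF \<psi>C]) (use that in auto)
    then show ?thesis by (rule holder_bd_lower_ex[OF convex_ball]) (use that in auto)
  qed
  have \<phi>ex: "\<exists>K. holder_bd (ball q \<rho>0) K 2 (\<lambda>y. \<phi> y $ k)" for k
  proof -
    have "\<exists>K. holder_bd (ball q \<rho>0) K 4 (partials [] (\<lambda>y. \<phi> y $ k))"
      by (rule C_holder_on_holder_bd_ex[OF \<phi>C]) (use \<rho>0 in auto)
    then show ?thesis using holder_bd_lower_ex[OF convex_ball, of q \<rho>0 4 _ 2] by simp
  qed
  have \<phi>exSo: "\<exists>K. holder_bd So K (Suc (Suc 0)) (\<lambda>y. \<phi> y $ k)" for k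
    using \<phi>ex[of k] holder_bd_subset[of "ball q \<rho>0" _ 2 _ So] unfolding two So_def by blast
  have pull: "\<exists>K. holder_bd So K 2 (\<lambda>y. f (\<phi> y))" if "\<exists>K. holder_bd T K 2 f" "\<And>y. y \<in> So \<Longrightarrow> \<phi> y \<in> T" for f T
    using holder_bd_compose_ex[OF So(2) that(2) \<phi>exSo] that(1) unfolding two by blast

  define P where "P k i x = partials [i] (\<lambda>x. \<psi> x $ k) x" for k i x
  define Q where "Q k i j x = partials [i, j] (\<lambda>x. \<psi> x $ k) x" for k i j x
  have Pg: "has_gradient_on (\<lambda>x. \<psi> x $ k) (P k) (ball p r0)" for k
  proof -
    have "(\<lambda>x. \<psi> x $ k) differentiable_on ball p r0"
      using \<psi>C[of k] unfolding C_holder_on_def by (metis length_0_conv partials_Nil zero_less_numeral)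
    then show ?thesis
      using differentiable_on_has_gradient[OF _ open_ball] unfolding P_def partials_Cons partials_Nil by blast
  qed
  have Qg: "has_gradient_on (P k j) (\<lambda>i. Q k i j) (ball p r0)" for k j
  proof -
    have "partials [j] (\<lambda>x. \<psi> x $ k) differentiable_on ball p r0"
      using \<psi>C[of k] unfolding C_holder_on_def by simp
    then show ?thesis
      using differentiable_on_has_gradient[OF _ open_ball] unfolding P_def Q_def partials_Cons by blast
  qed
  have Pex: "\<exists>K. holder_bd So K 2 (\<lambda>y. P k i (\<phi> y))" for k i
    unfolding P_def by (rule pull[OF \<psi>ex]) (use \<phi>So in auto)
  have Qex: "\<exists>K. holder_bd So K 2 (\<lambda>y. Q k i j (\<phi> y))" for k i j
    unfolding Q_def by (rule pull[OF \<psi>ex]) (use \<phi>So in auto)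
  have aex: "\<exists>K. holder_bd So K 2 (\<lambda>y. a i j (\<phi> y))" for i j
    by (rule pull[OF a]) (use \<phi>So in auto)
  have bex: "\<exists>K. holder_bd So K 2 (\<lambda>y. b i (\<phi> y))" for i
    by (rule pull[OF b]) (use \<phi>So in auto)

  define A where "A k l y = (\<Sum>i\<in>UNIV. \<Sum>j\<in>UNIV. a i j (\<phi> y) * P k j (\<phi> y) * P l i (\<phi> y))" for k l y
  define Bc where "Bc k y = (\<Sum>i\<in>UNIV. \<Sum>j\<in>UNIV. a i j (\<phi> y) * Q k i j (\<phi> y)) +
    (\<Sum>i\<in>UNIV. b i (\<phi> y) * P k i (\<phi> y))" for k y
  have Aex: "\<exists>K. holder_bd So K 2 (A k l)" for k l
    unfolding A_def by (intro holder_bd_sum_ex holder_bd_mult_ex[OF So(2)] aex Pex) auto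
  have Bex: "\<exists>K. holder_bd So K 2 (Bc k)" for k
    unfolding Bc_def by (intro holder_bd_add_ex holder_bd_sum_ex holder_bd_mult_ex[OF So(2)] aex bex Pex Qex) auto

  \<comment> \<open>\<open>A m m\<close> is the quadratic form of \<open>a\<close> at the gradient of \<open>\<psi>\<^sub>m\<close>; differentiating \<open>\<psi>\<^sub>m (\<phi> y) = y\<^sub>m\<close> bounds
    that gradient from below. The summand \<open>1\<close> only serves to avoid division by zero.\<close>
  obtain c where c: "0 < c" "\<And>y. y \<in> So \<Longrightarrow> c \<le> A m m y"
  proof -
    obtain K where K: "\<And>k. holder_bd (ball q \<rho>0) (K k) (Suc (Suc 0)) (\<lambda>y. \<phi> y $ k)" using \<phi>ex unfolding two by metis
    have "\<exists>g. has_gradient_on (\<lambda>y. \<phi> y $ k) g (ball q \<rho>0) \<and> (\<forall>i. holder_bd (ball q \<rho>0) (K k) (Suc 0) (g i))" for k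
      using holder_bd_SucE[OF K[of k]] by metis
    then obtain F where F: "\<And>k. has_gradient_on (\<lambda>y. \<phi> y $ k) (F k) (ball q \<rho>0)"
      "\<And>k i. holder_bd (ball q \<rho>0) (K k) (Suc 0) (F k i)" by metis
    have lb: "lam * (1 / (1 + (\<Sum>k\<in>UNIV. K k))\<^sup>2) \<le> A m m y" if y: "y \<in> So" for y
    proof -
      have "has_gradient_on (\<lambda>y. \<psi> (\<phi> y) $ m) (\<lambda>i y. \<Sum>k\<in>UNIV. P m k (\<phi> y) * F k i y) (ball q \<rho>0)"
        by (rule has_gradient_on_compose[OF Pg F(1)]) (use \<phi>V in auto)
      then have g1: "has_gradient_on (\<lambda>y. y $ m) (\<lambda>i y. \<Sum>k\<in>UNIV. P m k (\<phi> y) * F k i y) (ball q \<rho>0)"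
        by (rule has_gradient_on_cong) (use \<phi>V in auto)
      have "(\<Sum>k\<in>UNIV. P m k (\<phi> y) * F k m y) = 1"
        using has_gradient_on_partial[OF g1 open_ball \<phi>So(3)[OF y], of m]
          has_gradient_on_partial[OF has_gradient_on_component[of m] open_ball \<phi>So(3)[OF y], of m] by simp
      moreover define N where "N = (\<chi> i. P m i (\<phi> y))"
      moreover define f where "f = (\<chi> k. F k m y)"
      ultimately have Nf: "(\<Sum>i\<in>UNIV. N $ i * f $ i) = 1" by simp
      have "norm f \<le> (\<Sum>k\<in>UNIV. \<bar>f $ k\<bar>)" by (rule norm_le_l1_cart)
      also have "\<dots> \<le> (\<Sum>k\<in>UNIV. K k)"
        by (intro sum_mono) (auto simp: f_def intro: holder_bd_bound[OF F(2) \<phi>So(3)[OF y]])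
      also have "\<dots> \<le> 1 + (\<Sum>k\<in>UNIV. K k)" by simp
      finally have "lam * (1 / (1 + (\<Sum>k\<in>UNIV. K k))\<^sup>2) \<le> lam * (norm N)\<^sup>2"
        using lam by (intro mult_left_mono cauchy_schwarz_lower_bound[OF Nf]) auto
      also have "\<dots> \<le> (\<Sum>i\<in>UNIV. \<Sum>j\<in>UNIV. a i j (\<phi> y) * N $ i * N $ j)" by (rule ell[OF \<phi>So(1)[OF y]])
      also have "\<dots> = A m m y" by (simp add: A_def N_def mult_ac)
      finally show ?thesis .
    qed
    have "0 \<le> (\<Sum>k\<in>UNIV. K k)" by (intro sum_nonneg) (rule holder_bd_nonneg[OF K])
    then show thesis using lam lb by (intro that[of "lam * (1 / (1 + (\<Sum>k\<in>UNIV. K k))\<^sup>2)"]) auto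
  qed

  have Iex: "\<exists>K. holder_bd So K 2 (\<lambda>y. inverse (A m m y))"
    by (rule holder_bd_inverse_ex[OF So(2) Aex c])
  have "\<exists>f. (\<exists>K. holder_bd Sp K 2 f) \<and> (\<forall>y\<in>So. f y = g y)" if "\<exists>K. holder_bd So K 2 g" for g
    using that holder_bd_extend_closure[OF So(2,1) Sp So(3,4), of _ 2 g] by blast
  note ext = this
  have "\<exists>f. (\<exists>K. holder_bd Sp K 2 f) \<and> (\<forall>y\<in>So. f y = inverse (A m m y) * A k l y)" for k l
    by (rule ext) (intro holder_bd_mult_ex[OF So(2)] Iex Aex)
  then obtain al where al: "\<And>k l. \<exists>K. holder_bd Sp K 2 (al k l)"
    "\<And>k l y. y \<in> So \<Longrightarrow> al k l y = inverse (A m m y) * A k l y" by metis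
  have "\<exists>f. (\<exists>K. holder_bd Sp K 2 f) \<and> (\<forall>y\<in>So. f y = inverse (A m m y) * Bc k y)" for k
    by (rule ext) (intro holder_bd_mult_ex[OF So(2)] Iex Bex)
  then obtain be where be: "\<And>k. \<exists>K. holder_bd Sp K 2 (be k)"
    "\<And>k y. y \<in> So \<Longrightarrow> be k y = inverse (A m m y) * Bc k y" by metis
  have al_cont: "continuous_on Sp (al k l)" and be_cont: "continuous_on Sp (be k)" for k l
    using al(1) be(1) holder_bd_continuous[OF Sp] by blast+
  have al1: "al m m y = 1" if "y \<in> Sp" for y
  proof -
    have cont: "continuous_on Sp (\<lambda>y. \<bar>al m m y - 1\<bar>)" by (intro continuous_intros al_cont)
    have "al m m y = 1" if "y \<in> So" for y using al(2)[OF that] c(1) c(2)[OF that] by simp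
    then have "\<bar>al m m y - 1\<bar> \<le> 0"
      using bound_on_closure[OF So(4,3) cont _ that, of 0] by simp
    then show ?thesis by simp
  qed

  obtain r1 R C1 where r1: "0 < r1" "r1 \<le> \<rho>0" and R: "\<And>y. y \<in> ball q r1 \<Longrightarrow> y $ m \<le> 0 \<Longrightarrow> R y \<in> Sp"
    and C1: "0 \<le> C1" "\<And>v K. holder_bd Sp K 2 v \<Longrightarrow> flat_solution al be m Sp v \<Longrightarrow>
      holder_bd (ball q r1) (C1 * K) 2 (\<lambda>y. if 0 \<le> y $ m then v y else - v (R y))"
    using flat_reflection[OF q0 \<rho>0(1), of al be, folded Sp_def, OF al(1) be(1) al1] by blast

  obtain C3 where C3: "0 \<le> C3" "\<And>f K. holder_bd \<Omega> K 2 f \<Longrightarrow> holder_bd So (C3 * K) 2 (\<lambda>y. f (\<phi> y))"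
    using holder_bd_compose[OF So(2) \<phi>So(1) \<phi>exSo] unfolding two by blast
  obtain r where r: "0 < r" "r \<le> r0" "\<And>x. x \<in> ball p r \<Longrightarrow> \<psi> x \<in> ball q r1"
  proof -
    have "open (ball p r0 \<inter> \<psi> -` ball q r1)"
      by (rule continuous_open_preimage[OF homeomorphism_cont1[OF hom] open_ball open_ball])
    moreover have "p \<in> ball p r0 \<inter> \<psi> -` ball q r1" using r0 r1 by (simp add: q_def)
    ultimately obtain r where r: "0 < r" "ball p r \<subseteq> ball p r0 \<inter> \<psi> -` ball q r1"
      using open_contains_ball by blast
    show thesis by (rule that[of "min r r0"]) (use r r0 in auto)
  qed
  have \<psi>exr: "\<exists>K. holder_bd (ball p r) K (Suc (Suc 0)) (\<lambda>x. \<psi> x $ k)" for k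
  proof -
    have "ball p r \<subseteq> ball p r0" using r(2) by auto
    moreover obtain K where "holder_bd (ball p r0) K 2 (\<lambda>x. \<psi> x $ k)" using \<psi>ex[of "[]" k] by auto
    ultimately show ?thesis using holder_bd_subset unfolding two by blast
  qed
  obtain C2 where C2: "0 \<le> C2" "\<And>f K. holder_bd (ball q r1) K 2 f \<Longrightarrow> holder_bd (ball p r) (C2 * K) 2 (\<lambda>x. f (\<psi> x))"
    using holder_bd_compose[OF convex_ball r(3) \<psi>exr] unfolding two by blast

  have \<phi>Sp: "\<phi> y \<in> closure \<Omega>" if "y \<in> Sp" for y
  proof (cases "y $ m = 0")
    case True
    then show ?thesis using sides(2) that unfolding Sp_def frontier_def by blast
  next
    case False
    then have "y \<in> So" using that by (auto simp: Sp_def So_def)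
    then show ?thesis using \<phi>So(1) closure_subset by blast
  qed
  have \<phi>cont: "continuous_on Sp \<phi>"
    by (rule continuous_on_subset[OF homeomorphism_cont2[OF hom]]) (use \<rho>0 in \<open>auto simp: Sp_def\<close>)
  \<comment> \<open>The value on the closure of \<open>\<Omega>\<close> is arbitrary; the identity makes \<open>\<rho>\<close> map into the closure everywhere.\<close>
  define \<rho> where "\<rho> x = (if x \<in> closure \<Omega> then x else \<phi> (R (\<psi> x)))" for x
  have side_iff: "x \<in> closure \<Omega> \<longleftrightarrow> 0 \<le> \<psi> x $ m" if x: "x \<in> ball p r" for x
  proof -
    have y: "\<psi> x \<in> ball q \<rho>0" using r(3)[OF x] r1(2) by auto
    have x': "\<phi> (\<psi> x) = x" by (rule \<phi>\<psi>) (use x r(2) in auto)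
    show ?thesis
    proof
      assume "x \<in> closure \<Omega>" then show "0 \<le> \<psi> x $ m" using sides(3)[OF y] x' by force
    next
      assume "0 \<le> \<psi> x $ m" then show "x \<in> closure \<Omega>" using \<phi>Sp[of "\<psi> x"] y x' by (auto simp: Sp_def)
    qed
  qed
  have \<rho>_in: "\<rho> x \<in> closure \<Omega>" if "x \<in> ball p r" for x
    using side_iff[OF that] R[OF r(3)[OF that]] \<phi>Sp by (auto simp: \<rho>_def)

  have main: "holder_bd (ball p r) (C2 * (C1 * (C3 * K))) 2 (odd_extension \<Omega> \<rho> u)"
    if u: "reflectable \<Omega> a b K u" for u K
  proof -
    have uC: "holder_bd \<Omega> K 2 u" and ucont: "continuous_on (closure \<Omega>) u"
      and u0: "\<And>z. z \<in> frontier \<Omega> \<Longrightarrow> u z = 0" using u unfolding reflectable_def by blast+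
    define Lu where "Lu x = derivative_terms a b u x" for x
    have Lu0: "(Lu \<longlongrightarrow> 0) (at z within \<Omega>)" if "z \<in> frontier \<Omega>" for z
      using u that unfolding reflectable_def Lu_def by blast
    define v where "v y = u (\<phi> y)" for y
    have vcont: "continuous_on Sp v"
      unfolding v_def by (rule continuous_on_compose2[OF ucont \<phi>cont]) (use \<phi>Sp in auto)
    have vC: "holder_bd Sp (C3 * K) 2 v"
      by (rule holder_bd_extend_closure_continuous[OF So(2,1) Sp So(3,4) _ vcont])
        (rule holder_bd_cong[OF C3(2)[OF uC]], simp add: v_def)
    have v0: "v y = 0" if "y \<in> Sp" "y $ m = 0" for y
      using u0 sides(2)[of y] that by (auto simp: v_def Sp_def)
    have eqn: "(\<Sum>k\<in>UNIV. \<Sum>l\<in>UNIV. al k l z * v2 k l z) + (\<Sum>k\<in>UNIV. be k z * v1 k z) = 0"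
      if v1: "has_gradient_on v v1 Sp" and v2: "\<And>i. has_gradient_on (v1 i) (v2 i) Sp"
        and v2c: "\<And>i j. continuous_on Sp (v2 i j)" and z: "z \<in> Sp" "z $ m = 0" for v1 v2 z
    proof -
      define G where "G y = (\<Sum>k\<in>UNIV. \<Sum>l\<in>UNIV. al k l y * v2 k l y) + (\<Sum>k\<in>UNIV. be k y * v1 k y)" for y
      have v1c: "continuous_on Sp (v1 i)" for i by (rule has_gradient_on_continuous[OF v2])
      have Gcont: "continuous_on Sp G"
        unfolding G_def by (intro continuous_intros al_cont be_cont v1c v2c)
      define W where "W = ball p r0 \<inter> \<psi> -` So"
      have W: "open W" unfolding W_def
        by (rule continuous_open_preimage[OF homeomorphism_cont1[OF hom] open_ball So(1)])
      have Wsub: "W \<subseteq> ball p r0" "\<And>x. x \<in> W \<Longrightarrow> \<psi> x \<in> Sp" using So(3) by (auto simp: W_def)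
      have Pg': "has_gradient_on (\<lambda>x. \<psi> x $ k) (P k) W" for k by (rule has_gradient_on_subset[OF Pg Wsub(1)])
      have Qg': "has_gradient_on (P k j) (\<lambda>i. Q k i j) W" for k j by (rule has_gradient_on_subset[OF Qg Wsub(1)])
      have uv: "has_gradient_on u (\<lambda>j x. \<Sum>k\<in>UNIV. v1 k (\<psi> x) * P k j x) W"
        by (rule has_gradient_on_cong[OF has_gradient_on_compose[OF v1 Pg' Wsub(2)]])
          (auto simp: v_def W_def \<phi>\<psi>)
      have p1: "partials [j] u x = (\<Sum>k\<in>UNIV. v1 k (\<psi> x) * P k j x)" if "x \<in> W" for j x
        unfolding partials_Cons partials_Nil by (rule has_gradient_on_partial[OF uv W that])
      have "has_gradient_on (\<lambda>x. \<Sum>k\<in>UNIV. v1 k (\<psi> x) * P k j x)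
          (\<lambda>i x. \<Sum>k\<in>UNIV. (\<Sum>l\<in>UNIV. v2 k l (\<psi> x) * P l i x) * P k j x + v1 k (\<psi> x) * Q k i j x) W" for j
        by (intro has_gradient_on_sum has_gradient_on_mult Qg' has_gradient_on_compose[OF v2 Pg' Wsub(2)]) auto
      then have g2: "has_gradient_on (partials [j] u)
          (\<lambda>i x. \<Sum>k\<in>UNIV. (\<Sum>l\<in>UNIV. v2 k l (\<psi> x) * P l i x) * P k j x + v1 k (\<psi> x) * Q k i j x) W" for j
        by (rule has_gradient_on_cong) (use p1 in auto)
      have p2: "partials [i, j] u x =
          (\<Sum>k\<in>UNIV. (\<Sum>l\<in>UNIV. v2 k l (\<psi> x) * P l i x) * P k j x + v1 k (\<psi> x) * Q k i j x)" if "x \<in> W" for i j x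
        unfolding partials_Cons[of i] by (rule has_gradient_on_partial[OF g2 W that])
      \<comment> \<open>Inside, the normalised transformed operator is a bounded multiple of the original one, which tends to
        zero at the boundary; so \<open>G\<close> vanishes on the hyperplane by continuity.\<close>
      have GLu: "G y = inverse (A m m y) * Lu (\<phi> y)" if y: "y \<in> So" for y
      proof -
        have x: "\<phi> y \<in> W" "\<psi> (\<phi> y) = y" using \<phi>V[OF \<phi>So(3)[OF y]] y by (auto simp: W_def)
        have "Lu (\<phi> y) = (\<Sum>k\<in>UNIV. \<Sum>l\<in>UNIV. A k l y * v2 k l y) + (\<Sum>k\<in>UNIV. Bc k y * v1 k y)"
          unfolding Lu_def p1[OF x(1)] p2[OF x(1)] x(2) A_def Bc_def
          by (rule operator_change_of_variables)
        then show ?thesis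
          unfolding G_def al(2)[OF y] be(2)[OF y] by (simp add: distrib_left sum_distrib_left mult.assoc)
      qed
      have \<phi>z: "\<phi> z \<in> frontier \<Omega>" using sides(2) z by (auto simp: Sp_def)
      obtain Y where Y: "\<And>n. Y n \<in> So" "Y \<longlonglongrightarrow> z"
        using subsetD[OF So(4) z(1)] unfolding closure_sequential by blast
      have "(\<lambda>n. \<phi> (Y n)) \<longlonglongrightarrow> \<phi> z"
        by (rule continuous_on_tendsto_compose[OF \<phi>cont Y(2) z(1)]) (auto intro!: always_eventually subsetD[OF So(3) Y(1)])
      moreover have "\<phi> z \<notin> \<Omega>" using \<phi>z \<Omega> by (simp add: frontier_def interior_open)
      then have "\<phi> (Y n) \<in> \<Omega> \<and> \<phi> (Y n) \<noteq> \<phi> z" for n using \<phi>So(1)[OF Y(1)[of n]] by metis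
      ultimately have "filterlim (\<lambda>n. \<phi> (Y n)) (at (\<phi> z) within \<Omega>) sequentially"
        unfolding filterlim_at by simp
      then have "(\<lambda>n. Lu (\<phi> (Y n))) \<longlonglongrightarrow> 0" by (rule filterlim_compose[OF Lu0[OF \<phi>z]])
      then have "(\<lambda>n. inverse c * \<bar>Lu (\<phi> (Y n))\<bar>) \<longlonglongrightarrow> inverse c * \<bar>0\<bar>" by (intro tendsto_intros)
      then have lim0: "(\<lambda>n. inverse c * \<bar>Lu (\<phi> (Y n))\<bar>) \<longlonglongrightarrow> 0" by simp
      have "(\<lambda>n. G (Y n)) \<longlonglongrightarrow> 0"
      proof (rule Lim_null_comparison[OF _ lim0], rule always_eventually, rule allI)
        fix n
        have "inverse (A m m (Y n)) \<le> inverse c" "0 \<le> inverse (A m m (Y n))"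
          using le_imp_inverse_le[OF c(2)[OF Y(1)[of n]] c(1)] order_trans[OF less_imp_le[OF c(1)] c(2)[OF Y(1)[of n]]]
          by simp_all
        then show "norm (G (Y n)) \<le> inverse c * \<bar>Lu (\<phi> (Y n))\<bar>"
          unfolding GLu[OF Y(1)] by (simp add: abs_mult mult_right_mono)
      qed
      moreover have "(\<lambda>n. G (Y n)) \<longlonglongrightarrow> G z"
        by (rule continuous_on_tendsto_compose[OF Gcont Y(2) z(1)]) (auto intro!: always_eventually subsetD[OF So(3) Y(1)])
      ultimately show ?thesis using LIMSEQ_unique G_def by metis
    qed
    have "flat_solution al be m Sp v" unfolding flat_solution_def using v0 eqn by blast
    then have "holder_bd (ball q r1) (C1 * (C3 * K)) 2 (\<lambda>y. if 0 \<le> y $ m then v y else - v (R y))"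
      by (rule C1(2)[OF vC])
    from C2(2)[OF this]
    have "holder_bd (ball p r) (C2 * (C1 * (C3 * K))) 2 (\<lambda>x. if 0 \<le> \<psi> x $ m then v (\<psi> x) else - v (R (\<psi> x)))" .
    then show ?thesis
    proof (rule holder_bd_cong)
      fix x assume x: "x \<in> ball p r"
      have "\<phi> (\<psi> x) = x" by (rule \<phi>\<psi>) (use x r(2) in auto)
      then show "(if x \<in> closure \<Omega> then u x else - u (\<rho> x)) = (if 0 \<le> \<psi> x $ m then v (\<psi> x) else - v (R (\<psi> x)))"
        using side_iff[OF x] by (simp add: v_def \<rho>_def)
    qed
  qed
  show thesis
  proof (rule that[OF r(1) _ \<rho>_in])
    show "0 \<le> C2 * C1 * C3" using C1 C2 C3 by simp
    show "holder_bd (ball p r) (C2 * C1 * C3 * K) 2 (odd_extension \<Omega> \<rho> u)"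
      if "reflectable \<Omega> a b K u" for u K
      using main[OF that] by (simp add: mult.assoc)
  qed
qed

section \<open>Hoelder norms\<close>

lemma holder_bd_partials:
  fixes f :: "real^'n::finite \<Rightarrow> real"
  assumes U: "open U"
  shows "holder_bd U K (length js + l) f \<Longrightarrow> holder_bd U K l (partials js f)"
proof (induction js arbitrary: l)
  case (Cons i js)
  have "holder_bd U K (Suc l) (partials js f)" by (rule Cons.IH) (use Cons.prems in simp)
  then obtain g where g: "has_gradient_on (partials js f) g U" "\<And>i. holder_bd U K l (g i)"
    using holder_bd_SucE by metis
  show ?case
    by (rule holder_bd_cong[OF g(2)[of i]]) (simp add: partials_Cons has_gradient_on_partial[OF g(1) U])
qed simp

lemma holder_bd_partials_gradient:
  fixes f :: "real^'n::finite \<Rightarrow> real"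
  assumes U: "open U" and f: "holder_bd U K k f" and js: "length js < k"
  shows "has_gradient_on (partials js f) (\<lambda>i. partials (i # js) f) U"
proof -
  have "k = length js + Suc (k - length js - 1)" using js by simp
  then have "holder_bd U K (Suc (k - length js - 1)) (partials js f)"
    using holder_bd_partials[OF U, of K js "Suc (k - length js - 1)" f] f by metis
  then obtain g where g: "has_gradient_on (partials js f) g U" using holder_bd_SucE by metis
  show ?thesis
    by (rule has_gradient_on_cong[OF g refl]) (simp add: partials_Cons has_gradient_on_partial[OF g U])
qed

lemma partials_diff:
  fixes f g :: "real^'n::finite \<Rightarrow> real"
  assumes U: "open U" and f: "holder_bd U K k f" and g: "holder_bd U M k g"
  shows "length js \<le> k \<Longrightarrow> x \<in> U \<Longrightarrow> partials js (\<lambda>x. f x - g x) x = partials js f x - partials js g x"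
proof (induction js arbitrary: x)
  case (Cons i js)
  have "has_gradient_on (\<lambda>x. partials js f x + - 1 * partials js g x)
      (\<lambda>i x. partials (i # js) f x + - 1 * partials (i # js) g x) U"
    using Cons.prems by (intro has_gradient_on_add has_gradient_on_cmult holder_bd_partials_gradient[OF U f]
        holder_bd_partials_gradient[OF U g]) auto
  then have "has_gradient_on (partials js (\<lambda>x. f x - g x))
      (\<lambda>i x. partials (i # js) f x + - 1 * partials (i # js) g x) U"
    by (rule has_gradient_on_cong) (use Cons in auto)
  from has_gradient_on_partial[OF this U Cons.prems(2), of i] show ?case
    by (simp add: partials_Cons)
qed simp

lemma ex_list_length: "\<exists>js::'a list. length js = j"
  by (rule exI[of _ "replicate j undefined"]) simp

lemma ex_two_points:
  fixes U :: "(real^'n::finite) set"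
  assumes "open U" "U \<noteq> {}"
  shows "\<exists>x\<in>U. \<exists>y\<in>U. x \<noteq> y"
proof -
  have "\<not> finite U" using assms by (metis finite.emptyI finite_imp_not_open)
  then show ?thesis by (metis finite.emptyI finite_insert insertCI subsetI finite_subset)
qed

text \<open>Any bound makes the suprema in the norm finite; hence \<open>holder_norm\<close> is the best constant in \<open>holder_bd\<close>
up to a factor depending on \<open>k\<close>.\<close>

lemma holder_norm_bounds:
  fixes f :: "real^'n::finite \<Rightarrow> real"
  assumes U: "open U" "U \<noteq> {}" and f: "holder_bd U K k f"
  shows "0 \<le> holder_norm k \<alpha> U f"
    and "\<And>js x. length js \<le> k \<Longrightarrow> x \<in> U \<Longrightarrow> \<bar>partials js f x\<bar> \<le> holder_norm k \<alpha> U f"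
    and "\<And>js x y. length js = k \<Longrightarrow> x \<in> U \<Longrightarrow> y \<in> U \<Longrightarrow>
      \<bar>partials js f x - partials js f y\<bar> \<le> holder_norm k \<alpha> U f * dist x y powr \<alpha>"
    and "holder_norm k \<alpha> U f \<le> (real k + 2) * K"
proof -
  define A where "A j = {js::'n list. length js = j} \<times> U" for j
  define F where "F = (\<lambda>(js, x). \<bar>partials js f x\<bar>)"
  define B where "B = {(js::'n list, x, y). length js = k \<and> x \<in> U \<and> y \<in> U \<and> x \<noteq> y}"
  define G where "G = (\<lambda>(js, x, y). \<bar>partials js f x - partials js f y\<bar> / dist x y powr \<alpha>)"
  have norm_eq: "holder_norm k \<alpha> U f = (\<Sum>j\<le>k. Sup (F ` A j)) + Sup (G ` B)"
    by (simp add: holder_norm_def A_def B_def F_def G_def)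
  have pb: "\<bar>partials js f x\<bar> \<le> K" if "length js \<le> k" "x \<in> U" for js x
    using holder_bd_bound[OF holder_bd_partials[OF U(1), of K js "k - length js" f] that(2)] f that(1) by simp
  have ph: "\<bar>partials js f x - partials js f y\<bar> \<le> K * dist x y powr \<alpha>" if "length js = k" "x \<in> U" "y \<in> U" for js x y
    using holder_bd_partials[OF U(1), of K js 0 f] f that by simp
  have FK: "F z \<le> K" if "z \<in> A j" "j \<le> k" for z j
    using that pb by (auto simp: F_def A_def)
  have GK: "G z \<le> K" if "z \<in> B" for z
    using that ph by (auto simp: G_def B_def divide_le_eq)
  have Ane: "A j \<noteq> {}" for j using U(2) ex_list_length[of j] by (auto simp: A_def)
  have Bne: "B \<noteq> {}"
    using ex_two_points[OF U] ex_list_length[of k] unfolding B_def by blast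
  have Fbdd: "bdd_above (F ` A j)" if "j \<le> k" for j
    using FK that by (intro bdd_aboveI[of _ K]) auto
  have Gbdd: "bdd_above (G ` B)" using GK by (intro bdd_aboveI[of _ K]) auto
  have F0: "0 \<le> Sup (F ` A j)" if "j \<le> k" for j
  proof -
    obtain z where z: "z \<in> A j" using Ane[of j] by blast
    have "0 \<le> F z" by (cases z) (simp add: F_def)
    also have "\<dots> \<le> Sup (F ` A j)" by (rule cSUP_upper[OF z Fbdd[OF that]])
    finally show ?thesis .
  qed
  have G0: "0 \<le> Sup (G ` B)"
  proof -
    obtain z where z: "z \<in> B" using Bne by blast
    have "0 \<le> G z" by (cases z) (simp add: G_def)
    also have "\<dots> \<le> Sup (G ` B)" by (rule cSUP_upper[OF z Gbdd])
    finally show ?thesis .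
  qed
  have S0: "0 \<le> (\<Sum>j\<le>k. Sup (F ` A j))" by (rule sum_nonneg) (use F0 in auto)
  show nn: "0 \<le> holder_norm k \<alpha> U f" unfolding norm_eq by (rule add_nonneg_nonneg[OF S0 G0])
  show "\<bar>partials js f x\<bar> \<le> holder_norm k \<alpha> U f" if "length js \<le> k" "x \<in> U" for js x
  proof -
    have "(js, x) \<in> A (length js)" using that by (simp add: A_def)
    from cSUP_upper[OF this Fbdd[OF that(1)]] have "\<bar>partials js f x\<bar> \<le> Sup (F ` A (length js))"
      by (simp add: F_def)
    also have "\<dots> \<le> (\<Sum>j\<le>k. Sup (F ` A j))"
      by (rule member_le_sum) (use that F0 in auto)
    finally show ?thesis using G0 unfolding norm_eq by linarith
  qed
  show "\<bar>partials js f x - partials js f y\<bar> \<le> holder_norm k \<alpha> U f * dist x y powr \<alpha>"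
    if "length js = k" "x \<in> U" "y \<in> U" for js x y
  proof (cases "x = y")
    case True then show ?thesis using nn by simp
  next
    case False
    then have "(js, x, y) \<in> B" using that by (simp add: B_def)
    from cSUP_upper[OF this Gbdd] have "\<bar>partials js f x - partials js f y\<bar> / dist x y powr \<alpha> \<le> Sup (G ` B)"
      by (simp add: G_def)
    also have "\<dots> \<le> holder_norm k \<alpha> U f" unfolding norm_eq using S0 by simp
    finally show ?thesis using False by (simp add: divide_le_eq)
  qed
  have "(\<Sum>j\<le>k. Sup (F ` A j)) \<le> (\<Sum>j\<le>k. K)"
    by (intro sum_mono cSUP_least Ane) (use FK in auto)
  moreover have "Sup (G ` B) \<le> K" by (rule cSUP_least[OF Bne GK])
  ultimately show "holder_norm k \<alpha> U f \<le> (real k + 2) * K" unfolding norm_eq by (simp add: algebra_simps)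
qed

lemma holder_bd_holder_norm:
  fixes f :: "real^'n::finite \<Rightarrow> real"
  assumes U: "open U" "U \<noteq> {}" and f: "holder_bd U K k f"
  shows "holder_bd U (holder_norm k \<alpha> U f) k f"
proof -
  have "partials js f differentiable_on U" if "length js < k" for js
    using holder_bd_partials_gradient[OF U(1) f that] has_gradient_onD
    unfolding differentiable_on_def differentiable_def by blast
  from holder_bd_of_partials[OF U(1) holder_norm_bounds(1)[OF assms] this holder_norm_bounds(2,3)[OF assms], where js = "[]" and l = k]
  show ?thesis by simp
qed

lemma closure_ext_UNIV: "closure_ext UNIV f = f"
  by (auto simp: closure_ext_def)

lemma holder_bd_UNIV_holder_space:
  fixes f :: "real^'n::finite \<Rightarrow> real"
  assumes f: "holder_bd UNIV K k f"
  shows "f \<in> holder_space k \<alpha> UNIV"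
proof -
  have P: "holder_bd UNIV K (k - length js) (partials js f)" if "length js \<le> k" for js
    using holder_bd_partials[OF open_UNIV, of K js "k - length js" f] f that by simp
  have "partials js f differentiable_on UNIV" if "length js < k" for js
    using holder_bd_partials_gradient[OF open_UNIV f that] has_gradient_onD
    unfolding differentiable_on_def differentiable_def by blast
  moreover have "holder_continuous_on UNIV \<alpha> (partials js f)" if "length js = k" for js
    using P[of js] that unfolding holder_continuous_on_def by auto
  ultimately show ?thesis
    using holder_bd_continuous[OF convex_UNIV f] holder_bd_continuous[OF convex_UNIV P]
    by (auto simp: holder_space_def C_holder_on_def closure_ext_UNIV)
qed

section \<open>Cutoff functions\<close>

text \<open>A point of \<open>C\<close> and a point outside \<open>U\<close> have distance at least \<open>\<delta>\<close>, so that the difference of the values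
there is controlled by the bound on the function.\<close>

lemma holder_bd_extend_zero:
  fixes f :: "real^'n::finite \<Rightarrow> real"
  assumes U: "open U" and C: "closed C" "C \<subseteq> U"
    and \<delta>: "0 < \<delta>" "\<And>x y. x \<in> C \<Longrightarrow> y \<notin> U \<Longrightarrow> \<delta> \<le> dist x y"
  shows "holder_bd U K k f \<Longrightarrow> (\<And>x. x \<in> U \<Longrightarrow> x \<notin> C \<Longrightarrow> f x = 0) \<Longrightarrow>
    holder_bd UNIV ((1 + 1 / \<delta> powr \<alpha>) * K) k (\<lambda>x. if x \<in> U then f x else 0)"
proof (induction k arbitrary: f)
  case 0
  let ?c = "1 + 1 / \<delta> powr \<alpha>" and ?F = "\<lambda>x. if x \<in> U then f x else 0"
  have K: "0 \<le> K" using 0 by simp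
  have c: "K \<le> ?c * K" "0 \<le> ?c * K" using K by (simp_all add: algebra_simps)
  have mixed: "\<bar>f x\<bar> \<le> ?c * K * dist x y powr \<alpha>" if "x \<in> U" "y \<notin> U" for x y
  proof (cases "x \<in> C")
    case False then show ?thesis using 0 that c by simp
  next
    case True
    have "\<delta> powr \<alpha> \<le> dist x y powr \<alpha>" using \<alpha> \<delta> True that by (intro powr_mono2) auto
    then have "1 \<le> (1 / \<delta> powr \<alpha>) * dist x y powr \<alpha>" using \<delta> by (simp add: divide_simps)
    also have "\<dots> \<le> ?c * dist x y powr \<alpha>" by (intro mult_right_mono) auto
    finally have "K * 1 \<le> K * (?c * dist x y powr \<alpha>)" using K by (rule mult_left_mono)
    moreover have "\<bar>f x\<bar> \<le> K" using 0 that by auto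
    ultimately show ?thesis by (simp add: mult_ac)
  qed
  show ?case
    unfolding holder_bd.simps(1)
  proof (intro conjI ballI c(2))
    fix x y
    show "\<bar>?F x\<bar> \<le> ?c * K" using 0(1) c by (auto intro: order_trans)
    have same: "K * dist x y powr \<alpha> \<le> ?c * K * dist x y powr \<alpha>" using c by (intro mult_right_mono) auto
    show "\<bar>?F x - ?F y\<bar> \<le> ?c * K * dist x y powr \<alpha>"
    proof (cases "x \<in> U"; cases "y \<in> U")
      assume "x \<in> U" "y \<in> U"
      then have "\<bar>f x - f y\<bar> \<le> K * dist x y powr \<alpha>" using 0 by auto
      then show ?thesis using same \<open>x \<in> U\<close> \<open>y \<in> U\<close> by simp
    next
      assume "x \<in> U" "y \<notin> U" then show ?thesis using mixed by simp
    next
      assume "x \<notin> U" "y \<in> U" then show ?thesis using mixed[of y x] by (simp add: dist_commute)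
    next
      assume "x \<notin> U" "y \<notin> U" then show ?thesis using c by simp
    qed
  qed
next
  case (Suc k)
  let ?c = "1 + 1 / \<delta> powr \<alpha>" and ?F = "\<lambda>x. if x \<in> U then f x else 0"
  have K: "0 \<le> K" using Suc.prems(1) holder_bd_nonneg by blast
  have c: "K \<le> ?c * K" "0 \<le> ?c * K" using K by (simp_all add: algebra_simps)
  obtain g where g: "has_gradient_on f g U" "\<And>i. holder_bd U K k (g i)"
    using holder_bd_SucE[OF Suc.prems(1)] by blast
  let ?G = "\<lambda>i x. if x \<in> U then g i x else 0"
  have V: "open (U - C)" using U C by (simp add: open_Diff)
  have g0: "g i x = 0" if "x \<in> U" "x \<notin> C" for i x
  proof -
    have "has_gradient_on f (\<lambda>i x. 0) (U - C)"
      by (rule has_gradient_on_cong[OF has_gradient_on_const[of 0]]) (use Suc.prems(2) in auto)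
    from has_gradient_on_partial[OF this V, of x i]
      has_gradient_on_partial[OF has_gradient_on_subset[OF g(1)] V, of x i] that show ?thesis by auto
  qed
  have on_U: "has_gradient_on ?F ?G U" by (rule has_gradient_on_cong[OF g(1)]) auto
  have on_C: "has_gradient_on ?F ?G (- C)"
    by (rule has_gradient_on_cong[OF has_gradient_on_const[of 0]]) (use Suc.prems(2) g0 in auto)
  have "has_gradient_on ?F ?G UNIV"
    unfolding has_gradient_on_def
  proof
    fix x :: "real^'n"
    consider "x \<in> U" | "x \<in> - C" using C by blast
    then show "(?F has_derivative (\<lambda>h. \<Sum>i\<in>UNIV. ?G i x * h $ i)) (at x)"
    proof cases
      case 1
      show ?thesis using has_gradient_onD[OF on_U 1] unfolding at_within_open[OF 1 U] .
    next
      case 2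
      show ?thesis using has_gradient_onD[OF on_C 2] unfolding at_within_open[OF 2 open_Compl[OF C(1)]] .
    qed
  qed
  moreover have "holder_bd UNIV (?c * K) k (?G i)" for i by (rule Suc.IH[OF g(2) g0])
  moreover have "\<bar>?F x\<bar> \<le> ?c * K" for x
    using holder_bd_bound[OF Suc.prems(1), of x] c by auto
  ultimately show ?case by (intro holder_bd_SucI) auto
qed

text \<open>Powers of the positive part supply smooth enough cutoffs that are polynomial, hence easy to estimate.\<close>

lemma has_derivative_max_power:
  assumes "2 \<le> j"
  shows "((\<lambda>t::real. (max 0 t) ^ j) has_field_derivative real j * (max 0 t) ^ (j - 1)) (at t)"
proof -
  consider "t > 0" | "t < 0" | "t = 0" by linarith
  then show ?thesis
  proof cases
    case 1
    have "((\<lambda>t. t ^ j) has_field_derivative real j * t ^ (j - 1)) (at t)"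
      by (auto intro!: derivative_eq_intros)
    then have "((\<lambda>t. (max 0 t) ^ j) has_field_derivative real j * t ^ (j - 1)) (at t)"
      by (rule has_field_derivative_transform_within_open[of _ _ _ "{0<..}"]) (use 1 in \<open>auto simp: max_def\<close>)
    then show ?thesis using 1 by (simp add: max_def)
  next
    case 2
    have "((\<lambda>t::real. 0) has_field_derivative 0) (at t)" by simp
    then have "((\<lambda>t. (max 0 t) ^ j) has_field_derivative 0) (at t)"
      by (rule has_field_derivative_transform_within_open[of _ _ _ "{..<0}"]) (use 2 assms in \<open>auto simp: max_def\<close>)
    moreover have "real j * (max 0 t) ^ (j - 1) = 0" using 2 assms by (simp add: max_def)
    ultimately show ?thesis by (simp only:)
  next
    case 3
    have "((\<lambda>y::real. (max 0 y) ^ (j - 1)) \<longlongrightarrow> (max 0 0) ^ (j - 1)) (at 0)"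
      by (intro tendsto_intros)
    moreover have "(max 0 0 :: real) ^ (j - 1) = 0" using assms by simp
    ultimately have "((\<lambda>y::real. (max 0 y) ^ (j - 1)) \<longlongrightarrow> 0) (at 0)" by (simp only:)
    moreover have "(max 0 y) ^ (j - 1) = ((max 0 y) ^ j - (max 0 0) ^ j) / (y - 0)" if "y \<noteq> 0" for y :: real
      using that assms power_minus_mult[of j y] by (auto simp: max_def eq_divide_eq power_0_left)
    then have "eventually (\<lambda>y::real. (max 0 y) ^ (j - 1) = ((max 0 y) ^ j - (max 0 0) ^ j) / (y - 0)) (at 0)"
      by (simp add: eventually_at_filter)
    ultimately have "((\<lambda>y::real. ((max 0 y) ^ j - (max 0 0) ^ j) / (y - 0)) \<longlongrightarrow> 0) (at 0)"
      by (rule Lim_transform_eventually)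
    moreover have "real j * (max 0 t) ^ (j - 1) = 0" using 3 assms by (simp add: power_0_left)
    ultimately show ?thesis unfolding has_field_derivative_iff 3 by (simp only:)
  qed
qed

text \<open>Each differentiation lowers the exponent by one, and the positive part itself is Lipschitz.\<close>

lemma holder_bd_max_power_ex:
  fixes f :: "real^'n::finite \<Rightarrow> real"
  assumes S: "convex S"
  shows "\<exists>K. holder_bd S K k f \<Longrightarrow> k < j \<Longrightarrow> \<exists>K. holder_bd S K k (\<lambda>x. (max 0 (f x)) ^ j)"
proof (induction k arbitrary: j)
  case 0
  then obtain K where K: "holder_bd S K 0 f" by blast
  have "holder_bd S K 0 (\<lambda>x. max 0 (f x))"
    unfolding holder_bd.simps(1)
  proof (intro conjI ballI)
    show "0 \<le> K" using K by simp
    fix x y assume "x \<in> S" "y \<in> S"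
    then have "\<bar>f x\<bar> \<le> K" "\<bar>f x - f y\<bar> \<le> K * dist x y powr \<alpha>" using K by auto
    then show "\<bar>max 0 (f x)\<bar> \<le> K" "\<bar>max 0 (f x) - max 0 (f y)\<bar> \<le> K * dist x y powr \<alpha>"
      by (auto simp: max_def)
  qed
  then have "\<exists>K. holder_bd S K 0 (\<lambda>x. \<Prod>i\<in>{..<j}. max 0 (f x))"
    by (intro holder_bd_prod_ex[OF S]) auto
  then show ?case by simp
next
  case (Suc k)
  then obtain K where K: "holder_bd S K (Suc k) f" by blast
  obtain g where g: "has_gradient_on f g S" "\<And>i. holder_bd S K k (g i)" using holder_bd_SucE[OF K] by blast
  have j: "2 \<le> j" using Suc by simp
  have fk: "\<exists>K. holder_bd S K k f" using holder_bd_lower[OF S K] by blast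
  have "has_gradient_on (\<lambda>x. (max 0 (f x)) ^ j) (\<lambda>i x. real j * (max 0 (f x)) ^ (j - 1) * g i x) S"
    by (rule has_gradient_on_chain[OF _ g(1)]) (rule has_field_derivative_at_within[OF has_derivative_max_power[OF j]])
  moreover have "\<exists>K. holder_bd S K k (\<lambda>x. real j * (max 0 (f x)) ^ (j - 1) * g i x)" for i
    by (intro holder_bd_mult_ex[OF S] holder_bd_const_ex Suc.IH fk) (use Suc.prems g(2) in auto)
  moreover have "\<bar>(max 0 (f x)) ^ j\<bar> \<le> K ^ j" if "x \<in> S" for x
    unfolding power_abs using holder_bd_bound[OF K that] holder_bd_nonneg[OF K] by (intro power_mono) auto
  ultimately show ?case by (intro holder_bd_Suc_ex)
qed

text \<open>The function \<open>\<zeta>\<close>, the cube of the positive part of \<open>1 - |x - p|\<^sup>2 / s\<^sup>2\<close>, is supported in the ball and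
exceeds \<open>1 / 4\<close> on the half as large ball. A second truncation turns the values above \<open>1 / 4\<close> into \<open>1\<close>.\<close>

lemma cutoff_exists:
  fixes p :: "real^'n::finite"
  assumes s: "0 < s"
  obtains \<eta> where "\<exists>K. holder_bd UNIV K 2 \<eta>" "\<And>x. 0 \<le> \<eta> x" "\<And>x. \<eta> x \<le> 1"
    "\<And>x. x \<in> ball p (s / 2) \<Longrightarrow> \<eta> x = 1" "\<And>x. x \<notin> ball p s \<Longrightarrow> \<eta> x = 0"
proof -
  define N where "N x = 1 - (1 / s\<^sup>2) * (\<Sum>i\<in>UNIV. (x $ i - p $ i) * (x $ i - p $ i))" for x
  define \<zeta> where "\<zeta> x = (max 0 (N x)) ^ 3" for x
  define \<eta> where "\<eta> x = 1 - (max 0 (1 - 4 * \<zeta> x)) ^ 3" for x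
  let ?U = "ball p (2 * s)"
  have N_eq: "N x = 1 - (dist p x / s)\<^sup>2" for x
  proof -
    have "(\<Sum>i\<in>UNIV. (x $ i - p $ i) * (x $ i - p $ i)) = (x - p) \<bullet> (x - p)" by (simp add: inner_vec_def)
    then show ?thesis
      by (simp add: N_def dot_square_norm dist_norm norm_minus_commute power_divide)
  qed
  have comp: "\<exists>K. holder_bd ?U K 2 (\<lambda>x. x $ i - p $ i)" for i
    by (intro holder_bd_diff_ex holder_bd_component_ex holder_bd_const_ex bounded_ball convex_ball)
  have Nex: "\<exists>K. holder_bd ?U K 2 N"
    unfolding N_def
    by (intro holder_bd_diff_ex holder_bd_const_ex holder_bd_mult_ex[OF convex_ball] holder_bd_sum_ex comp) simp
  have \<zeta>ex: "\<exists>K. holder_bd ?U K 2 \<zeta>"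
    unfolding \<zeta>_def by (rule holder_bd_max_power_ex[OF convex_ball Nex]) simp
  have "\<exists>K. holder_bd ?U K 2 (\<lambda>x. 1 - 4 * \<zeta> x)"
    by (intro holder_bd_diff_ex holder_bd_const_ex holder_bd_mult_ex[OF convex_ball] \<zeta>ex)
  then have "\<exists>K. holder_bd ?U K 2 (\<lambda>x. (max 0 (1 - 4 * \<zeta> x)) ^ 3)"
    by (rule holder_bd_max_power_ex[OF convex_ball]) simp
  then have \<eta>ex: "\<exists>K. holder_bd ?U K 2 \<eta>"
    unfolding \<eta>_def by (intro holder_bd_diff_ex holder_bd_const_ex)
  have \<zeta>0: "0 \<le> \<zeta> x" for x by (simp add: \<zeta>_def)
  have lo: "0 \<le> \<eta> x" for x
  proof -
    have "(max 0 (1 - 4 * \<zeta> x)) ^ 3 \<le> 1" by (rule power_le_one) (use \<zeta>0[of x] in auto)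
    then show ?thesis by (simp add: \<eta>_def)
  qed
  have hi: "\<eta> x \<le> 1" for x by (simp add: \<eta>_def)
  have out: "\<eta> x = 0" if "x \<notin> ball p s" for x
  proof -
    have "1 \<le> dist p x / s" using that s by (simp add: field_simps)
    then have "1 \<le> (dist p x / s)\<^sup>2" by (simp add: one_le_power)
    then show ?thesis by (simp add: \<eta>_def \<zeta>_def N_eq)
  qed
  have ins: "\<eta> x = 1" if "x \<in> ball p (s / 2)" for x
  proof -
    have "dist p x / s \<le> 1 / 2" using that s by (simp add: field_simps)
    then have "(dist p x / s)\<^sup>2 \<le> (1 / 2)\<^sup>2" by (rule power_mono) (use s in simp)
    then have "3 / 4 \<le> N x" by (simp add: N_eq power_divide)
    then have "(3 / 4) ^ 3 \<le> \<zeta> x" unfolding \<zeta>_def by (intro power_mono) auto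
    then have "1 - 4 * \<zeta> x \<le> 0" by (simp add: power_divide)
    then show ?thesis by (simp add: \<eta>_def)
  qed
  obtain K where K: "holder_bd ?U K 2 \<eta>" using \<eta>ex by blast
  have "holder_bd UNIV ((1 + 1 / s powr \<alpha>) * K) 2 (\<lambda>x. if x \<in> ?U then \<eta> x else 0)"
  proof (rule holder_bd_extend_zero[OF open_ball closed_cball[of p s] _ s _ K])
    show "cball p s \<subseteq> ?U" using s by auto
    show "s \<le> dist x y" if "x \<in> cball p s" "y \<notin> ?U" for x y
      using dist_triangle[of p y x] that by simp
    show "\<eta> x = 0" if "x \<notin> cball p s" for x by (rule out) (use that in auto)
  qed
  then have "holder_bd UNIV ((1 + 1 / s powr \<alpha>) * K) 2 \<eta>"
    by (rule holder_bd_cong) (use out s in \<open>auto\<close>)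
  then show ?thesis using that[of \<eta>] lo hi ins out by blast
qed

text \<open>These products of cutoffs form a partition of unity wherever one of the \<open>\<eta>\<^sub>j\<close> equals \<open>1\<close>, and their sum
never exceeds \<open>1\<close>.\<close>

lemma partition_telescope:
  fixes \<eta> :: "nat \<Rightarrow> real"
  shows "(\<Sum>k<n. \<eta> k * (\<Prod>j<k. 1 - \<eta> j)) = 1 - (\<Prod>j<n. 1 - \<eta> j)"
  by (induction n) (auto simp: algebra_simps)

section \<open>The extension operator\<close>

lemma tendsto_closure_ext:
  assumes "continuous_on (closure U) (closure_ext U f)" "z \<in> closure U"
  shows "(f \<longlongrightarrow> closure_ext U f z) (at z within U)"
proof -
  have "(closure_ext U f \<longlongrightarrow> closure_ext U f z) (at z within closure U)"
    using assms by (simp add: continuous_on_def)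
  then have "(closure_ext U f \<longlongrightarrow> closure_ext U f z) (at z within U)"
    using closure_subset by (rule tendsto_within_subset)
  then show ?thesis
    by (rule Lim_transform_eventually) (auto simp: eventually_at_filter closure_ext_inside)
qed

text \<open>The continuous extensions in \<open>L_op\<close> are limits from inside, and \<open>c * u\<close> vanishes on the boundary.\<close>

lemma X_space_reflectable:
  fixes \<Omega> :: "(real^'n::finite) set"
  assumes \<Omega>: "open \<Omega>" "bounded \<Omega>" and u: "u \<in> X_space \<alpha> \<Omega> a b c"
    and a: "\<And>i j. C_holder_on 2 \<alpha> \<Omega> (a i j)" and b: "\<And>i. C_holder_on 2 \<alpha> \<Omega> (b i)"
  shows "\<exists>K. reflectable \<Omega> a b K u"
proof -
  have uC: "C_holder_on 2 \<alpha> \<Omega> u" and u0: "\<And>z. z \<in> frontier \<Omega> \<Longrightarrow> u z = 0"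
    and Lu: "\<And>z. z \<in> frontier \<Omega> \<Longrightarrow> L_op \<Omega> a b c u z = 0"
    using u by (auto simp: X_space_def holder_space_def)
  obtain K where K: "holder_bd \<Omega> K 2 u"
    using C_holder_on_holder_bd_ex[OF uC order_refl \<Omega>, of "[]" 2] by auto
  have lim: "((\<lambda>x. derivative_terms a b u x) \<longlongrightarrow> 0) (at z within \<Omega>)" if z: "z \<in> frontier \<Omega>" for z
  proof -
    have zc: "z \<in> closure \<Omega>" using z by (simp add: frontier_def)
    have P: "(partials js u \<longlongrightarrow> closure_ext \<Omega> (partials js u) z) (at z within \<Omega>)" if "length js \<le> 2" for js
      using uC that by (intro tendsto_closure_ext zc) (simp add: C_holder_on_def)
    have cont: "(f \<longlongrightarrow> f z) (at z within \<Omega>)" if "C_holder_on 2 \<alpha> \<Omega> f" for f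
    proof -
      have "(f \<longlongrightarrow> f z) (at z within closure \<Omega>)" using that zc by (simp add: C_holder_on_def continuous_on_def)
      then show ?thesis using closure_subset by (rule tendsto_within_subset)
    qed
    have "((\<lambda>x. derivative_terms a b u x) \<longlongrightarrow>
       (\<Sum>i\<in>UNIV. \<Sum>j\<in>UNIV. a i j z * closure_ext \<Omega> (partials [i, j] u) z) +
             (\<Sum>i\<in>UNIV. b i z * closure_ext \<Omega> (partials [i] u) z)) (at z within \<Omega>)"
      by (intro tendsto_intros cont a b P) auto
    moreover have "(\<Sum>i\<in>UNIV. \<Sum>j\<in>UNIV. a i j z * closure_ext \<Omega> (partials [i, j] u) z) +
             (\<Sum>i\<in>UNIV. b i z * closure_ext \<Omega> (partials [i] u) z) = 0"
      using Lu[OF z] u0[OF z] by (simp add: L_op_def)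
    ultimately show ?thesis by simp
  qed
  have "continuous_on (closure \<Omega>) u" using uC by (simp add: C_holder_on_def)
  then show ?thesis using K u0 lim unfolding reflectable_def by blast
qed

lemma reflectable_diff:
  fixes \<Omega> :: "(real^'n::finite) set"
  assumes \<Omega>: "open \<Omega>" and v: "reflectable \<Omega> a b K v" and u: "reflectable \<Omega> a b M u"
  shows "reflectable \<Omega> a b (K + M) (\<lambda>x. v x - u x)"
proof -
  have vC: "holder_bd \<Omega> K 2 v" and uC: "holder_bd \<Omega> M 2 u" using u v by (auto simp: reflectable_def)
  let ?L = "derivative_terms a b"
  have L: "?L v x - ?L u x = ?L (\<lambda>x. v x - u x) x" if "x \<in> \<Omega>" for x
    using that by (simp add: partials_diff[OF \<Omega> vC uC] right_diff_distrib sum_subtractf)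
  have "(?L (\<lambda>x. v x - u x) \<longlongrightarrow> 0) (at z within \<Omega>)" if "z \<in> frontier \<Omega>" for z
  proof -
    have "((\<lambda>x. ?L v x - ?L u x) \<longlongrightarrow> 0 - 0) (at z within \<Omega>)"
      using u v that unfolding reflectable_def by (intro tendsto_diff) auto
    then have "((\<lambda>x. ?L v x - ?L u x) \<longlongrightarrow> 0) (at z within \<Omega>)" by simp
    then show ?thesis
      by (rule Lim_transform_eventually) (use L in \<open>auto simp: eventually_at_filter\<close>)
  qed
  then show ?thesis
    using u v holder_bd_diff[OF vC uC] unfolding reflectable_def by (auto intro: continuous_on_diff)
qed

lemma reflectable_holder_norm:
  assumes "open \<Omega>" "\<Omega> \<noteq> {}" "reflectable \<Omega> a b K u"
  shows "reflectable \<Omega> a b (holder_norm 2 \<alpha> \<Omega> u) u"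
  using assms holder_bd_holder_norm unfolding reflectable_def by blast

text \<open>Near interior points nothing has to be extended; near boundary points \<open>\<rho>\<close> is the bent reflection.\<close>

lemma local_extension:
  fixes \<Omega> :: "(real^'n::finite) set" and lam :: real
    and a :: "'n \<Rightarrow> 'n \<Rightarrow> real^'n \<Rightarrow> real" and b :: "'n \<Rightarrow> real^'n \<Rightarrow> real"
  assumes \<Omega>: "open \<Omega>" and bdry: "holder_boundary 4 \<alpha> \<Omega>"
    and a: "\<And>i j. \<exists>K. holder_bd \<Omega> K 2 (a i j)" and b: "\<And>i. \<exists>K. holder_bd \<Omega> K 2 (b i)"
    and lam: "lam > 0"
    and ell: "\<And>x \<xi>. x \<in> \<Omega> \<Longrightarrow> (\<Sum>i\<in>UNIV. \<Sum>j\<in>UNIV. a i j x * \<xi> $ i * \<xi> $ j) \<ge> lam * (norm \<xi>)\<^sup>2"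
    and p: "p \<in> closure \<Omega>"
  shows "\<exists>r \<rho> C. 0 < r \<and> 0 \<le> C \<and> (\<forall>x\<in>ball p r. \<rho> x \<in> closure \<Omega>) \<and>
    (\<forall>u K. reflectable \<Omega> a b K u \<longrightarrow>
      holder_bd (ball p r) (C * K) 2 (odd_extension \<Omega> \<rho> u))"
proof (cases "p \<in> \<Omega>")
  case True
  then obtain r where r: "0 < r" "ball p r \<subseteq> \<Omega>" using \<Omega> open_contains_ball by blast
  have sub: "x \<in> closure \<Omega>" if "x \<in> ball p r" for x using that r(2) closure_subset by blast
  have "holder_bd (ball p r) (1 * K) 2 (odd_extension \<Omega> (\<lambda>x. x) u)"
    if "reflectable \<Omega> a b K u" for u K
  proof -
    have "holder_bd (ball p r) K 2 u" using that holder_bd_subset[OF _ r(2)] unfolding reflectable_def by blast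
    then have "holder_bd (ball p r) K 2 (odd_extension \<Omega> (\<lambda>x. x) u)"
      by (rule holder_bd_cong) (use sub in auto)
    then show ?thesis by simp
  qed
  then show ?thesis using r(1) sub by (intro exI[of _ r] exI[of _ "\<lambda>x. x"] exI[of _ 1]) auto
next
  case False
  then have fr: "p \<in> frontier \<Omega>" using p \<Omega> by (simp add: frontier_def interior_open)
  show ?thesis
  proof (rule boundary_reflection[of \<Omega> a b lam p])
    fix r :: real and \<rho> C
    assume "0 < r" "0 \<le> C" "\<And>x. x \<in> ball p r \<Longrightarrow> \<rho> x \<in> closure \<Omega>"
      "\<And>u K. reflectable \<Omega> a b K u \<Longrightarrow>
        holder_bd (ball p r) (C * K) 2 (odd_extension \<Omega> \<rho> u)"
    then show ?thesis by blast
  qed (rule \<Omega> bdry a b lam ell fr | assumption)+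
qed

text \<open>The term belonging to the centre \<open>h k\<close> is a cutoff times a composition operator. As the cutoff vanishes
outside the ball on which \<open>\<rho> (h k)\<close> takes values in the closure of \<open>\<Omega>\<close>, the extension is a
subconvex combination of values of \<open>u\<close> and \<open>- u\<close>, which gives the bound on the supremum. The
operator is defined and linear on all functions; only the Hoelder bound requires \<open>reflectable\<close>.\<close>

lemma global_extension:
  fixes \<Omega> :: "(real^'n::finite) set" and lam :: real
    and a :: "'n \<Rightarrow> 'n \<Rightarrow> real^'n \<Rightarrow> real" and b :: "'n \<Rightarrow> real^'n \<Rightarrow> real"
  assumes \<Omega>: "open \<Omega>" "bounded \<Omega>" and bdry: "holder_boundary 4 \<alpha> \<Omega>"
    and a: "\<And>i j. \<exists>K. holder_bd \<Omega> K 2 (a i j)" and b: "\<And>i. \<exists>K. holder_bd \<Omega> K 2 (b i)"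
    and lam: "lam > 0"
    and ell: "\<And>x \<xi>. x \<in> \<Omega> \<Longrightarrow> (\<Sum>i\<in>UNIV. \<Sum>j\<in>UNIV. a i j x * \<xi> $ i * \<xi> $ j) \<ge> lam * (norm \<xi>)\<^sup>2"
  obtains E :: "(real^'n \<Rightarrow> real) \<Rightarrow> real^'n \<Rightarrow> real" and C and S where
    "\<And>u v x. E (\<lambda>x. u x + v x) x = E u x + E v x"
    "\<And>u t x. E (\<lambda>x. t * u x) x = t * E u x"
    "\<And>u x. x \<in> closure \<Omega> \<Longrightarrow> E u x = u x"
    "\<And>u M x. \<forall>y\<in>closure \<Omega>. \<bar>u y\<bar> \<le> M \<Longrightarrow> 0 \<le> M \<Longrightarrow> \<bar>E u x\<bar> \<le> M"
    "bounded S" "\<And>u x. x \<notin> S \<Longrightarrow> E u x = 0"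
    "0 \<le> C" "\<And>u K. reflectable \<Omega> a b K u \<Longrightarrow> holder_bd UNIV (C * K) 2 (E u)"
proof -
  define Q where "Q p r \<rho> C \<longleftrightarrow> 0 < r \<and> 0 \<le> C \<and> (\<forall>x\<in>ball p r. \<rho> x \<in> closure \<Omega>) \<and>
    (\<forall>u K. reflectable \<Omega> a b K u \<longrightarrow>
      holder_bd (ball p r) (C * K) 2 (odd_extension \<Omega> \<rho> u))" for p r \<rho> C
  have "\<exists>r \<rho> C. Q p r \<rho> C" if "p \<in> closure \<Omega>" for p
    unfolding Q_def
    by (rule local_extension[of \<Omega> a b lam p]) (rule \<Omega> bdry a b lam ell that | assumption)+
  then obtain r \<rho> C where Q: "\<And>p. p \<in> closure \<Omega> \<Longrightarrow> Q p (r p) (\<rho> p) (C p)" by metis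
  have loc: "0 < r p" "0 \<le> C p" "\<And>x. x \<in> ball p (r p) \<Longrightarrow> \<rho> p x \<in> closure \<Omega>"
    "\<And>u K. reflectable \<Omega> a b K u \<Longrightarrow>
      holder_bd (ball p (r p)) (C p * K) 2 (odd_extension \<Omega> (\<rho> p) u)"
    if "p \<in> closure \<Omega>" for p
    using Q[OF that] unfolding Q_def by blast+
  have comp: "compact (closure \<Omega>)" using \<Omega>(2) by (simp add: compact_closure)
  have cov: "closure \<Omega> \<subseteq> (\<Union>p\<in>closure \<Omega>. ball p (r p / 4))"
  proof
    fix x assume x: "x \<in> closure \<Omega>"
    then have "x \<in> ball x (r x / 4)" using loc(1)[OF x] by simp
    with x show "x \<in> (\<Union>p\<in>closure \<Omega>. ball p (r p / 4))" by (rule UN_I)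
  qed
  obtain P where P: "P \<subseteq> closure \<Omega>" "finite P" "closure \<Omega> \<subseteq> (\<Union>p\<in>P. ball p (r p / 4))"
    by (rule compactE_image[OF comp open_ball cov])
  obtain h where h: "bij_betw h {0..<card P} P" using ex_bij_betw_nat_finite[OF P(2)] by blast
  define n where "n = card P"
  have hP: "h k \<in> closure \<Omega>" if "k < n" for k
    using that h P(1) unfolding n_def by (auto simp: bij_betw_def)
  have cover: "\<exists>k<n. x \<in> ball (h k) (r (h k) / 4)" if "x \<in> closure \<Omega>" for x
  proof -
    obtain p where p: "p \<in> P" "x \<in> ball p (r p / 4)" using P(3) \<open>x \<in> closure \<Omega>\<close> by blast
    then obtain k where "k < n" "p = h k" using h unfolding n_def bij_betw_def by force
    then show ?thesis using p by blast
  qed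
  define bump where "bump k \<eta> \<longleftrightarrow> (\<exists>K. holder_bd UNIV K 2 \<eta>) \<and> (\<forall>x. 0 \<le> \<eta> x \<and> \<eta> x \<le> 1) \<and>
      (\<forall>x\<in>ball (h k) (r (h k) / 4). \<eta> x = 1) \<and> (\<forall>x. x \<notin> ball (h k) (r (h k) / 2) \<longrightarrow> \<eta> x = 0)" for k \<eta>
  have "\<exists>\<eta>. bump k \<eta>" if "k < n" for k
  proof -
    have s: "0 < r (h k) / 2" using loc(1)[OF hP[OF that]] by simp
    show ?thesis
    proof (rule cutoff_exists[OF s, of "h k"])
      fix \<eta> :: "real^'n \<Rightarrow> real"
      assume "\<exists>K. holder_bd UNIV K 2 \<eta>" "\<And>x. 0 \<le> \<eta> x" "\<And>x. \<eta> x \<le> 1"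
        "\<And>x. x \<in> ball (h k) (r (h k) / 2 / 2) \<Longrightarrow> \<eta> x = 1" "\<And>x. x \<notin> ball (h k) (r (h k) / 2) \<Longrightarrow> \<eta> x = 0"
      then have "bump k \<eta>" unfolding bump_def by simp
      then show ?thesis by blast
    qed
  qed
  then obtain \<eta> where bump: "\<And>k. k < n \<Longrightarrow> bump k (\<eta> k)" by metis
  have \<eta>: "\<exists>K. holder_bd UNIV K 2 (\<eta> k)" "\<And>x. 0 \<le> \<eta> k x" "\<And>x. \<eta> k x \<le> 1"
    "\<And>x. x \<in> ball (h k) (r (h k) / 4) \<Longrightarrow> \<eta> k x = 1" "\<And>x. x \<notin> ball (h k) (r (h k) / 2) \<Longrightarrow> \<eta> k x = 0"
    if "k < n" for k
    using bump[OF that] unfolding bump_def by blast+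
  define \<theta> where "\<theta> k x = \<eta> k x * (\<Prod>j<k. 1 - \<eta> j x)" for k x
  have \<theta>sum: "(\<Sum>k<n. \<theta> k x) = 1 - (\<Prod>j<n. 1 - \<eta> j x)" for x
    unfolding \<theta>_def by (rule partition_telescope)
  have \<theta>nn: "0 \<le> \<theta> k x" if "k < n" for k x
    unfolding \<theta>_def using that \<eta>(2,3) by (intro mult_nonneg_nonneg prod_nonneg) auto
  have \<theta>le: "(\<Sum>k<n. \<theta> k x) \<le> 1" for x
  proof -
    have "0 \<le> (\<Prod>j<n. 1 - \<eta> j x)" by (rule prod_nonneg) (use \<eta>(3) in auto)
    then show ?thesis unfolding \<theta>sum by simp
  qed
  have \<theta>1: "(\<Sum>k<n. \<theta> k x) = 1" if "x \<in> closure \<Omega>" for x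
  proof -
    obtain k where "k < n" "x \<in> ball (h k) (r (h k) / 4)" using cover \<open>x \<in> closure \<Omega>\<close> by blast
    then have "(\<Prod>j<n. 1 - \<eta> j x) = 0" using \<eta>(4) by (intro prod_zero) auto
    then show ?thesis unfolding \<theta>sum by simp
  qed
  have \<theta>out: "\<theta> k x = 0" if "k < n" "x \<notin> ball (h k) (r (h k) / 2)" for k x
    using \<eta>(5)[OF that] by (simp add: \<theta>_def)
  have \<theta>ex: "\<exists>K. holder_bd UNIV K 2 (\<theta> k)" if "k < n" for k
    unfolding \<theta>_def
    by (intro holder_bd_mult_ex[OF convex_UNIV] holder_bd_prod_ex[OF convex_UNIV] holder_bd_diff_ex
        holder_bd_const_ex \<eta>(1)) (use that in auto)
  define T where "T k u = odd_extension \<Omega> (\<rho> (h k)) u"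
    for k and u :: "real^'n \<Rightarrow> real"
  define E where "E u x = (\<Sum>k<n. \<theta> k x * T k u x)" for u x
  define S where "S = (\<Union>k<n. ball (h k) (r (h k) / 2))"

  have term_bound: "\<exists>C\<ge>0. \<forall>u K. reflectable \<Omega> a b K u \<longrightarrow> holder_bd UNIV (C * K) 2 (\<lambda>x. \<theta> k x * T k u x)"
    if k: "k < n" for k
  proof -
    let ?p = "h k" and ?r = "r (h k)"
    let ?U = "ball ?p ?r"
    note hk = hP[OF k]
    obtain M where M: "holder_bd UNIV M 2 (\<theta> k)" using \<theta>ex[OF k] by blast
    then have M': "holder_bd ?U M 2 (\<theta> k)" by (rule holder_bd_subset) simp
    obtain D where D: "D \<ge> 0" "\<And>f g K M. holder_bd ?U K 2 f \<Longrightarrow> holder_bd ?U M 2 g \<Longrightarrow>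
      holder_bd ?U (D * K * M) 2 (\<lambda>x. f x * g x)" using holder_bd_mult[OF convex_ball, of ?p ?r 2] by blast
    define c where "c = 1 + 1 / (?r / 2) powr \<alpha>"
    have "holder_bd UNIV (c * (D * M * (C ?p * K))) 2 (\<lambda>x. \<theta> k x * T k u x)" if u: "reflectable \<Omega> a b K u" for u K
    proof -
      have 1: "holder_bd ?U (D * M * (C ?p * K)) 2 (\<lambda>x. \<theta> k x * T k u x)"
        unfolding T_def by (rule D(2)[OF M' loc(4)[OF hk u]])
      have "holder_bd UNIV (c * (D * M * (C ?p * K))) 2 (\<lambda>x. if x \<in> ?U then \<theta> k x * T k u x else 0)"
        unfolding c_def
      proof (rule holder_bd_extend_zero[OF open_ball closed_cball[of ?p "?r / 2"] _ _ _ 1])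
        show "cball ?p (?r / 2) \<subseteq> ?U" "0 < ?r / 2" using loc(1)[OF hk] by auto
        show "?r / 2 \<le> dist x y" if "x \<in> cball ?p (?r / 2)" "y \<notin> ?U" for x y
          using dist_triangle[of ?p y x] that by simp
        show "\<theta> k x * T k u x = 0" if "x \<notin> cball ?p (?r / 2)" for x
          using \<theta>out[OF k, of x] that by auto
      qed
      then show ?thesis
      proof (rule holder_bd_cong)
        fix x
        show "\<theta> k x * T k u x = (if x \<in> ?U then \<theta> k x * T k u x else 0)"
          using \<theta>out[OF k, of x] loc(1)[OF hk] by auto
      qed
    qed
    moreover have "0 \<le> c * (D * M * C ?p)"
      using D(1) holder_bd_nonneg[OF M] loc(2)[OF hk] by (simp add: c_def)
    ultimately show ?thesis
      by (intro exI[of _ "c * (D * M * C ?p)"]) (simp add: mult.assoc)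
  qed
  then obtain B where B: "\<And>k. k < n \<Longrightarrow> 0 \<le> B k" "\<And>k u K. k < n \<Longrightarrow> reflectable \<Omega> a b K u \<Longrightarrow>
      holder_bd UNIV (B k * K) 2 (\<lambda>x. \<theta> k x * T k u x)" by metis
  define C' where "C' = real n * (\<Sum>k<n. B k)"
  show thesis
  proof (rule that[of E S C'])
    show "E (\<lambda>x. u x + v x) x = E u x + E v x" for u v x
      unfolding E_def T_def sum.distrib[symmetric] by (rule sum.cong) (auto simp: algebra_simps)
    show "E (\<lambda>x. t * u x) x = t * E u x" for u t x
      unfolding E_def T_def sum_distrib_left by (rule sum.cong) auto
    show "E u x = u x" if "x \<in> closure \<Omega>" for u x
    proof -
      have "E u x = (\<Sum>k<n. \<theta> k x) * u x" using that by (simp add: E_def T_def sum_distrib_right)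
      then show ?thesis using \<theta>1[OF that] by simp
    qed
    show "\<bar>E u x\<bar> \<le> M" if u: "\<forall>y\<in>closure \<Omega>. \<bar>u y\<bar> \<le> M" and M: "0 \<le> M" for u M x
    proof -
      have "\<bar>\<theta> k x * T k u x\<bar> \<le> \<theta> k x * M" if k: "k < n" for k
      proof (cases "x \<in> ball (h k) (r (h k))")
        case True
        then have "\<bar>T k u x\<bar> \<le> M" using u loc(3)[OF hP[OF k]] by (auto simp: T_def)
        then show ?thesis using \<theta>nn[OF k] by (simp add: abs_mult mult_left_mono)
      next
        case False
        then have "\<theta> k x = 0" using loc(1)[OF hP[OF k]] by (intro \<theta>out[OF k]) auto
        then show ?thesis by simp
      qed
      then have "\<bar>E u x\<bar> \<le> (\<Sum>k<n. \<theta> k x * M)"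
        unfolding E_def by (intro order_trans[OF sum_abs] sum_mono) auto
      also have "\<dots> = (\<Sum>k<n. \<theta> k x) * M" by (simp add: sum_distrib_right)
      also have "\<dots> \<le> 1 * M" by (intro mult_right_mono \<theta>le M)
      finally show ?thesis by simp
    qed
    show "bounded S" unfolding S_def by auto
    show "E u x = 0" if "x \<notin> S" for u x
      unfolding E_def using that \<theta>out[of _ x] by (intro sum.neutral) (auto simp: S_def)
    show "0 \<le> C'" unfolding C'_def using B(1) by (intro mult_nonneg_nonneg sum_nonneg) auto
    show "holder_bd UNIV (C' * K) 2 (E u)" if u: "reflectable \<Omega> a b K u" for u K
    proof -
      have K: "0 \<le> K" using u holder_bd_nonneg unfolding reflectable_def by blast
      let ?B = "\<Sum>k<n. B k"
      have "holder_bd UNIV (?B * K) 2 (\<lambda>x. \<theta> k x * T k u x)" if k: "k < n" for k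
      proof (rule holder_bd_mono[OF B(2)[OF k u]])
        have "B k \<le> ?B" by (rule member_le_sum) (use k B(1) in auto)
        then show "B k * K \<le> ?B * K" using K by (rule mult_right_mono)
      qed
      moreover have "0 \<le> ?B * K" using K B(1) by (intro mult_nonneg_nonneg sum_nonneg) auto
      ultimately have "holder_bd UNIV (real (card {..<n}) * (?B * K)) 2 (\<lambda>x. \<Sum>k<n. \<theta> k x * T k u x)"
        by (intro holder_bd_sum) auto
      then show ?thesis unfolding E_def C'_def by (simp add: mult.assoc)
    qed
  qed
qed

end

theorem theorem3p9:
  fixes \<Omega> :: "(real^'n::finite) set" and \<alpha> lam :: real
    and a :: "'n \<Rightarrow> 'n \<Rightarrow> real^'n \<Rightarrow> real"
    and b :: "'n \<Rightarrow> real^'n \<Rightarrow> real"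
    and c :: "real^'n \<Rightarrow> real"
  assumes "0 < \<alpha>" and "\<alpha> \<le> 1"
    and "open \<Omega>" and "connected \<Omega>" and "\<Omega> \<noteq> {}" and "bounded \<Omega>"
    and "holder_boundary 4 \<alpha> \<Omega>"
    and "\<And>i j. C_holder_on 2 \<alpha> \<Omega> (a i j)"
    and "\<And>i. C_holder_on 2 \<alpha> \<Omega> (b i)"
    and "C_holder_on 0 \<alpha> \<Omega> c"
    and "lam > 0"
    and "\<And>x \<xi>. x \<in> \<Omega> \<Longrightarrow>
           (\<Sum>i\<in>UNIV. \<Sum>j\<in>UNIV. a i j x * \<xi> $ i * \<xi> $ j) \<ge> lam * (norm \<xi>)\<^sup>2"
  shows "\<exists>E :: (real^'n \<Rightarrow> real) \<Rightarrow> (real^'n \<Rightarrow> real).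
    (\<forall>u\<in>X_space \<alpha> \<Omega> a b c. E u \<in> holder_space_compact_support 2 \<alpha>) \<and>
    (\<forall>u\<in>X_space \<alpha> \<Omega> a b c. \<forall>v\<in>X_space \<alpha> \<Omega> a b c.
        E (\<lambda>x. u x + v x) = (\<lambda>x. E u x + E v x)) \<and>
    (\<forall>u\<in>X_space \<alpha> \<Omega> a b c. \<forall>r::real. E (\<lambda>x. r * u x) = (\<lambda>x. r * E u x)) \<and>
    (\<forall>u\<in>X_space \<alpha> \<Omega> a b c. \<forall>\<epsilon>>0. \<exists>\<delta>>0. \<forall>v\<in>X_space \<alpha> \<Omega> a b c.
        holder_norm 2 \<alpha> \<Omega> (\<lambda>x. v x - u x) < \<delta> \<longrightarrow>
        holder_norm 2 \<alpha> UNIV (\<lambda>x. E v x - E u x) < \<epsilon>) \<and>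
    (\<forall>u\<in>X_space \<alpha> \<Omega> a b c. \<forall>x\<in>closure \<Omega>. E u x = u x) \<and>
    (\<forall>u\<in>X_space \<alpha> \<Omega> a b c. (SUP x. \<bar>E u x\<bar>) = (SUP x\<in>closure \<Omega>. \<bar>u x\<bar>))"
proof -
  note \<alpha> = assms(1,2) and \<Omega> = \<open>open \<Omega>\<close> \<open>bounded \<Omega>\<close>
  have coeff: "\<exists>K. holder_bd \<alpha> \<Omega> K 2 f" if "C_holder_on 2 \<alpha> \<Omega> f" for f
    using C_holder_on_holder_bd_ex[OF \<alpha> that order_refl \<Omega>, of "[]" 2] by (simp add: partials_def)
  show ?thesis
  proof (rule global_extension[of \<alpha> \<Omega> a b lam])
    fix E :: "(real^'n \<Rightarrow> real) \<Rightarrow> real^'n \<Rightarrow> real" and C and S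
    assume add: "\<And>u v x. E (\<lambda>x. u x + v x) x = E u x + E v x"
    and scale: "\<And>u t x. E (\<lambda>x. t * u x) x = t * E u x"
    and ext: "\<And>u x. x \<in> closure \<Omega> \<Longrightarrow> E u x = u x"
    and bound: "\<And>u M x. \<forall>y\<in>closure \<Omega>. \<bar>u y\<bar> \<le> M \<Longrightarrow> 0 \<le> M \<Longrightarrow> \<bar>E u x\<bar> \<le> M"
    and S: "bounded S" "\<And>u x. x \<notin> S \<Longrightarrow> E u x = 0"
    and C: "0 \<le> C" "\<And>u K. reflectable \<alpha> \<Omega> a b K u \<Longrightarrow> holder_bd \<alpha> UNIV (C * K) 2 (E u)"
    have refl: "\<exists>K. reflectable \<alpha> \<Omega> a b K u" if "u \<in> X_space \<alpha> \<Omega> a b c" for u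
      by (rule X_space_reflectable[OF \<alpha> \<Omega> that]) (rule assms)+
    have diff: "E (\<lambda>x. v x - u x) x = E v x - E u x" for u v x
      using add[of v "\<lambda>x. - 1 * u x" x] scale[of "- 1" u x] by simp
    have "E u \<in> holder_space_compact_support 2 \<alpha>" if u: "u \<in> X_space \<alpha> \<Omega> a b c" for u
    proof -
      obtain K where "reflectable \<alpha> \<Omega> a b K u" using refl[OF u] by blast
      then have "E u \<in> holder_space 2 \<alpha> UNIV" by (intro holder_bd_UNIV_holder_space[OF \<alpha> C(2)])
      moreover have "bounded {x. E u x \<noteq> 0}" by (rule bounded_subset[OF S(1)]) (use S(2) in auto)
      ultimately show ?thesis by (simp add: holder_space_compact_support_def compact_closure)
    qed
    moreover have "\<exists>\<delta>>0. \<forall>v\<in>X_space \<alpha> \<Omega> a b c. holder_norm 2 \<alpha> \<Omega> (\<lambda>x. v x - u x) < \<delta> \<longrightarrow>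
          holder_norm 2 \<alpha> UNIV (\<lambda>x. E v x - E u x) < \<epsilon>"
      if u: "u \<in> X_space \<alpha> \<Omega> a b c" and \<epsilon>: "0 < \<epsilon>" for u \<epsilon>
    \<comment> \<open>The factor \<open>4\<close> is \<open>k + 2\<close> for \<open>k = 2\<close>, from comparing \<open>holder_norm\<close> with \<open>holder_bd\<close>.\<close>
    proof (intro exI[of _ "\<epsilon> / (4 * C + 1)"] conjI ballI impI)
      show "0 < \<epsilon> / (4 * C + 1)" using \<epsilon> C(1) by simp
      fix v assume v: "v \<in> X_space \<alpha> \<Omega> a b c"
        and small: "holder_norm 2 \<alpha> \<Omega> (\<lambda>x. v x - u x) < \<epsilon> / (4 * C + 1)"
      let ?N = "holder_norm 2 \<alpha> \<Omega> (\<lambda>x. v x - u x)"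
      obtain K M where "reflectable \<alpha> \<Omega> a b K v" "reflectable \<alpha> \<Omega> a b M u" using refl u v by blast
      then have w: "reflectable \<alpha> \<Omega> a b (K + M) (\<lambda>x. v x - u x)" by (rule reflectable_diff[OF \<alpha> \<Omega>(1)])
      then have "holder_bd \<alpha> UNIV (C * ?N) 2 (E (\<lambda>x. v x - u x))"
        by (intro C(2) reflectable_holder_norm[OF \<alpha> \<Omega>(1) assms(5)])
      then have "holder_bd \<alpha> UNIV (C * ?N) 2 (\<lambda>x. E v x - E u x)"
        by (rule holder_bd_cong[OF \<alpha>]) (simp add: diff)
      from holder_norm_bounds(4)[OF \<alpha> open_UNIV _ this]
      have "holder_norm 2 \<alpha> UNIV (\<lambda>x. E v x - E u x) \<le> 4 * (C * ?N)" by simp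
      also have "\<dots> \<le> (4 * C) * (\<epsilon> / (4 * C + 1))"
        using small C(1) by (simp only: mult.assoc) (intro mult_left_mono, auto)
      also have "\<dots> < \<epsilon>" using C(1) \<epsilon> by (simp add: field_simps)
      finally show "holder_norm 2 \<alpha> UNIV (\<lambda>x. E v x - E u x) < \<epsilon>" .
    qed
    moreover have "(SUP x. \<bar>E u x\<bar>) = (SUP x\<in>closure \<Omega>. \<bar>u x\<bar>)" if u: "u \<in> X_space \<alpha> \<Omega> a b c" for u
    proof (rule antisym)
      have ne: "closure \<Omega> \<noteq> {}" using assms(5) by simp
      have "continuous_on (closure \<Omega>) u"
        using u by (simp add: X_space_def holder_space_def C_holder_on_def)
      then have "compact ((\<lambda>x. \<bar>u x\<bar>) ` closure \<Omega>)"
        using \<Omega>(2) by (intro compact_continuous_image continuous_intros) (simp_all add: compact_closure)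
      then have bdd: "bdd_above ((\<lambda>x. \<bar>u x\<bar>) ` closure \<Omega>)"
        by (intro bounded_imp_bdd_above compact_imp_bounded)
      let ?M = "SUP x\<in>closure \<Omega>. \<bar>u x\<bar>"
      have uM: "\<bar>u y\<bar> \<le> ?M" if "y \<in> closure \<Omega>" for y by (rule cSUP_upper[OF that bdd])
      then have "0 \<le> ?M" using ne by (meson abs_ge_zero ex_in_conv order_trans)
      then have EM: "\<bar>E u x\<bar> \<le> ?M" for x using uM by (intro bound) auto
      then show "(SUP x. \<bar>E u x\<bar>) \<le> ?M" by (intro cSUP_least) auto
      have bddE: "bdd_above (range (\<lambda>x. \<bar>E u x\<bar>))" using EM by (intro bdd_aboveI[of _ ?M]) auto
      show "?M \<le> (SUP x. \<bar>E u x\<bar>)"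
      proof (rule cSUP_least[OF ne])
        fix x assume "x \<in> closure \<Omega>"
        then have "\<bar>u x\<bar> = \<bar>E u x\<bar>" by (simp add: ext)
        also have "\<dots> \<le> (SUP x. \<bar>E u x\<bar>)" by (rule cSUP_upper[OF UNIV_I bddE])
        finally show "\<bar>u x\<bar> \<le> (SUP x. \<bar>E u x\<bar>)" .
      qed
    qed
    ultimately show ?thesis
      using ext by (intro exI[of _ E] conjI ballI allI impI ext) (auto simp: add scale)
  qed (rule assms coeff | assumption)+
qed

end
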